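(* For every $n\ge 1$, $\dim_{\mathbb{C}}H^n(\mathbb{Z}^n,C^*_{red}(\mathbb{Z}^n))=\infty$.
   Context: For a group $G$, $C^*_{red}(G)$ is the completion of the group ring $\mathbb{C}G$ in the operator norm $\|\alpha\|_{op}=\sup\{\|\alpha\cdot\beta\|_2:\beta\in L^2(G),\ \|\beta\|_2=1\}$, where $L^2(G)$ is the Hilbert space of formal sums $\sum_{g\in G}a_g g$ with $\sum_g|a_g|^2<\infty$ and $\mathbb{C}G$ acts by left multiplication; $G$ acts on $C^*_{red}(G)$ by left multiplication. $H^n(G,M)$ denotes usual group cohomology: for a projective resolution $\cdots\to P_1\to P_0$ of the trivial module $\mathbb{Z}$ by $\mathbb{Z}G$-modules, it is the $n$-th cohomology of the complex $\mathrm{Hom}_{\mathbb{Z}G}(P_\bullet,M)$; it is a $\mathbb{C}$-vector space when $M$ is one with $G$ acting $\mathbb{C}$-linearly. *)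

theory Defs
  imports
    "HOL-Analysis.Infinite_Sum"
    "HOL-Algebra.Product_Groups"
    "HOL-Algebra.Algebraic_Closure_Type"
    "Jordan_Normal_Form.Missing_VectorSpace"
begin

section \<open>Modules over a ring that need not be commutative\<close>

locale left_module = R?: ring R + M?: abelian_group M
  for R :: "('r, 's) ring_scheme" (structure) and M :: "('r, 'm, 'x) module_scheme" (structure) +
  assumes smult_closed [simp, intro]:
      "\<lbrakk>a \<in> carrier R; x \<in> carrier M\<rbrakk> \<Longrightarrow> a \<odot>\<^bsub>M\<^esub> x \<in> carrier M"
    and smult_l_distr:
      "\<lbrakk>a \<in> carrier R; b \<in> carrier R; x \<in> carrier M\<rbrakk> \<Longrightarrow>
        (a \<oplus>\<^bsub>R\<^esub> b) \<odot>\<^bsub>M\<^esub> x = a \<odot>\<^bsub>M\<^esub> x \<oplus>\<^bsub>M\<^esub> b \<odot>\<^bsub>M\<^esub> x"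
    and smult_r_distr:
      "\<lbrakk>a \<in> carrier R; x \<in> carrier M; y \<in> carrier M\<rbrakk> \<Longrightarrow>
        a \<odot>\<^bsub>M\<^esub> (x \<oplus>\<^bsub>M\<^esub> y) = a \<odot>\<^bsub>M\<^esub> x \<oplus>\<^bsub>M\<^esub> a \<odot>\<^bsub>M\<^esub> y"
    and smult_assoc1:
      "\<lbrakk>a \<in> carrier R; b \<in> carrier R; x \<in> carrier M\<rbrakk> \<Longrightarrow>
        (a \<otimes>\<^bsub>R\<^esub> b) \<odot>\<^bsub>M\<^esub> x = a \<odot>\<^bsub>M\<^esub> (b \<odot>\<^bsub>M\<^esub> x)"
    and smult_one [simp]:
      "x \<in> carrier M \<Longrightarrow> \<one>\<^bsub>R\<^esub> \<odot>\<^bsub>M\<^esub> x = x"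

text \<open>
  The lifting property. HOL cannot quantify over types inside a definition, so the test modules
  \<open>A\<close> and \<open>B\<close> are taken with elements in fixed types, large enough to contain the free module
  on the elements of \<open>P\<close>. Lemma \<open>projective_lift\<close> below shows that the lifting property then holds
  for test modules over arbitrary types.
\<close>

definition projective :: "('r, 's) ring_scheme \<Rightarrow> ('r, 'p, 't) module_scheme \<Rightarrow> bool" where
  "projective R P \<longleftrightarrow> left_module R P \<and>
    (\<forall>(A :: ('r, 'p \<Rightarrow> 'r) module) (B :: ('r, 'p) module) e f.
      left_module R A \<and> left_module R B \<and>
      e \<in> LinearCombinations.module_hom R A B \<and> e ` carrier A = carrier B \<and>
      f \<in> LinearCombinations.module_hom R P B \<longrightarrow>
      (\<exists>h \<in> LinearCombinations.module_hom R P A. \<forall>x \<in> carrier P. e (h x) = f x))"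


definition free_module :: "('r, 's) ring_scheme \<Rightarrow> 'x set \<Rightarrow> ('r, 'x \<Rightarrow> 'r) module" where
  "free_module R I =
    \<lparr>carrier = {\<phi>. (\<forall>x. \<phi> x \<in> carrier R) \<and> {x. \<phi> x \<noteq> \<zero>\<^bsub>R\<^esub>} \<subseteq> I \<and> finite {x. \<phi> x \<noteq> \<zero>\<^bsub>R\<^esub>}},
     monoid.mult = undefined, one = undefined,
     ring.zero = (\<lambda>x. \<zero>\<^bsub>R\<^esub>),
     add = (\<lambda>\<phi> \<psi> x. \<phi> x \<oplus>\<^bsub>R\<^esub> \<psi> x),
     module.smult = (\<lambda>a \<phi> x. a \<otimes>\<^bsub>R\<^esub> \<phi> x)\<rparr>"

definition linear_extension ::
    "('r, 's) ring_scheme \<Rightarrow> ('r, 'm, 't) module_scheme \<Rightarrow> ('x \<Rightarrow> 'm) \<Rightarrow> ('x \<Rightarrow> 'r) \<Rightarrow> 'm" where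
  "linear_extension R M u \<phi> = (\<Oplus>\<^bsub>M\<^esub>x \<in> {x. \<phi> x \<noteq> \<zero>\<^bsub>R\<^esub>}. \<phi> x \<odot>\<^bsub>M\<^esub> u x)"

lemma left_module_free_module:
  assumes "ring R"
  shows "left_module R (free_module R I)" (is "left_module R ?F")
proof -
  interpret ring R by fact
  have add: "\<phi> \<oplus>\<^bsub>?F\<^esub> \<psi> \<in> carrier ?F" if "\<phi> \<in> carrier ?F" "\<psi> \<in> carrier ?F" for \<phi> \<psi>
  proof -
    have "{x. \<phi> x \<oplus>\<^bsub>R\<^esub> \<psi> x \<noteq> \<zero>\<^bsub>R\<^esub>} \<subseteq> {x. \<phi> x \<noteq> \<zero>\<^bsub>R\<^esub>} \<union> {x. \<psi> x \<noteq> \<zero>\<^bsub>R\<^esub>}" by auto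
    then have "finite {x. \<phi> x \<oplus>\<^bsub>R\<^esub> \<psi> x \<noteq> \<zero>\<^bsub>R\<^esub>}"
      by (rule finite_subset) (use that in \<open>simp add: free_module_def\<close>)
    moreover have "\<phi> x \<oplus>\<^bsub>R\<^esub> \<psi> x = \<zero>\<^bsub>R\<^esub>" if "x \<notin> I" for x
    proof -
      have "\<phi> x = \<zero>\<^bsub>R\<^esub>" "\<psi> x = \<zero>\<^bsub>R\<^esub>"
        using \<open>\<phi> \<in> carrier ?F\<close> \<open>\<psi> \<in> carrier ?F\<close> that by (auto simp: free_module_def)
      then show ?thesis by simp
    qed
    ultimately show ?thesis using that by (auto simp: free_module_def)
  qed
  have smult: "a \<odot>\<^bsub>?F\<^esub> \<phi> \<in> carrier ?F" if "a \<in> carrier R" "\<phi> \<in> carrier ?F" for a \<phi>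
  proof -
    have "{x. a \<otimes>\<^bsub>R\<^esub> \<phi> x \<noteq> \<zero>\<^bsub>R\<^esub>} \<subseteq> {x. \<phi> x \<noteq> \<zero>\<^bsub>R\<^esub>}" using that by auto
    then have "finite {x. a \<otimes>\<^bsub>R\<^esub> \<phi> x \<noteq> \<zero>\<^bsub>R\<^esub>}"
      by (rule finite_subset) (use that in \<open>simp add: free_module_def\<close>)
    moreover have "a \<otimes>\<^bsub>R\<^esub> \<phi> x = \<zero>\<^bsub>R\<^esub>" if "x \<notin> I" for x
    proof -
      have "\<phi> x = \<zero>\<^bsub>R\<^esub>"
        using \<open>\<phi> \<in> carrier ?F\<close> that by (auto simp: free_module_def)
      then show ?thesis using \<open>a \<in> carrier R\<close> by simp
    qed
    ultimately show ?thesis using that by (auto simp: free_module_def)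
  qed
  have "abelian_group ?F"
  proof (intro abelian_groupI)
    show "\<exists>y\<in>carrier ?F. y \<oplus>\<^bsub>?F\<^esub> x = \<zero>\<^bsub>?F\<^esub>" if "x \<in> carrier ?F" for x
    proof (intro bexI[of _ "(\<ominus>\<^bsub>R\<^esub> \<one>\<^bsub>R\<^esub>) \<odot>\<^bsub>?F\<^esub> x"])
      show "(\<ominus>\<^bsub>R\<^esub> \<one>\<^bsub>R\<^esub>) \<odot>\<^bsub>?F\<^esub> x \<in> carrier ?F" using smult that by simp
      show "(\<ominus>\<^bsub>R\<^esub> \<one>\<^bsub>R\<^esub>) \<odot>\<^bsub>?F\<^esub> x \<oplus>\<^bsub>?F\<^esub> x = \<zero>\<^bsub>?F\<^esub>"
        using that by (auto simp: free_module_def l_minus l_neg)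
    qed
  qed (use add in \<open>auto simp: free_module_def a_ac\<close>)
  then show ?thesis
    unfolding left_module_def left_module_axioms_def
    using assms smult
    by (auto simp: free_module_def l_distr r_distr m_assoc)
qed

lemma (in left_module) smult_l_null:
  assumes "x \<in> carrier M"
  shows "\<zero>\<^bsub>R\<^esub> \<odot>\<^bsub>M\<^esub> x = \<zero>\<^bsub>M\<^esub>"
proof -
  have "\<zero>\<^bsub>R\<^esub> \<odot>\<^bsub>M\<^esub> x \<oplus>\<^bsub>M\<^esub> \<zero>\<^bsub>R\<^esub> \<odot>\<^bsub>M\<^esub> x = (\<zero>\<^bsub>R\<^esub> \<oplus>\<^bsub>R\<^esub> \<zero>\<^bsub>R\<^esub>) \<odot>\<^bsub>M\<^esub> x"
    using assms by (intro smult_l_distr[symmetric]) auto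
  then show ?thesis using assms by simp
qed

lemma (in left_module) smult_r_null:
  assumes "a \<in> carrier R"
  shows "a \<odot>\<^bsub>M\<^esub> \<zero>\<^bsub>M\<^esub> = \<zero>\<^bsub>M\<^esub>"
proof -
  have "a \<odot>\<^bsub>M\<^esub> \<zero>\<^bsub>M\<^esub> \<oplus>\<^bsub>M\<^esub> a \<odot>\<^bsub>M\<^esub> \<zero>\<^bsub>M\<^esub> = a \<odot>\<^bsub>M\<^esub> (\<zero>\<^bsub>M\<^esub> \<oplus>\<^bsub>M\<^esub> \<zero>\<^bsub>M\<^esub>)"
    using assms by (intro smult_r_distr[symmetric]) auto
  then show ?thesis using assms by simp
qed

lemma (in left_module) linear_extension_superset:
  assumes "\<phi> \<in> carrier (free_module R I)" "u \<in> I \<rightarrow> carrier M"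
    and "finite F" "{x. \<phi> x \<noteq> \<zero>\<^bsub>R\<^esub>} \<subseteq> F" "F \<subseteq> I"
  shows "linear_extension R M u \<phi> = (\<Oplus>\<^bsub>M\<^esub>x \<in> F. \<phi> x \<odot>\<^bsub>M\<^esub> u x)"
  unfolding linear_extension_def
  using assms by (intro M.add.finprod_mono_neutral_cong_left)
    (auto simp: free_module_def Pi_iff smult_l_null subset_iff)

lemma (in left_module) linear_extension_hom:
  assumes u: "u \<in> I \<rightarrow> carrier M"
  shows "linear_extension R M u \<in> LinearCombinations.module_hom R (free_module R I) M"
    (is "_ \<in> LinearCombinations.module_hom R ?F M")
  unfolding LinearCombinations.module_hom_def
proof (intro CollectI conjI allI impI)
  interpret F: left_module R ?F by (rule left_module_free_module) (rule R.ring_axioms)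
  have closed: "\<phi> x \<odot>\<^bsub>M\<^esub> u x \<in> carrier M" if "\<phi> \<in> carrier ?F" "x \<in> I" for \<phi> x
    using that u by (auto simp: free_module_def)
  show "linear_extension R M u \<in> carrier ?F \<rightarrow> carrier M"
    unfolding linear_extension_def using closed
    by (auto intro!: M.finsum_closed simp: free_module_def subset_iff Pi_iff)
  fix \<phi> \<psi> assume *: "\<phi> \<in> carrier ?F \<and> \<psi> \<in> carrier ?F"
  define S where "S = {x. \<phi> x \<noteq> \<zero>\<^bsub>R\<^esub>} \<union> {x. \<psi> x \<noteq> \<zero>\<^bsub>R\<^esub>}"
  have S: "finite S" "S \<subseteq> I" using * by (auto simp: S_def free_module_def)
  have "linear_extension R M u (\<phi> \<oplus>\<^bsub>?F\<^esub> \<psi>) = (\<Oplus>\<^bsub>M\<^esub>x \<in> S. (\<phi> \<oplus>\<^bsub>?F\<^esub> \<psi>) x \<odot>\<^bsub>M\<^esub> u x)"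
    by (rule linear_extension_superset[OF _ u S(1) _ S(2)])
      (use * in \<open>auto simp: S_def\<close>, auto simp: free_module_def)
  also have "\<dots> = (\<Oplus>\<^bsub>M\<^esub>x \<in> S. \<phi> x \<odot>\<^bsub>M\<^esub> u x \<oplus>\<^bsub>M\<^esub> \<psi> x \<odot>\<^bsub>M\<^esub> u x)"
  proof (rule M.finsum_cong'[OF refl])
    show "(\<lambda>x. \<phi> x \<odot>\<^bsub>M\<^esub> u x \<oplus>\<^bsub>M\<^esub> \<psi> x \<odot>\<^bsub>M\<^esub> u x) \<in> S \<rightarrow> carrier M"
      using closed * S by auto
    fix x assume "x \<in> S"
    then have "u x \<in> carrier M" "\<phi> x \<in> carrier R" "\<psi> x \<in> carrier R"
      using S u * by (auto simp: free_module_def)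
    then show "(\<phi> \<oplus>\<^bsub>?F\<^esub> \<psi>) x \<odot>\<^bsub>M\<^esub> u x = \<phi> x \<odot>\<^bsub>M\<^esub> u x \<oplus>\<^bsub>M\<^esub> \<psi> x \<odot>\<^bsub>M\<^esub> u x"
      by (simp add: free_module_def smult_l_distr)
  qed
  also have "\<dots> = (\<Oplus>\<^bsub>M\<^esub>x \<in> S. \<phi> x \<odot>\<^bsub>M\<^esub> u x) \<oplus>\<^bsub>M\<^esub> (\<Oplus>\<^bsub>M\<^esub>x \<in> S. \<psi> x \<odot>\<^bsub>M\<^esub> u x)"
    using closed * S by (intro M.finsum_addf) auto
  also have "\<dots> = linear_extension R M u \<phi> \<oplus>\<^bsub>M\<^esub> linear_extension R M u \<psi>"
    using * by (auto simp: linear_extension_superset[OF _ u S(1) _ S(2)] S_def)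
  finally show "linear_extension R M u (\<phi> \<oplus>\<^bsub>?F\<^esub> \<psi>)
    = linear_extension R M u \<phi> \<oplus>\<^bsub>M\<^esub> linear_extension R M u \<psi>" .
next
  interpret F: left_module R ?F by (rule left_module_free_module) (rule R.ring_axioms)
  fix r \<phi> assume *: "r \<in> carrier R \<and> \<phi> \<in> carrier ?F"
  define S where "S = {x. \<phi> x \<noteq> \<zero>\<^bsub>R\<^esub>}"
  have S: "finite S" "S \<subseteq> I" using * by (auto simp: S_def free_module_def)
  have in_M: "\<phi> x \<odot>\<^bsub>M\<^esub> u x \<in> carrier M" "u x \<in> carrier M" "\<phi> x \<in> carrier R" if "x \<in> S" for x
    using that * u S by (auto simp: free_module_def)
  have smult_sum: "r \<odot>\<^bsub>M\<^esub> (\<Oplus>\<^bsub>M\<^esub>x \<in> T. \<phi> x \<odot>\<^bsub>M\<^esub> u x) = (\<Oplus>\<^bsub>M\<^esub>x \<in> T. r \<odot>\<^bsub>M\<^esub> (\<phi> x \<odot>\<^bsub>M\<^esub> u x))"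
    if "T \<subseteq> S" for T
    using finite_subset[OF that S(1)] that
  proof (induction T rule: finite_induct)
    case empty
    then show ?case using * by (simp add: smult_r_null)
  next
    case (insert x T)
    have "(\<lambda>x. \<phi> x \<odot>\<^bsub>M\<^esub> u x) \<in> T \<rightarrow> carrier M" "(\<lambda>x. r \<odot>\<^bsub>M\<^esub> (\<phi> x \<odot>\<^bsub>M\<^esub> u x)) \<in> T \<rightarrow> carrier M"
      using insert.prems in_M(1) * by auto
    moreover have "\<phi> x \<odot>\<^bsub>M\<^esub> u x \<in> carrier M" using insert.prems in_M(1) by auto
    ultimately show ?case
      using insert * by (simp add: smult_r_distr)
  qed
  have "linear_extension R M u (r \<odot>\<^bsub>?F\<^esub> \<phi>) = (\<Oplus>\<^bsub>M\<^esub>x \<in> S. (r \<odot>\<^bsub>?F\<^esub> \<phi>) x \<odot>\<^bsub>M\<^esub> u x)"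
    by (rule linear_extension_superset[OF _ u S(1) _ S(2)])
      (use * in \<open>auto simp: S_def\<close>, auto simp: free_module_def)
  also have "\<dots> = (\<Oplus>\<^bsub>M\<^esub>x \<in> S. r \<odot>\<^bsub>M\<^esub> (\<phi> x \<odot>\<^bsub>M\<^esub> u x))"
    using in_M * by (intro M.finsum_cong'[OF refl]) (auto simp: free_module_def smult_assoc1)
  also have "\<dots> = r \<odot>\<^bsub>M\<^esub> linear_extension R M u \<phi>"
    using smult_sum[OF subset_refl] by (simp add: linear_extension_def S_def)
  finally show "linear_extension R M u (r \<odot>\<^bsub>?F\<^esub> \<phi>) = r \<odot>\<^bsub>M\<^esub> linear_extension R M u \<phi>" .
qed

lemma linear_extension_unit:
  assumes "left_module R M" "u \<in> I \<rightarrow> carrier M" "x \<in> I"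
  shows "(\<lambda>y. if y = x then \<one>\<^bsub>R\<^esub> else \<zero>\<^bsub>R\<^esub>) \<in> carrier (free_module R I)"
    and "linear_extension R M u (\<lambda>y. if y = x then \<one>\<^bsub>R\<^esub> else \<zero>\<^bsub>R\<^esub>) = u x"
proof -
  interpret left_module R M by fact
  show *: "(\<lambda>y. if y = x then \<one>\<^bsub>R\<^esub> else \<zero>\<^bsub>R\<^esub>) \<in> carrier (free_module R I)"
    using assms(3) by (auto simp: free_module_def)
  have ux: "u x \<in> carrier M" using assms by auto
  have "linear_extension R M u (\<lambda>y. if y = x then \<one>\<^bsub>R\<^esub> else \<zero>\<^bsub>R\<^esub>)
      = (\<Oplus>\<^bsub>M\<^esub>y \<in> {x}. (if y = x then \<one>\<^bsub>R\<^esub> else \<zero>\<^bsub>R\<^esub>) \<odot>\<^bsub>M\<^esub> u y)"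
    by (rule linear_extension_superset[OF * assms(2)]) (use assms(3) in auto)
  then show "linear_extension R M u (\<lambda>y. if y = x then \<one>\<^bsub>R\<^esub> else \<zero>\<^bsub>R\<^esub>) = u x"
    using ux by simp
qed

lemma module_hom_linear_extension:
  assumes "left_module R M" "left_module R N" "e \<in> LinearCombinations.module_hom R M N"
    and u: "u \<in> I \<rightarrow> carrier M" and \<phi>: "\<phi> \<in> carrier (free_module R I)"
  shows "e (linear_extension R M u \<phi>) = linear_extension R N (\<lambda>x. e (u x)) \<phi>"
proof -
  interpret M: left_module R M by fact
  interpret N: left_module R N by fact
  have e: "e x \<in> carrier N" "e (x \<oplus>\<^bsub>M\<^esub> y) = e x \<oplus>\<^bsub>N\<^esub> e y" "e (r \<odot>\<^bsub>M\<^esub> x) = r \<odot>\<^bsub>N\<^esub> e x"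
    if "x \<in> carrier M" "y \<in> carrier M" "r \<in> carrier R" for x y r
    using assms(3) that by (auto simp: LinearCombinations.module_hom_def)
  have e0: "e \<zero>\<^bsub>M\<^esub> = \<zero>\<^bsub>N\<^esub>"
    using e(3)[of "\<zero>\<^bsub>M\<^esub>" "\<zero>\<^bsub>M\<^esub>" "\<zero>\<^bsub>R\<^esub>"] e(1)[of "\<zero>\<^bsub>M\<^esub>" "\<zero>\<^bsub>M\<^esub>" "\<zero>\<^bsub>R\<^esub>"]
    by (simp add: M.smult_l_null N.smult_l_null)
  define S where "S = {x. \<phi> x \<noteq> \<zero>\<^bsub>R\<^esub>}"
  have S: "finite S" "S \<subseteq> I" using \<phi> by (auto simp: S_def free_module_def)
  have in_M: "\<phi> x \<odot>\<^bsub>M\<^esub> u x \<in> carrier M" "u x \<in> carrier M" "\<phi> x \<in> carrier R"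
    "e (u x) \<in> carrier N" if "x \<in> S" for x
    using that \<phi> u S e(1)[of "u x" "u x" "\<zero>\<^bsub>R\<^esub>"] by (auto simp: free_module_def)
  have "e (\<Oplus>\<^bsub>M\<^esub>x \<in> T. \<phi> x \<odot>\<^bsub>M\<^esub> u x) = (\<Oplus>\<^bsub>N\<^esub>x \<in> T. \<phi> x \<odot>\<^bsub>N\<^esub> e (u x))" if "T \<subseteq> S" for T
    using finite_subset[OF that S(1)] that
  proof (induction T rule: finite_induct)
    case empty
    then show ?case by (simp add: e0)
  next
    case (insert x T)
    have "(\<lambda>x. \<phi> x \<odot>\<^bsub>M\<^esub> u x) \<in> T \<rightarrow> carrier M" "(\<lambda>x. \<phi> x \<odot>\<^bsub>N\<^esub> e (u x)) \<in> T \<rightarrow> carrier N"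
      using insert.prems in_M by auto
    moreover have "\<phi> x \<odot>\<^bsub>M\<^esub> u x \<in> carrier M" "u x \<in> carrier M" "\<phi> x \<in> carrier R"
      "e (u x) \<in> carrier N" using insert.prems in_M by auto
    ultimately show ?case
      using insert by (simp add: e)
  qed
  from this[OF subset_refl] show ?thesis by (simp add: linear_extension_def S_def)
qed

lemma projective_lift:
  fixes A :: "('r, 'a, 'x) module_scheme" and B :: "('r, 'b, 'y) module_scheme"
    and P :: "('r, 'p, 't) module_scheme"
  assumes P: "projective R P" and A: "left_module R A" and B: "left_module R B"
    and e: "e \<in> LinearCombinations.module_hom R A B" "e ` carrier A = carrier B"
    and f: "f \<in> LinearCombinations.module_hom R P B"
  shows "\<exists>h \<in> LinearCombinations.module_hom R P A. \<forall>x \<in> carrier P. e (h x) = f x"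
proof -
  interpret P: left_module R P using P by (simp add: projective_def)
  interpret A: left_module R A by fact
  define F where "F = free_module R (carrier P)"
  define P' :: "('r, 'p) module" where "P' =
    \<lparr>carrier = carrier P, monoid.mult = undefined, one = undefined, ring.zero = ring.zero P,
     add = add P, module.smult = module.smult P\<rparr>"
  have F: "left_module R F"
    unfolding F_def by (rule left_module_free_module) (rule P.R.ring_axioms)
  have "abelian_group P'"
    by (intro abelian_groupI) (auto simp: P'_def P.M.a_ac intro: P.M.l_neg)
  then have P': "left_module R P'"
    unfolding left_module_def left_module_axioms_def
    by (auto simp: P'_def P.R.ring_axioms P.smult_l_distr P.smult_r_distr P.smult_assoc1)
  have id_funcset: "(\<lambda>x. x) \<in> carrier P \<rightarrow> carrier P" by simp
  define c where "c = linear_extension R P (\<lambda>x. x)"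
  have c: "c \<in> LinearCombinations.module_hom R F P"
    unfolding c_def F_def by (rule P.linear_extension_hom) simp
  then have c': "c \<in> LinearCombinations.module_hom R F P'"
    by (simp add: LinearCombinations.module_hom_def P'_def)
  have "c ` carrier F = carrier P'"
  proof
    show "c ` carrier F \<subseteq> carrier P'" using c' by (auto simp: LinearCombinations.module_hom_def)
    show "carrier P' \<subseteq> c ` carrier F"
    proof
      fix x assume "x \<in> carrier P'"
      then have "x \<in> carrier P" by (simp add: P'_def)
      from linear_extension_unit[OF P.left_module_axioms id_funcset this]
      show "x \<in> c ` carrier F" unfolding c_def F_def by force
    qed
  qed
  moreover have "(\<lambda>x. x) \<in> LinearCombinations.module_hom R P P'"
    by (auto simp: LinearCombinations.module_hom_def P'_def)
  ultimately obtain s where s: "s \<in> LinearCombinations.module_hom R P F"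
      and cs: "\<And>x. x \<in> carrier P \<Longrightarrow> c (s x) = x"
    using P[unfolded projective_def, THEN conjunct2, rule_format, of F P' c "\<lambda>x. x"] F P' c'
    by blast
  have "\<forall>x\<in>carrier P. \<exists>y\<in>carrier A. e y = f x"
  proof
    fix x assume "x \<in> carrier P"
    then have "f x \<in> e ` carrier A"
      using f unfolding e(2) by (auto simp: LinearCombinations.module_hom_def)
    then show "\<exists>y\<in>carrier A. e y = f x" by auto
  qed
  then obtain u where u: "u \<in> carrier P \<rightarrow> carrier A" and eu: "\<And>x. x \<in> carrier P \<Longrightarrow> e (u x) = f x"
    by (metis Pi_I)
  define h where "h = linear_extension R A u \<circ> s"
  have le: "linear_extension R A u \<in> LinearCombinations.module_hom R F A"
    unfolding F_def by (rule A.linear_extension_hom[OF u])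
  have "h \<in> LinearCombinations.module_hom R P A"
    using s le by (auto simp: LinearCombinations.module_hom_def h_def Pi_iff)
  moreover have "e (h x) = f x" if x: "x \<in> carrier P" for x
  proof -
    have sx: "s x \<in> carrier (free_module R (carrier P))"
      using s x by (auto simp: LinearCombinations.module_hom_def F_def)
    have "e (h x) = linear_extension R B (\<lambda>y. e (u y)) (s x)"
      using module_hom_linear_extension[OF A B e(1) u sx] by (simp add: h_def)
    also have "\<dots> = linear_extension R B (\<lambda>y. f y) (s x)"
    proof -
      have "{y. s x y \<noteq> \<zero>\<^bsub>R\<^esub>} \<subseteq> carrier P" using sx by (simp add: free_module_def)
      moreover have "f y \<in> carrier B" if "y \<in> carrier P" for y
        using f that by (auto simp: LinearCombinations.module_hom_def)
      moreover have "s x y \<in> carrier R" for y using sx by (simp add: free_module_def)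
      ultimately show ?thesis
        unfolding linear_extension_def
        using B eu unfolding left_module_def left_module_axioms_def
        by (intro abelian_monoid.finsum_cong') (auto simp: abelian_group.axioms subset_iff)
    qed
    also have "\<dots> = f (c (s x))"
      using module_hom_linear_extension[OF P.left_module_axioms B f id_funcset sx]
      by (simp add: c_def)
    finally show ?thesis using cs x by simp
  qed
  ultimately show ?thesis by blast
qed


section \<open>Group rings\<close>

text \<open>
  A formal sum of group elements is its coefficient function, which vanishes off the carrier.
  The product is also used when only the left factor has finite support.
\<close>

definition convolution ::
    "('g, 'x) monoid_scheme \<Rightarrow> ('g \<Rightarrow> 'a::comm_ring_1) \<Rightarrow> ('g \<Rightarrow> 'a) \<Rightarrow> 'g \<Rightarrow> 'a" where
  "convolution G a b = (\<lambda>g. if g \<in> carrier G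
     then \<Sum>h \<in> {h \<in> carrier G. a h \<noteq> 0}. a h * b (inv\<^bsub>G\<^esub> h \<otimes>\<^bsub>G\<^esub> g) else 0)"

definition group_ring :: "('g, 'x) monoid_scheme \<Rightarrow> ('g \<Rightarrow> 'a::comm_ring_1) ring" where
  "group_ring G =
    \<lparr>carrier = {a. finite {g. a g \<noteq> 0} \<and> {g. a g \<noteq> 0} \<subseteq> carrier G},
     monoid.mult = convolution G,
     one = (\<lambda>g. if g = \<one>\<^bsub>G\<^esub> then 1 else 0),
     ring.zero = (\<lambda>g. 0),
     add = (\<lambda>a b g. a g + b g)\<rparr>"

lemma convolution_superset:
  assumes "finite F" "{h. a h \<noteq> 0} \<subseteq> F" "F \<subseteq> carrier G" "g \<in> carrier G"
  shows "convolution G a b g = (\<Sum>h \<in> F. a h * b (inv\<^bsub>G\<^esub> h \<otimes>\<^bsub>G\<^esub> g))"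
  unfolding convolution_def using assms by (auto intro!: sum.mono_neutral_left)

lemma convolution_outside: "g \<notin> carrier G \<Longrightarrow> convolution G a b g = 0"
  by (simp add: convolution_def)

lemma carrier_group_ring:
  "a \<in> carrier (group_ring G) \<longleftrightarrow> finite {g. a g \<noteq> 0} \<and> {g. a g \<noteq> 0} \<subseteq> carrier G"
  by (simp add: group_ring_def)

context
  fixes G :: "('g, 'x) monoid_scheme" (structure)
  assumes G: "Group.group G"
begin

interpretation Group.group G by (fact G)

lemma convolution_support:
  fixes a b :: "'g \<Rightarrow> 'a::comm_ring_1"
  assumes "a \<in> carrier (group_ring G)" "b \<in> carrier (group_ring G)"
  shows "{g. convolution G a b g \<noteq> 0}
    \<subseteq> (\<lambda>(h, k). h \<otimes> k) ` ({g. a g \<noteq> 0} \<times> {g. b g \<noteq> 0})"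
proof
  fix g assume "g \<in> {g. convolution G a b g \<noteq> 0}"
  then have g: "g \<in> carrier G" 
    and nz: "(\<Sum>h \<in> {h \<in> carrier G. a h \<noteq> 0}. a h * b (inv h \<otimes> g)) \<noteq> 0"
    by (auto simp: convolution_def split: if_splits)
  obtain h where "h \<in> {h \<in> carrier G. a h \<noteq> 0}" "a h * b (inv h \<otimes> g) \<noteq> 0"
    using sum.not_neutral_contains_not_neutral[OF nz] by blast
  then have h: "h \<in> carrier G" "a h \<noteq> 0" "b (inv h \<otimes> g) \<noteq> 0" by auto
  have "g = h \<otimes> (inv h \<otimes> g)" using g h by (simp add: m_assoc[symmetric])
  then show "g \<in> (\<lambda>(h, k). h \<otimes> k) ` ({g. a g \<noteq> 0} \<times> {g. b g \<noteq> 0})"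
    using h by force
qed

lemma convolution_closed:
  fixes a b :: "'g \<Rightarrow> 'a::comm_ring_1"
  assumes "a \<in> carrier (group_ring G)" "b \<in> carrier (group_ring G)"
  shows "convolution G a b \<in> carrier (group_ring G)"
proof -
  have "finite {g. convolution G a b g \<noteq> 0}"
    using assms by (intro finite_subset[OF convolution_support[OF assms]]) (auto simp: carrier_group_ring)
  then show ?thesis
    by (auto simp: carrier_group_ring convolution_def split: if_splits)
qed

lemma convolution_assoc:
  fixes a b c :: "'g \<Rightarrow> 'a::comm_ring_1"
  assumes a: "a \<in> carrier (group_ring G)" and b: "b \<in> carrier (group_ring G)"
  shows "convolution G (convolution G a b) c = convolution G a (convolution G b c)"
proof
  fix g
  show "convolution G (convolution G a b) c g = convolution G a (convolution G b c) g"
  proof (cases "g \<in> carrier G")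
    case g: True
    define A where "A = {g. a g \<noteq> 0}"
    define B where "B = {g. b g \<noteq> 0}"
    define K where "K = (\<lambda>(h, k). h \<otimes> k) ` (A \<times> B)"
    have A: "finite A" "A \<subseteq> carrier G" and B: "finite B" "B \<subseteq> carrier G"
      using a b by (auto simp: A_def B_def carrier_group_ring)
    have K: "finite K" "K \<subseteq> carrier G"
      using A B by (auto simp: K_def)
    have "convolution G (convolution G a b) c g
        = (\<Sum>k\<in>K. convolution G a b k * c (inv k \<otimes> g))"
      using convolution_support[OF a b] K g
      by (intro convolution_superset) (auto simp: K_def A_def B_def)
    also have "\<dots> = (\<Sum>k\<in>K. \<Sum>h\<in>A. a h * b (inv h \<otimes> k) * c (inv k \<otimes> g))"
      using K A by (intro sum.cong refl)
        (auto simp: convolution_superset[of A a] A_def sum_distrib_right)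
    also have "\<dots> = (\<Sum>h\<in>A. \<Sum>k\<in>K. a h * b (inv h \<otimes> k) * c (inv k \<otimes> g))"
      by (rule sum.swap)
    also have "\<dots> = (\<Sum>h\<in>A. a h * convolution G b c (inv h \<otimes> g))"
    proof (rule sum.cong[OF refl])
      fix h assume hA: "h \<in> A"
      then have h: "h \<in> carrier G" using A by auto
      have inj: "inj_on ((\<otimes>) h) B"
        using B h by (intro inj_onI) (metis l_cancel subsetD)
      have "(\<Sum>k\<in>K. a h * b (inv h \<otimes> k) * c (inv k \<otimes> g))
          = (\<Sum>k\<in>(\<otimes>) h ` B. a h * b (inv h \<otimes> k) * c (inv k \<otimes> g))"
      proof (rule sum.mono_neutral_right)
        show "finite K" by fact
        show "(\<otimes>) h ` B \<subseteq> K" using hA by (auto simp: K_def)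
        show "\<forall>k\<in>K - (\<otimes>) h ` B. a h * b (inv h \<otimes> k) * c (inv k \<otimes> g) = 0"
        proof
          fix k assume k: "k \<in> K - (\<otimes>) h ` B"
          then have kc: "k \<in> carrier G" using K by auto
          have "k = h \<otimes> (inv h \<otimes> k)" using h kc by (simp add: m_assoc[symmetric])
          then have "inv h \<otimes> k \<notin> B" using k by blast
          then show "a h * b (inv h \<otimes> k) * c (inv k \<otimes> g) = 0" by (simp add: B_def)
        qed
      qed
      also have "\<dots> = (\<Sum>m\<in>B. a h * b m * c (inv m \<otimes> (inv h \<otimes> g)))"
      proof (subst sum.reindex[OF inj], rule sum.cong[OF refl])
        fix m assume "m \<in> B"
        then have m: "m \<in> carrier G" using B by auto
        have "inv h \<otimes> (h \<otimes> m) = m" using h m by (simp add: m_assoc[symmetric])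
        moreover have "inv (h \<otimes> m) \<otimes> g = inv m \<otimes> (inv h \<otimes> g)"
          using h m g by (simp add: inv_mult_group m_assoc)
        ultimately show "((\<lambda>k. a h * b (inv h \<otimes> k) * c (inv k \<otimes> g)) \<circ> (\<otimes>) h) m
            = a h * b m * c (inv m \<otimes> (inv h \<otimes> g))" by simp
      qed
      also have "\<dots> = a h * convolution G b c (inv h \<otimes> g)"
        using B h g by (subst convolution_superset[of B]) (auto simp: B_def sum_distrib_left mult.assoc)
      finally show "(\<Sum>k\<in>K. a h * b (inv h \<otimes> k) * c (inv k \<otimes> g))
          = a h * convolution G b c (inv h \<otimes> g)" .
    qed
    also have "\<dots> = convolution G a (convolution G b c) g"
      using A g by (subst convolution_superset[of A]) (auto simp: A_def)
    finally show ?thesis .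
  qed (simp add: convolution_outside)
qed

lemma ring_group_ring: "ring (group_ring G :: ('g \<Rightarrow> 'a::comm_ring_1) ring)" (is "ring ?R")
proof (intro ringI abelian_groupI monoidI)
  have add_closed: "(\<lambda>g. x g + y g) \<in> carrier ?R"
    if "x \<in> carrier ?R" "y \<in> carrier ?R" for x y :: "'g \<Rightarrow> 'a"
  proof -
    have "{g. x g + y g \<noteq> 0} \<subseteq> {g. x g \<noteq> 0} \<union> {g. y g \<noteq> 0}" by auto
    then have "finite {g. x g + y g \<noteq> 0}"
      by (rule finite_subset) (use that in \<open>auto simp: carrier_group_ring\<close>)
    moreover have "x g + y g = 0" if "g \<notin> carrier G" for g
    proof -
      have "x g = 0" "y g = 0"
        using \<open>x \<in> carrier ?R\<close> \<open>y \<in> carrier ?R\<close> that by (auto simp: carrier_group_ring)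
      then show ?thesis by simp
    qed
    ultimately show ?thesis by (auto simp: carrier_group_ring)
  qed
  show "x \<oplus>\<^bsub>?R\<^esub> y \<in> carrier ?R" if "x \<in> carrier ?R" "y \<in> carrier ?R" for x y
    using add_closed[OF that] by (simp add: group_ring_def)
  show "\<zero>\<^bsub>?R\<^esub> \<in> carrier ?R" by (simp add: group_ring_def)
  show "\<exists>y\<in>carrier ?R. y \<oplus>\<^bsub>?R\<^esub> x = \<zero>\<^bsub>?R\<^esub>" if "x \<in> carrier ?R" for x
    using that by (intro bexI[of _ "\<lambda>g. - x g"]) (auto simp: group_ring_def)
  show "\<one>\<^bsub>?R\<^esub> \<in> carrier ?R" by (simp add: group_ring_def)
  show "x \<otimes>\<^bsub>?R\<^esub> y \<in> carrier ?R" if "x \<in> carrier ?R" "y \<in> carrier ?R" for x y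
    using convolution_closed[OF that] by (simp add: group_ring_def)
  show "x \<otimes>\<^bsub>?R\<^esub> y \<otimes>\<^bsub>?R\<^esub> z = x \<otimes>\<^bsub>?R\<^esub> (y \<otimes>\<^bsub>?R\<^esub> z)"
    if "x \<in> carrier ?R" "y \<in> carrier ?R" for x y z
    using convolution_assoc[OF that] by (simp add: group_ring_def)
  show "\<one>\<^bsub>?R\<^esub> \<otimes>\<^bsub>?R\<^esub> x = x" if x: "x \<in> carrier ?R" for x
  proof
    fix g
    show "(\<one>\<^bsub>?R\<^esub> \<otimes>\<^bsub>?R\<^esub> x) g = x g"
    proof (cases "g \<in> carrier G")
      case True
      then have "(\<one>\<^bsub>?R\<^esub> \<otimes>\<^bsub>?R\<^esub> x) g = (\<Sum>h\<in>{\<one>}. \<one>\<^bsub>?R\<^esub> h * x (inv h \<otimes> g))"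
        by (simp only: group_ring_def ring.simps monoid.simps)
          (intro convolution_superset, auto split: if_splits)
      then show ?thesis using True by (simp add: group_ring_def)
    qed (use x in \<open>auto simp: group_ring_def convolution_def\<close>)
  qed
  show "x \<otimes>\<^bsub>?R\<^esub> \<one>\<^bsub>?R\<^esub> = x" if x: "x \<in> carrier ?R" for x
  proof
    fix g
    show "(x \<otimes>\<^bsub>?R\<^esub> \<one>\<^bsub>?R\<^esub>) g = x g"
    proof (cases "g \<in> carrier G")
      case True
      let ?F = "insert g {h. x h \<noteq> 0}"
      have F: "finite ?F" "?F \<subseteq> carrier G" using x True by (auto simp: carrier_group_ring)
      have "(x \<otimes>\<^bsub>?R\<^esub> \<one>\<^bsub>?R\<^esub>) g = (\<Sum>h\<in>?F. x h * (if inv h \<otimes> g = \<one> then 1 else 0))"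
        using convolution_superset[of ?F x G g] F True by (auto simp: group_ring_def)
      also have "\<dots> = (\<Sum>h\<in>?F. if h = g then x h else 0)"
      proof (rule sum.cong[OF refl])
        fix h assume "h \<in> ?F"
        then have "h \<in> carrier G" using F by auto
        then have "inv h \<otimes> g = \<one> \<longleftrightarrow> h = g"
          using True by (metis inv_equality inv_inv inv_closed l_inv)
        then show "x h * (if inv h \<otimes> g = \<one> then 1 else 0) = (if h = g then x h else 0)" by simp
      qed
      also have "\<dots> = x g" using F by (simp add: sum.delta)
      finally show ?thesis .
    qed (use x in \<open>auto simp: group_ring_def convolution_def\<close>)
  qed
  fix x y z assume xyz: "x \<in> carrier ?R" "y \<in> carrier ?R" "z \<in> carrier ?R"
  show "(x \<oplus>\<^bsub>?R\<^esub> y) \<otimes>\<^bsub>?R\<^esub> z = x \<otimes>\<^bsub>?R\<^esub> z \<oplus>\<^bsub>?R\<^esub> y \<otimes>\<^bsub>?R\<^esub> z"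
  proof
    fix g
    let ?F = "{h. x h \<noteq> 0} \<union> {h. y h \<noteq> 0}"
    have F: "finite ?F" "?F \<subseteq> carrier G" using xyz by (auto simp: carrier_group_ring)
    show "((x \<oplus>\<^bsub>?R\<^esub> y) \<otimes>\<^bsub>?R\<^esub> z) g = (x \<otimes>\<^bsub>?R\<^esub> z \<oplus>\<^bsub>?R\<^esub> y \<otimes>\<^bsub>?R\<^esub> z) g"
    proof (cases "g \<in> carrier G")
      case True
      have "convolution G (\<lambda>h. x h + y h) z g
          = (\<Sum>h\<in>?F. (x h + y h) * z (inv h \<otimes> g))"
        using F True by (intro convolution_superset) auto
      moreover have "convolution G x z g = (\<Sum>h\<in>?F. x h * z (inv h \<otimes> g))"
        using F True by (intro convolution_superset) auto
      moreover have "convolution G y z g = (\<Sum>h\<in>?F. y h * z (inv h \<otimes> g))"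
        using F True by (intro convolution_superset) auto
      ultimately show ?thesis by (simp add: group_ring_def distrib_right sum.distrib)
    qed (simp add: group_ring_def convolution_def)
  qed
  show "z \<otimes>\<^bsub>?R\<^esub> (x \<oplus>\<^bsub>?R\<^esub> y) = z \<otimes>\<^bsub>?R\<^esub> x \<oplus>\<^bsub>?R\<^esub> z \<otimes>\<^bsub>?R\<^esub> y"
    by (auto simp: group_ring_def convolution_def distrib_left sum.distrib)
qed (auto simp: group_ring_def algebra_simps)

end

definition trivial_module :: "('g, 'x) monoid_scheme \<Rightarrow> ('g \<Rightarrow> int, int) module" where
  "trivial_module G =
    \<lparr>carrier = UNIV, monoid.mult = (*), one = 1, ring.zero = 0, add = (+),
     module.smult = (\<lambda>a m. (\<Sum>g | a g \<noteq> 0. a g) * m)\<rparr>"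

lemma left_module_trivial_module:
  assumes "Group.group G"
  shows "left_module (group_ring G) (trivial_module G)"
proof -
  interpret Group.group G by fact
  let ?R = "group_ring G :: ('a \<Rightarrow> int) ring"
  define aug :: "('a \<Rightarrow> int) \<Rightarrow> int" where "aug a = (\<Sum>g | a g \<noteq> 0. a g)" for a
  have aug: "aug a = sum a F" if "finite F" "{g. a g \<noteq> 0} \<subseteq> F" for a F
    unfolding aug_def using that by (intro sum.mono_neutral_left) auto
  have "aug (\<lambda>g. a g + b g) = aug a + aug b" if "a \<in> carrier ?R" "b \<in> carrier ?R" for a b
  proof -
    let ?F = "{g. a g \<noteq> 0} \<union> {g. b g \<noteq> 0}"
    have "finite ?F" using that by (auto simp: carrier_group_ring)
    then have "aug (\<lambda>g. a g + b g) = (\<Sum>g\<in>?F. a g + b g)" "aug a = sum a ?F" "aug b = sum b ?F"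
      by (auto intro!: aug)
    then show ?thesis by (simp add: sum.distrib)
  qed
  moreover have "aug (convolution G a b) = aug a * aug b"
    if a: "a \<in> carrier ?R" and b: "b \<in> carrier ?R" for a b
  proof -
    define A where "A = {g. a g \<noteq> 0}"
    define B where "B = {g. b g \<noteq> 0}"
    define K where "K = (\<lambda>(h, k). h \<otimes>\<^bsub>G\<^esub> k) ` (A \<times> B)"
    have A: "finite A" "A \<subseteq> carrier G" and B: "finite B" "B \<subseteq> carrier G"
      using a b by (auto simp: A_def B_def carrier_group_ring)
    have K: "finite K" "K \<subseteq> carrier G"
      using A B by (auto simp: K_def)
    have "aug (convolution G a b) = (\<Sum>k\<in>K. convolution G a b k)"
      using convolution_support[OF assms a b] K by (intro aug) (auto simp: K_def A_def B_def)
    also have "\<dots> = (\<Sum>k\<in>K. \<Sum>h\<in>A. a h * b (inv\<^bsub>G\<^esub> h \<otimes>\<^bsub>G\<^esub> k))"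
      using K A by (intro sum.cong refl convolution_superset) (auto simp: A_def)
    also have "\<dots> = (\<Sum>h\<in>A. \<Sum>k\<in>K. a h * b (inv\<^bsub>G\<^esub> h \<otimes>\<^bsub>G\<^esub> k))"
      by (rule sum.swap)
    also have "\<dots> = (\<Sum>h\<in>A. a h * sum b B)"
    proof (rule sum.cong[OF refl])
      fix h assume hA: "h \<in> A"
      then have h: "h \<in> carrier G" using A by auto
      have inj: "inj_on ((\<otimes>\<^bsub>G\<^esub>) h) B"
        using B h by (intro inj_onI) (metis l_cancel subsetD)
      have "(\<Sum>k\<in>K. a h * b (inv\<^bsub>G\<^esub> h \<otimes>\<^bsub>G\<^esub> k)) = (\<Sum>k\<in>(\<otimes>\<^bsub>G\<^esub>) h ` B. a h * b (inv\<^bsub>G\<^esub> h \<otimes>\<^bsub>G\<^esub> k))"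
      proof (rule sum.mono_neutral_right)
        show "finite K" by fact
        show "(\<otimes>\<^bsub>G\<^esub>) h ` B \<subseteq> K" using hA by (auto simp: K_def)
        show "\<forall>k\<in>K - (\<otimes>\<^bsub>G\<^esub>) h ` B. a h * b (inv\<^bsub>G\<^esub> h \<otimes>\<^bsub>G\<^esub> k) = 0"
        proof
          fix k assume k: "k \<in> K - (\<otimes>\<^bsub>G\<^esub>) h ` B"
          then have kc: "k \<in> carrier G" using K by auto
          have "k = h \<otimes>\<^bsub>G\<^esub> (inv\<^bsub>G\<^esub> h \<otimes>\<^bsub>G\<^esub> k)" using h kc by (simp add: m_assoc[symmetric])
          then have "inv\<^bsub>G\<^esub> h \<otimes>\<^bsub>G\<^esub> k \<notin> B" using k by blast
          then show "a h * b (inv\<^bsub>G\<^esub> h \<otimes>\<^bsub>G\<^esub> k) = 0" by (simp add: B_def)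
        qed
      qed
      also have "\<dots> = (\<Sum>m\<in>B. a h * b m)"
      proof (subst sum.reindex[OF inj], rule sum.cong[OF refl])
        fix m assume "m \<in> B"
        then have m: "m \<in> carrier G" using B by auto
        have "inv\<^bsub>G\<^esub> h \<otimes>\<^bsub>G\<^esub> (h \<otimes>\<^bsub>G\<^esub> m) = m" using h m by (simp add: m_assoc[symmetric])
        then show "((\<lambda>k. a h * b (inv\<^bsub>G\<^esub> h \<otimes>\<^bsub>G\<^esub> k)) \<circ> (\<otimes>\<^bsub>G\<^esub>) h) m = a h * b m" by simp
      qed
      finally show "(\<Sum>k\<in>K. a h * b (inv\<^bsub>G\<^esub> h \<otimes>\<^bsub>G\<^esub> k)) = a h * sum b B"
        by (simp add: sum_distrib_left)
    qed
    also have "\<dots> = aug a * aug b"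
      by (simp add: aug_def A_def B_def sum_distrib_right)
    finally show ?thesis .
  qed
  moreover have "aug (\<lambda>g. if g = \<one>\<^bsub>G\<^esub> then 1 else 0) = 1"
    by (subst aug[of "{\<one>\<^bsub>G\<^esub>}"]) (auto split: if_splits)
  moreover have "abelian_group (trivial_module G)"
  proof (intro abelian_groupI)
    show "\<exists>y\<in>carrier (trivial_module G). y \<oplus>\<^bsub>trivial_module G\<^esub> x = \<zero>\<^bsub>trivial_module G\<^esub>" for x
      by (intro bexI[of _ "- x"]) (auto simp: trivial_module_def)
  qed (auto simp: trivial_module_def)
  ultimately show ?thesis
    unfolding left_module_def left_module_axioms_def
    using ring_group_ring[OF assms, where ?'a = int]
    by (auto simp: trivial_module_def group_ring_def aug_def[symmetric] algebra_simps)
qed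

text \<open>
  A complex vector space \<open>V\<close> with an action \<open>\<rho>\<close> of \<open>G\<close>, viewed as a module over the integral group
  ring by extending the action additively.
\<close>

definition integral_module ::
    "('g \<Rightarrow> 'v \<Rightarrow> 'v) \<Rightarrow> (complex, 'v) module \<Rightarrow> ('g \<Rightarrow> int, 'v) module" where
  "integral_module \<rho> V =
    \<lparr>carrier = carrier V, monoid.mult = monoid.mult V, one = monoid.one V,
     ring.zero = ring.zero V, add = add V,
     module.smult = (\<lambda>a x. \<Oplus>\<^bsub>V\<^esub>g \<in> {g. a g \<noteq> 0}. of_int (a g) \<odot>\<^bsub>V\<^esub> \<rho> g x)\<rparr>"


section \<open>Group cohomology\<close>

definition projective_resolution ::
    "('g, 'x) monoid_scheme \<Rightarrow> (nat \<Rightarrow> ('g \<Rightarrow> int, 'p) module) \<Rightarrow>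
      (nat \<Rightarrow> 'p \<Rightarrow> 'p) \<Rightarrow> ('p \<Rightarrow> int) \<Rightarrow> bool" where
  "projective_resolution G P d \<epsilon> \<longleftrightarrow>
    (\<forall>n. projective (group_ring G) (P n)) \<and>
    (\<forall>n. d n \<in> LinearCombinations.module_hom (group_ring G) (P (Suc n)) (P n)) \<and>
    \<epsilon> \<in> LinearCombinations.module_hom (group_ring G) (P 0) (trivial_module G) \<and>
    \<epsilon> ` carrier (P 0) = UNIV \<and>
    {x \<in> carrier (P 0). \<epsilon> x = 0} = d 0 ` carrier (P (Suc 0)) \<and>
    (\<forall>n. {x \<in> carrier (P (Suc n)). d n x = \<zero>\<^bsub>P n\<^esub>} = d (Suc n) ` carrier (P (Suc (Suc n))))"

text \<open>
  Homomorphisms over the integral group ring from \<open>Q\<close> to \<open>V\<close>, as a complex vector space. They are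
  made extensional so that each homomorphism is represented by exactly one function. Only the
  vector space structure of the records matters here, so \<open>mult\<close> and \<open>one\<close> are left unspecified.
\<close>

definition hom_space ::
    "('g, 'x) monoid_scheme \<Rightarrow> ('g \<Rightarrow> 'v \<Rightarrow> 'v) \<Rightarrow> (complex, 'v) module \<Rightarrow>
      ('g \<Rightarrow> int, 'p) module \<Rightarrow> (complex, 'p \<Rightarrow> 'v) module" where
  "hom_space G \<rho> V Q =
    \<lparr>carrier = LinearCombinations.module_hom (group_ring G) Q (integral_module \<rho> V)
       \<inter> extensional (carrier Q),
     monoid.mult = undefined, one = undefined,
     ring.zero = (\<lambda>x \<in> carrier Q. \<zero>\<^bsub>V\<^esub>),
     add = (\<lambda>f f'. \<lambda>x \<in> carrier Q. f x \<oplus>\<^bsub>V\<^esub> f' x),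
     module.smult = (\<lambda>c f. \<lambda>x \<in> carrier Q. c \<odot>\<^bsub>V\<^esub> f x)\<rparr>"

definition cocycles ::
    "('g, 'x) monoid_scheme \<Rightarrow> (nat \<Rightarrow> ('g \<Rightarrow> int, 'p) module) \<Rightarrow> (nat \<Rightarrow> 'p \<Rightarrow> 'p) \<Rightarrow>
      ('g \<Rightarrow> 'v \<Rightarrow> 'v) \<Rightarrow> (complex, 'v) module \<Rightarrow> nat \<Rightarrow> ('p \<Rightarrow> 'v) set" where
  "cocycles G P d \<rho> V n =
    {f \<in> carrier (hom_space G \<rho> V (P n)). \<forall>x \<in> carrier (P (Suc n)). f (d n x) = \<zero>\<^bsub>V\<^esub>}"

definition coboundaries ::
    "('g, 'x) monoid_scheme \<Rightarrow> (nat \<Rightarrow> ('g \<Rightarrow> int, 'p) module) \<Rightarrow> (nat \<Rightarrow> 'p \<Rightarrow> 'p) \<Rightarrow>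
      ('g \<Rightarrow> 'v \<Rightarrow> 'v) \<Rightarrow> (complex, 'v) module \<Rightarrow> nat \<Rightarrow> ('p \<Rightarrow> 'v) set" where
  "coboundaries G P d \<rho> V n =
    (case n of
       0 \<Rightarrow> {\<zero>\<^bsub>hom_space G \<rho> V (P 0)\<^esub>}
     | Suc m \<Rightarrow> (\<lambda>f. \<lambda>x \<in> carrier (P (Suc m)). f (d m x)) ` carrier (hom_space G \<rho> V (P m)))"

definition quotient_space :: "('k, 'v) module \<Rightarrow> 'v set \<Rightarrow> ('k, 'v set) module" where
  "quotient_space V W =
    \<lparr>carrier = a_rcosets\<^bsub>V\<^esub> W,
     monoid.mult = undefined, one = undefined,
     ring.zero = W,
     add = set_add V,
     module.smult = (\<lambda>c A. \<Union>x \<in> A. W +>\<^bsub>V\<^esub> (c \<odot>\<^bsub>V\<^esub> x))\<rparr>"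

definition group_cohomology ::
    "('g, 'x) monoid_scheme \<Rightarrow> (nat \<Rightarrow> ('g \<Rightarrow> int, 'p) module) \<Rightarrow> (nat \<Rightarrow> 'p \<Rightarrow> 'p) \<Rightarrow>
      ('g \<Rightarrow> 'v \<Rightarrow> 'v) \<Rightarrow> (complex, 'v) module \<Rightarrow> nat \<Rightarrow> (complex, ('p \<Rightarrow> 'v) set) module" where
  "group_cohomology G P d \<rho> V n =
    quotient_space ((hom_space G \<rho> V (P n))\<lparr>carrier := cocycles G P d \<rho> V n\<rparr>)
      (coboundaries G P d \<rho> V n)"

definition infinite_dimensional :: "('k, 's) ring_scheme \<Rightarrow> ('k, 'v, 't) module_scheme \<Rightarrow> bool" where
  "infinite_dimensional K V \<longleftrightarrow> vectorspace K V \<and> \<not> vectorspace.fin_dim K V"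

abbreviation complex_field :: "complex ring" where
  "complex_field \<equiv> ring_of_type_algebra"


section \<open>The reduced group C*-algebra\<close>

definition l2_space :: "('g, 'x) monoid_scheme \<Rightarrow> ('g \<Rightarrow> complex) set" where
  "l2_space G = {\<beta>. (\<forall>g. g \<notin> carrier G \<longrightarrow> \<beta> g = 0) \<and> (\<lambda>g. (cmod (\<beta> g))\<^sup>2) summable_on carrier G}"

definition l2_norm :: "('g, 'x) monoid_scheme \<Rightarrow> ('g \<Rightarrow> complex) \<Rightarrow> real" where
  "l2_norm G \<beta> = sqrt (\<Sum>\<^sub>\<infinity>g \<in> carrier G. (cmod (\<beta> g))\<^sup>2)"

text \<open>Operators are total functions; they are made to vanish off \<open>l2_space G\<close> so that equality of
  operators is equality of functions.\<close>

definition bounded_operator ::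
    "('g, 'x) monoid_scheme \<Rightarrow> (('g \<Rightarrow> complex) \<Rightarrow> 'g \<Rightarrow> complex) \<Rightarrow> bool" where
  "bounded_operator G T \<longleftrightarrow>
    T \<in> l2_space G \<rightarrow> l2_space G \<and>
    (\<forall>\<beta>. \<beta> \<notin> l2_space G \<longrightarrow> T \<beta> = (\<lambda>g. 0)) \<and>
    (\<forall>\<beta> \<in> l2_space G. \<forall>\<gamma> \<in> l2_space G. T (\<lambda>g. \<beta> g + \<gamma> g) = (\<lambda>g. T \<beta> g + T \<gamma> g)) \<and>
    (\<forall>c. \<forall>\<beta> \<in> l2_space G. T (\<lambda>g. c * \<beta> g) = (\<lambda>g. c * T \<beta> g)) \<and>
    (\<exists>C. \<forall>\<beta> \<in> l2_space G. l2_norm G (T \<beta>) \<le> C * l2_norm G \<beta>)"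

definition op_norm ::
    "('g, 'x) monoid_scheme \<Rightarrow> (('g \<Rightarrow> complex) \<Rightarrow> 'g \<Rightarrow> complex) \<Rightarrow> real" where
  "op_norm G T = (SUP \<beta> \<in> {\<beta> \<in> l2_space G. l2_norm G \<beta> = 1}. l2_norm G (T \<beta>))"

definition left_mult ::
    "('g, 'x) monoid_scheme \<Rightarrow> ('g \<Rightarrow> complex) \<Rightarrow> ('g \<Rightarrow> complex) \<Rightarrow> 'g \<Rightarrow> complex" where
  "left_mult G \<alpha> \<beta> = (if \<beta> \<in> l2_space G then convolution G \<alpha> \<beta> else (\<lambda>g. 0))"

text \<open>
  The complex group ring acts faithfully on the Hilbert space by bounded operators, and the bounded
  operators are complete. The completion of the group ring in the operator norm is therefore its
  norm closure in the bounded operators.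
\<close>

definition cstar_red ::
    "('g, 'x) monoid_scheme \<Rightarrow> (complex, ('g \<Rightarrow> complex) \<Rightarrow> 'g \<Rightarrow> complex) module" where
  "cstar_red G =
    \<lparr>carrier = {T. bounded_operator G T \<and>
       (\<forall>e>0. \<exists>\<alpha> \<in> carrier (group_ring G). op_norm G (\<lambda>\<beta> g. T \<beta> g - left_mult G \<alpha> \<beta> g) < e)},
     monoid.mult = (\<circ>),
     one = left_mult G \<one>\<^bsub>group_ring G\<^esub>,
     ring.zero = (\<lambda>\<beta> g. 0),
     add = (\<lambda>S T \<beta> g. S \<beta> g + T \<beta> g),
     module.smult = (\<lambda>c T \<beta> g. c * T \<beta> g)\<rparr>"

definition cstar_action ::
    "('g, 'x) monoid_scheme \<Rightarrow> 'g \<Rightarrow> (('g \<Rightarrow> complex) \<Rightarrow> 'g \<Rightarrow> complex) \<Rightarrow>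
      ('g \<Rightarrow> complex) \<Rightarrow> 'g \<Rightarrow> complex" where
  "cstar_action G g T = left_mult G (\<lambda>h. if h = g then 1 else 0) \<circ> T"

abbreviation free_abelian_group_of_rank :: "nat \<Rightarrow> (nat \<Rightarrow> int) monoid" where
  "free_abelian_group_of_rank n \<equiv> product_group {..<n} (\<lambda>_. integer_group)"

end

theory Submission
  imports Defs "HOL-Analysis.L2_Norm" "HOL-Library.Nat_Bijection"
begin

text \<open>
  Let \<open>G\<close> be the free abelian group of rank \<open>n\<close> with generators \<open>e\<^sub>0, \<dots>, e\<^sub>n\<^sub>-\<^sub>1\<close>, let \<open>R\<close> be its
  integral group ring, \<open>M\<close> its reduced C*-algebra and \<open>x\<^sub>i = e\<^sub>i - 1 \<in> R\<close>. The Koszul resolution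
  identifies the top cohomology with \<open>M / (x\<^sub>0M + \<dots> + x\<^sub>n\<^sub>-\<^sub>1M)\<close>. Under the Fourier transform \<open>M\<close>
  becomes the algebra of continuous functions on the torus and \<open>x\<^sub>i\<close> becomes \<open>z\<^sub>i - 1\<close>. Hence elements of the
  denominator vanish at the point \<open>1\<close> at least to first order, while \<open>M\<close> contains many functions
  that vanish there more slowly. The proof below realises this idea for an arbitrary projective
  resolution \<open>P\<close>, and it uses neither the Koszul complex nor the Fourier transform.

  Passage to the coefficients. Multiplication by \<open>x\<^sub>i\<close> is null-homotopic on \<open>P\<close>
  (\<open>multiplication_null_homotopic\<close>). Applying the homotopies for \<open>x\<^sub>0, \<dots>, x\<^sub>n\<^sub>-\<^sub>1\<close> one after the other to
  an element \<open>u\<^sub>0\<close> of \<open>P\<^sub>0\<close> of augmentation \<open>1\<close> gives an element \<open>u\<^sub>n\<close> of \<open>P\<^sub>n\<close> whose boundary lies in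
  \<open>x\<^sub>0P\<^sub>n\<^sub>-\<^sub>1 + \<dots> + x\<^sub>n\<^sub>-\<^sub>1P\<^sub>n\<^sub>-\<^sub>1\<close> (\<open>koszul_chain\<close>). Dually there is an \<open>R\<close>-linear cocycle
  \<open>c : P\<^sub>n \<rightarrow> R\<close> for which \<open>c(u\<^sub>n)\<close> has augmentation \<open>1\<close> (\<open>koszul_cocycle\<close>): starting from the
  augmentation of \<open>P\<^sub>0\<close>, one lifts a cocycle on \<open>P\<^sub>j\<close> with values in the group ring of the first \<open>j\<close>
  coordinates to the first \<open>j + 1\<close> coordinates, and divides its coboundary by the regular element
  \<open>x\<^sub>j\<close>. Every \<open>T\<close> in \<open>M\<close> then gives a cocycle \<open>y \<mapsto> c(y) T\<close>, and if this is a coboundary, then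
  \<open>c(u\<^sub>n) T\<close> lies in \<open>x\<^sub>0M + \<dots> + x\<^sub>n\<^sub>-\<^sub>1M\<close>.

  Analysis of the coefficients. For a bounded sequence \<open>b\<close> take the norm convergent series
  \<open>T\<^sub>b = \<Sum>\<^sub>j 2\<^sup>-\<^sup>j b\<^sub>j (e\<^sub>0\<^sup>M\<^sup>(\<^sup>j\<^sup>) - 1)\<close> with \<open>M(j) = 2 ^ j\<^sup>2\<close>. The vectors
  \<open>h \<mapsto> exp(i t h\<^sub>0) r ^ \<bar>h\<bar>\<close> are approximate eigenvectors of all translations as \<open>r\<close> tends to \<open>1\<close>.
  So the operator norm controls the character \<open>h \<mapsto> exp(- i t h\<^sub>0)\<close>, and an element of the
  denominator has value \<open>O(t)\<close> there (\<open>character_value_bound\<close>, \<open>span_multiples_dominated\<close>). At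
  \<open>t = \<pi> / M(m)\<close> the terms of \<open>T\<^sub>b\<close> with \<open>j > m\<close> vanish, those with \<open>j < m\<close> add up to \<open>O(4\<^sup>-\<^sup>m)\<close>, and
  the remaining one is \<open>- 2 b\<^sub>m / 2\<^sup>m\<close>. If \<open>c(u\<^sub>n) T\<^sub>b\<close> lies in the denominator, it follows that \<open>b\<close>
  tends to \<open>0\<close> (\<open>lacunary_coefficients_tendsto_zero\<close>). So the bounded sequences map linearly to the
  cohomology with a kernel of null sequences, and the cohomology is infinite-dimensional
  (\<open>infinite_dimensional_if_bounded_sequences\<close>).
\<close>

section \<open>Formal sums on a group\<close>

text \<open>The value at the finite formal sum \<open>a\<close> of the linear extension of \<open>\<phi>\<close>.\<close>

definition pairing :: "('g \<Rightarrow> 'a::comm_ring_1) \<Rightarrow> ('g \<Rightarrow> 'a) \<Rightarrow> 'a" where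
  "pairing a \<phi> = (\<Sum>g | a g \<noteq> 0. a g * \<phi> g)"

lemma pairing_superset:
  assumes "finite F" "{g. a g \<noteq> 0} \<subseteq> F"
  shows "pairing a \<phi> = (\<Sum>g\<in>F. a g * \<phi> g)"
  unfolding pairing_def using assms by (intro sum.mono_neutral_left) auto

lemma pairing_cong:
  assumes "\<And>g. a g \<noteq> 0 \<Longrightarrow> \<phi> g = \<psi> g"
  shows "pairing a \<phi> = pairing a \<psi>"
  unfolding pairing_def using assms by (intro sum.cong) auto

lemma pairing_indicator:
  assumes "finite {g. a g \<noteq> 0}"
  shows "pairing a (\<lambda>h. if h = g then 1 else 0) = a g"
proof -
  have "pairing a (\<lambda>h. if h = g then 1 else 0) = (\<Sum>h\<in>insert g {g. a g \<noteq> 0}. a h * (if h = g then 1 else 0))"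
    using assms by (intro pairing_superset) auto
  then show ?thesis using assms by (simp add: if_distrib[of "\<lambda>x. _ * x"] sum.delta cong: if_cong)
qed

lemma pairing_add:
  assumes "finite {g. a g \<noteq> 0}" "finite {g. b g \<noteq> 0}"
  shows "pairing (\<lambda>g. a g + b g) \<phi> = pairing a \<phi> + pairing b \<phi>"
proof -
  let ?F = "{g. a g \<noteq> 0} \<union> {g. b g \<noteq> 0}"
  have F: "finite ?F" using assms by auto
  have "pairing (\<lambda>g. a g + b g) \<phi> = (\<Sum>g\<in>?F. (a g + b g) * \<phi> g)" using F by (intro pairing_superset) auto
  moreover have "pairing a \<phi> = (\<Sum>g\<in>?F. a g * \<phi> g)" "pairing b \<phi> = (\<Sum>g\<in>?F. b g * \<phi> g)"
    using F by (auto intro!: pairing_superset)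
  ultimately show ?thesis by (simp add: sum.distrib distrib_right)
qed

lemma pairing_swap:
  "pairing a (\<lambda>h. pairing b (\<lambda>k. \<phi> h k)) = pairing b (\<lambda>k. pairing a (\<lambda>h. \<phi> h k))"
  unfolding pairing_def by (simp add: sum_distrib_left sum.swap[of _ "{g. a g \<noteq> 0}"] mult.left_commute)

lemma pairing_scale: "pairing a (\<lambda>g. c * \<phi> g) = c * pairing a \<phi>"
  by (simp add: pairing_def sum_distrib_left mult.left_commute)

lemma pairing_scale_left:
  assumes "finite {g. a g \<noteq> 0}"
  shows "pairing (\<lambda>g. c * a g) \<phi> = c * pairing a \<phi>"
  using assms by (subst pairing_superset[of "{g. a g \<noteq> 0}"])
    (auto simp: pairing_def sum_distrib_left mult.assoc)

lemma group_ring_add: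
  assumes "a \<in> carrier (group_ring G)" "b \<in> carrier (group_ring G)"
  shows "(\<lambda>g. a g + b g) \<in> carrier (group_ring G)"
proof -
  have "{g. a g + b g \<noteq> 0} \<subseteq> {g. a g \<noteq> 0} \<union> {g. b g \<noteq> 0}" by auto
  moreover have "finite ({g. a g \<noteq> 0} \<union> {g. b g \<noteq> 0})" "{g. a g \<noteq> 0} \<union> {g. b g \<noteq> 0} \<subseteq> carrier G"
    using assms by (auto simp: carrier_group_ring)
  ultimately show ?thesis unfolding carrier_group_ring by (meson finite_subset order_trans)
qed

lemma group_ring_scale:
  fixes a :: "'g \<Rightarrow> 'a::comm_ring_1"
  assumes "a \<in> carrier (group_ring G)"
  shows "(\<lambda>g. c * a g) \<in> carrier (group_ring G)"
proof -
  have "{g. c * a g \<noteq> 0} \<subseteq> {g. a g \<noteq> 0}" by auto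
  then show ?thesis using assms by (auto simp: carrier_group_ring intro: finite_subset)
qed

lemma convolution_eq_pairing:
  assumes "a \<in> carrier (group_ring G)" "g \<in> carrier G"
  shows "convolution G a b g = pairing a (\<lambda>h. b (inv\<^bsub>G\<^esub> h \<otimes>\<^bsub>G\<^esub> g))"
  unfolding pairing_def using assms by (intro convolution_superset) (auto simp: carrier_group_ring)

text \<open>The product of the group ring is dual to the multiplication of the group.\<close>

lemma pairing_convolution:
  assumes "Group.group G" "a \<in> carrier (group_ring G)" "b \<in> carrier (group_ring G)"
  shows "pairing (convolution G a b) \<phi> = pairing a (\<lambda>h. pairing b (\<lambda>k. \<phi> (h \<otimes>\<^bsub>G\<^esub> k)))"
proof -
  interpret Group.group G by fact
  define A where "A = {g. a g \<noteq> 0}"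
  define B where "B = {g. b g \<noteq> 0}"
  define K where "K = (\<lambda>(h, k). h \<otimes>\<^bsub>G\<^esub> k) ` (A \<times> B)"
  have A: "finite A" "A \<subseteq> carrier G" and B: "finite B" "B \<subseteq> carrier G"
    using assms by (auto simp: A_def B_def carrier_group_ring)
  have K: "finite K" "K \<subseteq> carrier G"
    using A B by (auto simp: K_def)
  have "pairing (convolution G a b) \<phi> = (\<Sum>x\<in>K. convolution G a b x * \<phi> x)"
    using K convolution_support[OF assms] by (intro pairing_superset) (auto simp: K_def A_def B_def)
  also have "\<dots> = (\<Sum>x\<in>K. \<Sum>h\<in>A. a h * b (inv\<^bsub>G\<^esub> h \<otimes>\<^bsub>G\<^esub> x) * \<phi> x)"
    using K A by (intro sum.cong refl) (auto simp: convolution_superset[of A a] A_def sum_distrib_right)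
  also have "\<dots> = (\<Sum>h\<in>A. \<Sum>x\<in>K. a h * b (inv\<^bsub>G\<^esub> h \<otimes>\<^bsub>G\<^esub> x) * \<phi> x)"
    by (rule sum.swap)
  also have "\<dots> = (\<Sum>h\<in>A. a h * pairing b (\<lambda>k. \<phi> (h \<otimes>\<^bsub>G\<^esub> k)))"
  proof (rule sum.cong[OF refl])
    fix h assume hA: "h \<in> A"
    then have h: "h \<in> carrier G" using A by auto
    have inj: "inj_on ((\<otimes>\<^bsub>G\<^esub>) h) B"
      using B h by (intro inj_onI) (metis l_cancel subsetD)
    have "(\<Sum>x\<in>K. a h * b (inv\<^bsub>G\<^esub> h \<otimes>\<^bsub>G\<^esub> x) * \<phi> x)
        = (\<Sum>x\<in>(\<otimes>\<^bsub>G\<^esub>) h ` B. a h * b (inv\<^bsub>G\<^esub> h \<otimes>\<^bsub>G\<^esub> x) * \<phi> x)"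
    proof (rule sum.mono_neutral_right)
      show "(\<otimes>\<^bsub>G\<^esub>) h ` B \<subseteq> K" using hA by (auto simp: K_def)
      show "\<forall>x\<in>K - (\<otimes>\<^bsub>G\<^esub>) h ` B. a h * b (inv\<^bsub>G\<^esub> h \<otimes>\<^bsub>G\<^esub> x) * \<phi> x = 0"
      proof
        fix x assume x: "x \<in> K - (\<otimes>\<^bsub>G\<^esub>) h ` B"
        then have "x = h \<otimes>\<^bsub>G\<^esub> (inv\<^bsub>G\<^esub> h \<otimes>\<^bsub>G\<^esub> x)" using h K by (auto simp: m_assoc[symmetric])
        then have "inv\<^bsub>G\<^esub> h \<otimes>\<^bsub>G\<^esub> x \<notin> B" using x by blast
        then show "a h * b (inv\<^bsub>G\<^esub> h \<otimes>\<^bsub>G\<^esub> x) * \<phi> x = 0" by (simp add: B_def)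
      qed
    qed (use K in auto)
    also have "\<dots> = (\<Sum>k\<in>B. a h * (b k * \<phi> (h \<otimes>\<^bsub>G\<^esub> k)))"
      using h B by (subst sum.reindex[OF inj], intro sum.cong refl)
        (auto simp: m_assoc[symmetric] subset_iff mult.assoc)
    finally show "(\<Sum>x\<in>K. a h * b (inv\<^bsub>G\<^esub> h \<otimes>\<^bsub>G\<^esub> x) * \<phi> x) = a h * pairing b (\<lambda>k. \<phi> (h \<otimes>\<^bsub>G\<^esub> k))"
      by (simp add: sum_distrib_left pairing_def B_def)
  qed
  finally show ?thesis by (simp add: pairing_def A_def)
qed

lemma group_ring_eqI:
  assumes "a \<in> carrier (group_ring G)" "b \<in> carrier (group_ring G)"
    and "\<And>\<phi>. pairing a \<phi> = pairing b \<phi>"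
  shows "a = b"
  using assms pairing_indicator[of a] pairing_indicator[of b]
  by (intro ext) (metis carrier_group_ring)

lemma convolution_commute:
  assumes "comm_group G" "a \<in> carrier (group_ring G)" "b \<in> carrier (group_ring G)"
  shows "convolution G a b = convolution G b a"
proof -
  interpret comm_group G by fact
  have G: "Group.group G" by (rule is_group)
  have "pairing (convolution G a b) \<phi> = pairing (convolution G b a) \<phi>" for \<phi>
  proof -
    have "pairing (convolution G a b) \<phi> = pairing a (\<lambda>h. pairing b (\<lambda>k. \<phi> (k \<otimes>\<^bsub>G\<^esub> h)))"
      unfolding pairing_convolution[OF G assms(2,3)] using assms(2,3)
      by (intro pairing_cong) (auto simp: carrier_group_ring m_comm subset_iff)
    then show ?thesis
      by (simp add: pairing_swap[of a] pairing_convolution[OF G assms(3,2)])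
  qed
  then show ?thesis
    by (intro group_ring_eqI[of _ G] convolution_closed assms G)
qed

lemma cring_group_ring:
  assumes "comm_group G"
  shows "cring (group_ring G :: ('g \<Rightarrow> 'a::comm_ring_1) ring)"
proof -
  interpret comm_group G by fact
  show ?thesis
    using convolution_commute[OF assms] ring_group_ring[OF is_group]
    by (intro cring.intro comm_monoid.intro ring.is_monoid) (auto simp: comm_monoid_axioms_def group_ring_def)
qed

text \<open>The group element \<open>h\<close> as a formal sum.\<close>

definition unit_mass :: "'g \<Rightarrow> 'g \<Rightarrow> 'a::comm_ring_1" where
  "unit_mass h = (\<lambda>g. if g = h then 1 else 0)"

lemma unit_mass_closed: "h \<in> carrier G \<Longrightarrow> unit_mass h \<in> carrier (group_ring G)"
  by (auto simp: unit_mass_def carrier_group_ring split: if_splits)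

lemma pairing_unit_mass: "pairing (unit_mass h) \<phi> = \<phi> h"
  by (subst pairing_superset[of "{h}"]) (auto simp: unit_mass_def split: if_splits)

lemma convolution_unit_mass:
  assumes "h \<in> carrier G" "g \<in> carrier G"
  shows "convolution G (unit_mass h) b g = b (inv\<^bsub>G\<^esub> h \<otimes>\<^bsub>G\<^esub> g)"
  by (simp add: convolution_eq_pairing unit_mass_closed pairing_unit_mass assms)

lemma unit_mass_diff_closed:
  assumes "h \<in> carrier G" "k \<in> carrier G"
  shows "(\<lambda>g. unit_mass h g - unit_mass k g) \<in> carrier (group_ring G)"
  using group_ring_add[OF unit_mass_closed[OF assms(1)] group_ring_scale[OF unit_mass_closed[OF assms(2)], of "- 1"]]
  by simp

lemma pairing_unit_mass_diff:
  "pairing (\<lambda>g. unit_mass h g - unit_mass k g) \<phi> = \<phi> h - \<phi> k"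
proof -
  have "pairing (\<lambda>g. unit_mass h g - unit_mass k g) \<phi> = (\<Sum>g\<in>{h, k}. (unit_mass h g - unit_mass k g) * \<phi> g)"
    by (intro pairing_superset) (auto simp: unit_mass_def split: if_splits)
  then show ?thesis by (cases "h = k") (auto simp: unit_mass_def)
qed

text \<open>The push-forward of formal sums along a map of the group into itself.\<close>

definition pushforward :: "('g \<Rightarrow> 'g) \<Rightarrow> ('g \<Rightarrow> 'a::comm_ring_1) \<Rightarrow> 'g \<Rightarrow> 'a" where
  "pushforward q a = (\<lambda>g. pairing a (\<lambda>h. if q h = g then 1 else 0))"

lemma pushforward_support: "{g. pushforward q a g \<noteq> 0} \<subseteq> q ` {g. a g \<noteq> 0}"
proof
  fix g assume "g \<in> {g. pushforward q a g \<noteq> 0}"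
  then have "pairing a (\<lambda>h. if q h = g then 1 else 0) \<noteq> 0" by (simp add: pushforward_def)
  then obtain h where "a h * (if q h = g then 1 else 0) \<noteq> 0" "a h \<noteq> 0"
    unfolding pairing_def using sum.not_neutral_contains_not_neutral by blast
  then show "g \<in> q ` {g. a g \<noteq> 0}" by (auto split: if_splits)
qed

lemma pushforward_closed:
  assumes "a \<in> carrier (group_ring G)" "q \<in> carrier G \<rightarrow> carrier G"
  shows "pushforward q a \<in> carrier (group_ring G)"
proof -
  have "finite (q ` {g. a g \<noteq> 0})" "q ` {g. a g \<noteq> 0} \<subseteq> carrier G"
    using assms by (auto simp: carrier_group_ring)
  then show ?thesis
    using pushforward_support[of q a] by (auto simp: carrier_group_ring intro: finite_subset)
qed

lemma pairing_pushforward: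
  assumes "finite {g. a g \<noteq> 0}"
  shows "pairing (pushforward q a) \<phi> = pairing a (\<lambda>h. \<phi> (q h))"
proof -
  let ?A = "{g. a g \<noteq> 0}"
  have "pairing (pushforward q a) \<phi> = (\<Sum>g\<in>q ` ?A. pushforward q a g * \<phi> g)"
    using assms by (intro pairing_superset pushforward_support) auto
  also have "\<dots> = (\<Sum>g\<in>q ` ?A. \<Sum>h\<in>?A. a h * (if q h = g then \<phi> g else 0))"
    unfolding pushforward_def pairing_def sum_distrib_right by (intro sum.cong refl) auto
  also have "\<dots> = (\<Sum>h\<in>?A. \<Sum>g\<in>q ` ?A. a h * (if q h = g then \<phi> g else 0))"
    by (rule sum.swap)
  also have "\<dots> = pairing a (\<lambda>h. \<phi> (q h))"
    unfolding pairing_def using assms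
    by (intro sum.cong refl) (simp add: sum_distrib_left[symmetric] sum.delta)
  finally show ?thesis .
qed

lemma pushforward_add:
  assumes "finite {g. a g \<noteq> 0}" "finite {g. b g \<noteq> 0}"
  shows "pushforward q (\<lambda>g. a g + b g) = (\<lambda>g. pushforward q a g + pushforward q b g)"
  unfolding pushforward_def by (simp add: pairing_add assms)

lemma pushforward_pushforward:
  assumes "finite {g. a g \<noteq> 0}"
  shows "pushforward p (pushforward q a) = pushforward (\<lambda>g. p (q g)) a"
  unfolding pushforward_def[of p] pushforward_def[of "\<lambda>g. p (q g)"]
  by (simp add: pairing_pushforward assms)

lemma pushforward_id:
  assumes "finite {g. a g \<noteq> 0}" "\<And>g. a g \<noteq> 0 \<Longrightarrow> q g = g"
  shows "pushforward q a = a"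
  unfolding pushforward_def using assms
  by (metis (no_types, lifting) ext pairing_cong pairing_indicator)

lemma pushforward_convolution:
  assumes G: "Group.group G" and q: "q \<in> hom G G"
    and ab: "a \<in> carrier (group_ring G)" "b \<in> carrier (group_ring G)"
  shows "pushforward q (convolution G a b) = convolution G (pushforward q a) (pushforward q b)"
proof (rule group_ring_eqI)
  have q': "q \<in> carrier G \<rightarrow> carrier G" using q by (auto simp: hom_def)
  have fin: "finite {g. a g \<noteq> 0}" "finite {g. b g \<noteq> 0}" "finite {g. convolution G a b g \<noteq> 0}"
    using ab convolution_closed[OF G ab] by (auto simp: carrier_group_ring)
  show "pushforward q (convolution G a b) \<in> carrier (group_ring G)"
    by (intro pushforward_closed convolution_closed G ab q')
  show "convolution G (pushforward q a) (pushforward q b) \<in> carrier (group_ring G)"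
    by (intro pushforward_closed convolution_closed G ab q')
  fix \<phi>
  have "pairing (pushforward q (convolution G a b)) \<phi> = pairing a (\<lambda>h. pairing b (\<lambda>k. \<phi> (q (h \<otimes>\<^bsub>G\<^esub> k))))"
    by (simp add: pairing_pushforward fin pairing_convolution G ab)
  also have "\<dots> = pairing a (\<lambda>h. pairing b (\<lambda>k. \<phi> (q h \<otimes>\<^bsub>G\<^esub> q k)))"
    using ab q by (intro pairing_cong) (auto simp: carrier_group_ring hom_def subset_iff)
  also have "\<dots> = pairing (convolution G (pushforward q a) (pushforward q b)) \<phi>"
    by (simp add: pairing_pushforward fin pairing_convolution[OF G] pushforward_closed ab q')
  finally show "pairing (pushforward q (convolution G a b)) \<phi>
    = pairing (convolution G (pushforward q a) (pushforward q b)) \<phi>" .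
qed

section \<open>The group ring of a free abelian group\<close>

lemma comm_group_free_abelian: "comm_group (free_abelian_group_of_rank n)"
  by (intro group.group_comm_groupI) (auto simp: fun_eq_iff)

lemmas group_free_abelian = comm_group.axioms(2)[OF comm_group_free_abelian]

text \<open>
  Elements of the group are functions that are extensional on \<open>{..<n}\<close>. For \<open>i < n\<close>,
  \<open>generator n i\<close> is the \<open>i\<close>-th basis vector, and \<open>difference_element n i\<close> is the element
  \<open>e\<^sub>i - 1\<close> of the integral group ring. The endomorphism \<open>keep_coordinates n S\<close> replaces the
  coordinates outside \<open>S\<close> by \<open>0\<close>.
\<close>

definition generator :: "nat \<Rightarrow> nat \<Rightarrow> nat \<Rightarrow> int" where
  "generator n i = (\<lambda>k\<in>{..<n}. if k = i then 1 else 0)"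

definition keep_coordinates :: "nat \<Rightarrow> nat set \<Rightarrow> (nat \<Rightarrow> int) \<Rightarrow> nat \<Rightarrow> int" where
  "keep_coordinates n S g = (\<lambda>k\<in>{..<n}. if k \<in> S then g k else 0)"

definition difference_element :: "nat \<Rightarrow> nat \<Rightarrow> (nat \<Rightarrow> int) \<Rightarrow> int" where
  "difference_element n i = (\<lambda>g. unit_mass (generator n i) g - unit_mass (\<lambda>k\<in>{..<n}. 0) g)"

lemma generator_closed [simp]: "generator n i \<in> carrier (free_abelian_group_of_rank n)"
  by (simp add: generator_def)

lemma keep_coordinates_hom: "keep_coordinates n S \<in> hom (free_abelian_group_of_rank n) (free_abelian_group_of_rank n)"
  by (auto simp: hom_def keep_coordinates_def fun_eq_iff)

lemma keep_coordinates_compose: "keep_coordinates n S (keep_coordinates n T g) = keep_coordinates n (S \<inter> T) g"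
  by (auto simp: keep_coordinates_def fun_eq_iff)

lemma keep_coordinates_eq:
  assumes "g \<in> carrier (free_abelian_group_of_rank n)" "\<And>k. k < n \<Longrightarrow> k \<notin> S \<Longrightarrow> g k = 0"
  shows "keep_coordinates n S g = g"
  using assms by (auto simp: keep_coordinates_def PiE_def extensional_def fun_eq_iff)

lemma origin_closed: "(\<lambda>k\<in>{..<n}. 0) \<in> carrier (free_abelian_group_of_rank n)"
  by simp

lemma pairing_difference_element:
  "pairing (difference_element n i) \<phi> = \<phi> (generator n i) - \<phi> (\<lambda>k\<in>{..<n}. 0)"
  unfolding difference_element_def by (rule pairing_unit_mass_diff)

lemma difference_element_closed:
  "difference_element n i \<in> carrier (group_ring (free_abelian_group_of_rank n))"
  unfolding difference_element_def by (rule unit_mass_diff_closed[OF generator_closed origin_closed])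

lemma convolution_difference_element:
  assumes "g \<in> carrier (free_abelian_group_of_rank n)"
  shows "convolution (free_abelian_group_of_rank n) (difference_element n i) b g
    = b (\<lambda>k\<in>{..<n}. g k - generator n i k) - b g"
proof -
  let ?G = "free_abelian_group_of_rank n"
  have inv: "inv\<^bsub>?G\<^esub> h \<otimes>\<^bsub>?G\<^esub> g = (\<lambda>k\<in>{..<n}. g k - h k)" if "h \<in> carrier ?G" for h
    using that by (auto simp: fun_eq_iff)
  have "(\<lambda>k\<in>{..<n}. g k - (\<lambda>k\<in>{..<n}. 0) k) = g"
    using assms by (auto simp: PiE_def extensional_def fun_eq_iff)
  then show ?thesis
    unfolding convolution_eq_pairing[OF difference_element_closed assms] pairing_difference_element
      inv[OF generator_closed] inv[OF origin_closed] by simp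
qed

lemma pushforward_difference_element:
  "pushforward (keep_coordinates n S) (difference_element n i) = (if i \<in> S then difference_element n i else (\<lambda>g. 0))"
proof
  fix g
  have "keep_coordinates n S (generator n i) = (if i \<in> S then generator n i else (\<lambda>k\<in>{..<n}. 0))"
    "keep_coordinates n S (\<lambda>k\<in>{..<n}. 0) = (\<lambda>k\<in>{..<n}. 0)"
    by (auto simp: keep_coordinates_def generator_def fun_eq_iff)
  then show "pushforward (keep_coordinates n S) (difference_element n i) g
      = (if i \<in> S then difference_element n i else (\<lambda>g. 0)) g"
    unfolding pushforward_def pairing_difference_element
    by (auto simp: difference_element_def unit_mass_def)
qed

lemma difference_element_regular:
  assumes "i < n" and r: "r \<in> carrier (group_ring (free_abelian_group_of_rank n))"
    and 0: "convolution (free_abelian_group_of_rank n) (difference_element n i) r = (\<lambda>g. 0)"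
  shows "r = (\<lambda>g. 0)"
proof (rule ccontr)
  let ?G = "free_abelian_group_of_rank n"
  assume "r \<noteq> (\<lambda>g. 0)"
  then obtain g where g: "r g \<noteq> 0" by auto
  then have gG: "g \<in> carrier ?G" using r by (auto simp: carrier_group_ring)
  define s where "s m = (\<lambda>k\<in>{..<n}. g k - of_nat m * generator n i k)" for m
  have s: "r (s m) = r g" for m
  proof (induction m)
    case 0
    have "s 0 = g" using gG by (auto simp: s_def PiE_def extensional_def)
    then show ?case by simp
  next
    case (Suc m)
    have "(\<lambda>k\<in>{..<n}. s m k - generator n i k) = s (Suc m)"
      by (auto simp: s_def fun_eq_iff algebra_simps)
    then have "r (s (Suc m)) = r (s m)"
      using convolution_difference_element[of "s m" n i r] 0 by (simp add: s_def)
    then show ?case using Suc by simp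
  qed
  have "inj s"
  proof (rule injI)
    fix l m assume "s l = s m"
    then have "s l i = s m i" by simp
    then show "l = m" using \<open>i < n\<close> by (simp add: s_def generator_def)
  qed
  then have "infinite (range s)" by (simp add: finite_image_iff)
  moreover have "range s \<subseteq> {g. r g \<noteq> 0}" using s g by auto
  moreover have "finite {g. r g \<noteq> 0}" using r by (simp add: carrier_group_ring)
  ultimately show False using finite_subset by blast
qed

text \<open>
  If only the coordinates up to \<open>j\<close> occur in \<open>s\<close>, and forgetting the coordinate \<open>j\<close> kills \<open>s\<close>, then
  \<open>s\<close> is a multiple of \<open>e\<^sub>j - 1\<close>: it is a combination of differences of group elements that agree
  outside the coordinate \<open>j\<close>.
\<close>

lemma difference_element_division:
  assumes j: "j < n" and s: "s \<in> carrier (group_ring (free_abelian_group_of_rank n))"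
    and supp: "\<And>g k. s g \<noteq> 0 \<Longrightarrow> j < k \<Longrightarrow> k < n \<Longrightarrow> g k = 0"
    and 0: "pushforward (keep_coordinates n {..<j}) s = (\<lambda>g. 0)"
  shows "\<exists>r\<in>carrier (group_ring (free_abelian_group_of_rank n)).
    s = convolution (free_abelian_group_of_rank n) (difference_element n j) r"
proof -
  let ?G = "free_abelian_group_of_rank n"
  let ?R = "group_ring ?G :: ((nat \<Rightarrow> int) \<Rightarrow> int) ring"
  let ?e = "generator n j"
  interpret R: cring ?R by (rule cring_group_ring[OF comm_group_free_abelian])
  define J where "J = {convolution ?G (difference_element n j) r | r. r \<in> carrier ?R}"
  have J0: "(\<lambda>g. 0) \<in> J"
    unfolding J_def by (rule CollectI, rule exI[of _ "\<lambda>g. 0"]) (auto simp: convolution_def carrier_group_ring)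
  have Jadd: "(\<lambda>g. a g + b g) \<in> J" if abJ: "a \<in> J" "b \<in> J" for a b
  proof -
    obtain p q where pq: "p \<in> carrier ?R" "q \<in> carrier ?R"
      and ab: "a = convolution ?G (difference_element n j) p" "b = convolution ?G (difference_element n j) q"
      using abJ unfolding J_def by blast
    have "(\<lambda>g. a g + b g) = convolution ?G (difference_element n j) (\<lambda>g. p g + q g)"
      unfolding ab convolution_def by (rule ext) (simp add: distrib_left sum.distrib)
    moreover have "(\<lambda>g. p g + q g) \<in> carrier ?R" using R.a_closed[OF pq] by (simp add: group_ring_def)
    ultimately show ?thesis by (auto simp: J_def)
  qed
  have Jscale: "(\<lambda>g. c * a g) \<in> J" if aJ: "a \<in> J" for a c
  proof -
    obtain p where p: "p \<in> carrier ?R" and a: "a = convolution ?G (difference_element n j) p"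
      using aJ unfolding J_def by blast
    have "(\<lambda>g. c * a g) = convolution ?G (difference_element n j) (\<lambda>g. c * p g)"
      unfolding a convolution_def by (rule ext) (simp add: sum_distrib_left mult.left_commute)
    moreover have "(\<lambda>g. c * p g) \<in> carrier ?R"
      using p by (auto simp: carrier_group_ring intro: rev_finite_subset)
    ultimately show ?thesis by (auto simp: J_def)
  qed
  define tr where "tr h m = (\<lambda>k\<in>{..<n}. h k + m * ?e k)" for h :: "nat \<Rightarrow> int" and m
  have step: "(\<lambda>g. unit_mass (tr h (m + 1)) g - unit_mass (tr h m) g) \<in> J" for h m
  proof -
    have "(\<lambda>g. unit_mass (tr h (m + 1)) g - unit_mass (tr h m) g)
        = convolution ?G (difference_element n j) (unit_mass (tr h m))"
    proof
      fix g
      show "unit_mass (tr h (m + 1)) g - unit_mass (tr h m) g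
        = convolution ?G (difference_element n j) (unit_mass (tr h m)) g"
      proof (cases "g \<in> carrier ?G")
        case True
        have "(\<lambda>k\<in>{..<n}. g k - ?e k) = tr h m \<longleftrightarrow> (\<forall>k<n. g k - ?e k = h k + m * ?e k)"
          by (auto simp: tr_def restrict_def fun_eq_iff)
        also have "\<dots> \<longleftrightarrow> (\<forall>k<n. g k = h k + (m + 1) * ?e k)"
          by (simp add: algebra_simps)
        also have "\<dots> \<longleftrightarrow> g = tr h (m + 1)"
        proof -
          have "g k = undefined" if "\<not> k < n" for k
            using True that by (simp add: PiE_def extensional_def)
          then show ?thesis by (auto simp: tr_def restrict_def fun_eq_iff)
        qed
        finally have "(\<lambda>k\<in>{..<n}. g k - ?e k) = tr h m \<longleftrightarrow> g = tr h (m + 1)" .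
        then show ?thesis
          unfolding convolution_difference_element[OF True] by (simp add: unit_mass_def)
      qed (auto simp: convolution_outside unit_mass_def tr_def)
    qed
    moreover have "unit_mass (tr h m) \<in> carrier ?R" by (intro unit_mass_closed) (simp add: tr_def)
    ultimately show ?thesis by (auto simp: J_def)
  qed
  have shift: "(\<lambda>g. unit_mass (tr h m) g - unit_mass (tr h 0) g) \<in> J" for h m
  proof (induction m rule: int_induct[of _ 0])
    case base
    then show ?case using J0 by simp
  next
    case (step1 m)
    then show ?case using Jadd[OF step[of h m] step1(2)] by simp
  next
    case (step2 m)
    have "(\<lambda>g. - 1 * (unit_mass (tr h (m - 1 + 1)) g - unit_mass (tr h (m - 1)) g)) \<in> J"
      by (rule Jscale[OF step])
    from Jadd[OF this step2(2)] show ?case by simp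
  qed
  have unit: "(\<lambda>g. unit_mass h g - unit_mass (keep_coordinates n {..<j} h) g) \<in> J" if h: "s h \<noteq> 0" for h
  proof -
    have hG: "h \<in> carrier ?G" using h s by (auto simp: carrier_group_ring)
    have "h = tr (keep_coordinates n {..<j} h) (h j)"
    proof
      fix k
      show "h k = tr (keep_coordinates n {..<j} h) (h j) k"
        using hG supp[OF h, of k]
        by (cases k j rule: linorder_cases)
          (auto simp: tr_def keep_coordinates_def generator_def PiE_def extensional_def)
    qed
    moreover have "keep_coordinates n {..<j} h = tr (keep_coordinates n {..<j} h) 0"
      by (auto simp: tr_def keep_coordinates_def)
    ultimately show ?thesis using shift[of "keep_coordinates n {..<j} h" "h j"] by metis
  qed
  have fin: "finite {h. s h \<noteq> 0}" using s by (simp add: carrier_group_ring)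
  have "(\<lambda>g. \<Sum>h\<in>F. s h * (unit_mass h g - unit_mass (keep_coordinates n {..<j} h) g)) \<in> J"
    if "finite F" "F \<subseteq> {h. s h \<noteq> 0}" for F
    using that
  proof (induction F rule: finite_induct)
    case empty
    then show ?case using J0 by simp
  next
    case (insert h F)
    then show ?case using Jadd[OF Jscale[OF unit[of h], of "s h"]] by simp
  qed
  from this[OF fin subset_refl]
  have "(\<lambda>g. \<Sum>h | s h \<noteq> 0. s h * (unit_mass h g - unit_mass (keep_coordinates n {..<j} h) g)) \<in> J" .
  moreover have "(\<Sum>h | s h \<noteq> 0. s h * (unit_mass h g - unit_mass (keep_coordinates n {..<j} h) g)) = s g" for g
  proof -
    have "(\<Sum>h | s h \<noteq> 0. s h * (unit_mass h g - unit_mass (keep_coordinates n {..<j} h) g))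
        = pairing s (\<lambda>h. if h = g then 1 else 0) - pushforward (keep_coordinates n {..<j}) s g"
      unfolding pushforward_def pairing_def sum_subtractf[symmetric]
      by (intro sum.cong) (auto simp: unit_mass_def)
    then show ?thesis by (simp add: pairing_indicator[OF fin] 0)
  qed
  ultimately have "s \<in> J" by simp
  then show ?thesis by (auto simp: J_def)
qed

section \<open>Projective modules and resolutions\<close>

abbreviation lin_hom ::
    "('r, 's) ring_scheme \<Rightarrow> ('r, 'm, 't) module_scheme \<Rightarrow> ('r, 'l, 'u) module_scheme \<Rightarrow> ('m \<Rightarrow> 'l) set" where
  "lin_hom \<equiv> LinearCombinations.module_hom"

lemma lin_homI:
  assumes "\<And>x. x \<in> carrier M \<Longrightarrow> f x \<in> carrier N"
    and "\<And>x y. x \<in> carrier M \<Longrightarrow> y \<in> carrier M \<Longrightarrow> f (x \<oplus>\<^bsub>M\<^esub> y) = f x \<oplus>\<^bsub>N\<^esub> f y"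
    and "\<And>r x. r \<in> carrier R \<Longrightarrow> x \<in> carrier M \<Longrightarrow> f (r \<odot>\<^bsub>M\<^esub> x) = r \<odot>\<^bsub>N\<^esub> f x"
  shows "f \<in> lin_hom R M N"
  using assms by (auto simp: LinearCombinations.module_hom_def)

lemma lin_homD:
  assumes "f \<in> lin_hom R M N" "x \<in> carrier M"
  shows "f x \<in> carrier N"
    and "y \<in> carrier M \<Longrightarrow> f (x \<oplus>\<^bsub>M\<^esub> y) = f x \<oplus>\<^bsub>N\<^esub> f y"
    and "r \<in> carrier R \<Longrightarrow> f (r \<odot>\<^bsub>M\<^esub> x) = r \<odot>\<^bsub>N\<^esub> f x"
  using assms by (auto simp: LinearCombinations.module_hom_def)

lemma module_if_left_module:
  assumes "cring R" "left_module R M"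
  shows "module R M"
proof -
  interpret left_module R M by fact
  show ?thesis
    by (intro moduleI assms(1) M.abelian_group_axioms)
      (auto simp: smult_l_distr smult_r_distr smult_assoc1)
qed

lemma left_module_if_module:
  assumes "module R M"
  shows "left_module R M"
proof -
  interpret module R M by fact
  show ?thesis
    by unfold_locales (auto simp: smult_l_distr smult_r_distr smult_assoc1)
qed

lemma lin_hom_zero_minus:
  assumes "module R M" "module R N" "f \<in> lin_hom R M N"
  shows "f \<zero>\<^bsub>M\<^esub> = \<zero>\<^bsub>N\<^esub>"
    and "x \<in> carrier M \<Longrightarrow> f (\<ominus>\<^bsub>M\<^esub> x) = \<ominus>\<^bsub>N\<^esub> f x"
    and "x \<in> carrier M \<Longrightarrow> y \<in> carrier M \<Longrightarrow> f (x \<ominus>\<^bsub>M\<^esub> y) = f x \<ominus>\<^bsub>N\<^esub> f y"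
proof -
  interpret mod_hom R M N f
    using assms by (simp add: mod_hom_def mod_hom_axioms_def)
  show "f \<zero>\<^bsub>M\<^esub> = \<zero>\<^bsub>N\<^esub>"
    and "x \<in> carrier M \<Longrightarrow> f (\<ominus>\<^bsub>M\<^esub> x) = \<ominus>\<^bsub>N\<^esub> f x"
    and "x \<in> carrier M \<Longrightarrow> y \<in> carrier M \<Longrightarrow> f (x \<ominus>\<^bsub>M\<^esub> y) = f x \<ominus>\<^bsub>N\<^esub> f y"
    by simp_all
qed

lemma module_image:
  assumes "module R A" "module R B" "e \<in> lin_hom R A B"
  shows "module R (B\<lparr>carrier := e ` carrier A\<rparr>)"
proof -
  interpret mod_hom R A B e
    using assms by (simp add: mod_hom_def mod_hom_axioms_def)
  have "submodule R (e ` carrier A) B" using im_is_submodule by (simp add: im_def)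
  then show ?thesis using N.submodule_is_module by simp
qed

lemma projective_lift_into_image:
  assumes R: "cring R" and P: "projective R P" and A: "module R A" and B: "module R B"
    and e: "e \<in> lin_hom R A B" and f: "f \<in> lin_hom R P B" and im: "f ` carrier P \<subseteq> e ` carrier A"
  shows "\<exists>h \<in> lin_hom R P A. \<forall>x \<in> carrier P. e (h x) = f x"
proof (rule projective_lift[OF P])
  let ?B = "B\<lparr>carrier := e ` carrier A\<rparr>"
  show "left_module R A" "left_module R ?B"
    using A module_image[OF A B e] by (auto intro: left_module_if_module)
  show "e ` carrier A = carrier ?B" by simp
  show "e \<in> lin_hom R A ?B" "f \<in> lin_hom R P ?B"
    using e f im by (auto simp: LinearCombinations.module_hom_def)
qed

lemma trivial_module_smult: "a \<odot>\<^bsub>trivial_module G\<^esub> m = pairing a (\<lambda>g. 1) * m"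
  by (simp add: trivial_module_def pairing_def)

context
  fixes G :: "('g, 'x) monoid_scheme" and P :: "nat \<Rightarrow> ('g \<Rightarrow> int, 'p) module" and d \<epsilon>
  assumes G: "comm_group G" and res: "projective_resolution G P d \<epsilon>"
begin


lemma cring_resolution_ring: "cring (group_ring G :: ('g \<Rightarrow> int) ring)"
  by (rule cring_group_ring[OF G])

lemma resolution_projective: "projective (group_ring G) (P k)"
  using res by (simp add: projective_resolution_def)

lemma resolution_module: "module (group_ring G) (P k)"
  using res by (intro module_if_left_module cring_resolution_ring) (simp add: projective_resolution_def projective_def)

lemma resolution_hom: "d k \<in> lin_hom (group_ring G) (P (Suc k)) (P k)"
  using res by (simp add: projective_resolution_def)

lemma resolution_augmentation: "\<epsilon> \<in> lin_hom (group_ring G) (P 0) (trivial_module G)" "\<epsilon> ` carrier (P 0) = UNIV"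
  using res by (simp_all add: projective_resolution_def)

lemma resolution_exact:
  "{x \<in> carrier (P 0). \<epsilon> x = 0} = d 0 ` carrier (P (Suc 0))"
  "{x \<in> carrier (P (Suc k)). d k x = \<zero>\<^bsub>P k\<^esub>} = d (Suc k) ` carrier (P (Suc (Suc k)))"
  using res by (simp_all add: projective_resolution_def)

lemma resolution_complex:
  "x \<in> carrier (P (Suc 0)) \<Longrightarrow> \<epsilon> (d 0 x) = 0"
  "x \<in> carrier (P (Suc (Suc k))) \<Longrightarrow> d k (d (Suc k) x) = \<zero>\<^bsub>P k\<^esub>"
  using resolution_exact(1) resolution_exact(2)[of k] by auto

text \<open>
  Multiplication by \<open>x\<close> is a chain map because the ring is commutative, and it is zero on the
  homology of the resolution because \<open>x\<close> has augmentation \<open>0\<close>. The maps \<open>s\<close> are a homotopy from it to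
  the zero map.
\<close>

lemma multiplication_null_homotopic:
  assumes x: "x \<in> carrier (group_ring G)" and aug: "pairing x (\<lambda>g. 1) = 0"
  shows "\<exists>s. (\<forall>k. s k \<in> lin_hom (group_ring G) (P k) (P (Suc k))) \<and>
    (\<forall>y \<in> carrier (P 0). d 0 (s 0 y) = x \<odot>\<^bsub>P 0\<^esub> y) \<and>
    (\<forall>k. \<forall>y \<in> carrier (P (Suc k)). d (Suc k) (s (Suc k) y) = x \<odot>\<^bsub>P (Suc k)\<^esub> y \<ominus>\<^bsub>P (Suc k)\<^esub> s k (d k y))"
proof -
  \<comment> \<open>The second clause makes \<open>x y - s (d y)\<close> a cycle, so that \<open>s\<close> extends by one degree.\<close>
  define good where "good k s \<longleftrightarrow> s \<in> lin_hom (group_ring G) (P k) (P (Suc k)) \<and>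
    (\<forall>y \<in> carrier (P (Suc k)). d k (s (d k y)) = x \<odot>\<^bsub>P k\<^esub> d k y) \<and>
    (k = 0 \<longrightarrow> (\<forall>y \<in> carrier (P 0). d 0 (s y) = x \<odot>\<^bsub>P 0\<^esub> y))" for k s
  define next_to where "next_to k s s' \<longleftrightarrow> (\<forall>y \<in> carrier (P (Suc k)).
    d (Suc k) (s' y) = x \<odot>\<^bsub>P (Suc k)\<^esub> y \<ominus>\<^bsub>P (Suc k)\<^esub> s (d k y))" for k s s'
  have mult: "(\<lambda>y. x \<odot>\<^bsub>P k\<^esub> y) \<in> lin_hom (group_ring G) (P k) (P k)" for k
  proof -
    interpret module "group_ring G" "P k" by (rule resolution_module)
    show ?thesis
      by (intro lin_homI) (auto simp: x smult_r_distr smult_assoc1[symmetric] R.m_comm)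
  qed
  have "\<exists>s. good 0 s"
  proof -
    have "\<epsilon> (x \<odot>\<^bsub>P 0\<^esub> y) = 0" if "y \<in> carrier (P 0)" for y
      using lin_homD(3)[OF resolution_augmentation(1) that x] aug
      by (simp add: trivial_module_smult)
    then have "(\<lambda>y. x \<odot>\<^bsub>P 0\<^esub> y) ` carrier (P 0) \<subseteq> d 0 ` carrier (P (Suc 0))"
      unfolding resolution_exact(1)[symmetric] using lin_homD(1)[OF mult] by auto
    from projective_lift_into_image[OF cring_resolution_ring resolution_projective resolution_module
        resolution_module resolution_hom mult this]
    show ?thesis using lin_homD(1)[OF resolution_hom] by (auto simp: good_def)
  qed
  moreover have "\<exists>s'. good (Suc k) s' \<and> next_to k s s'" if s: "good k s" for k s
  proof -
    interpret P0: module "group_ring G" "P k" by (rule resolution_module)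
    interpret P1: module "group_ring G" "P (Suc k)" by (rule resolution_module)
    have s_hom: "s \<in> lin_hom (group_ring G) (P k) (P (Suc k))" using s by (simp add: good_def)
    note closed = lin_homD(1)[OF s_hom] lin_homD(1)[OF resolution_hom] lin_homD(1)[OF mult]
    define f where "f y = x \<odot>\<^bsub>P (Suc k)\<^esub> y \<ominus>\<^bsub>P (Suc k)\<^esub> s (d k y)" for y
    have f: "f \<in> lin_hom (group_ring G) (P (Suc k)) (P (Suc k))"
    proof (rule lin_homI)
      show "f y \<in> carrier (P (Suc k))" if "y \<in> carrier (P (Suc k))" for y
        using that by (simp add: f_def closed)
      show "f (y \<oplus>\<^bsub>P (Suc k)\<^esub> z) = f y \<oplus>\<^bsub>P (Suc k)\<^esub> f z"
        if "y \<in> carrier (P (Suc k))" "z \<in> carrier (P (Suc k))" for y z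
        using that
        by (simp add: f_def closed lin_homD(2)[OF s_hom] lin_homD(2)[OF resolution_hom]
            lin_homD(2)[OF mult] a_minus_def P1.M.minus_add P1.M.a_ac)
      show "f (r \<odot>\<^bsub>P (Suc k)\<^esub> y) = r \<odot>\<^bsub>P (Suc k)\<^esub> f y"
        if "r \<in> carrier (group_ring G)" "y \<in> carrier (P (Suc k))" for r y
        using that
        by (simp add: f_def closed lin_homD(3)[OF s_hom] lin_homD(3)[OF resolution_hom]
            lin_homD(3)[OF mult] a_minus_def P1.smult_r_distr P1.smult_r_minus)
    qed
    have "f ` carrier (P (Suc k)) \<subseteq> d (Suc k) ` carrier (P (Suc (Suc k)))"
    proof -
      have "d k (f y) = \<zero>\<^bsub>P k\<^esub>" if y: "y \<in> carrier (P (Suc k))" for y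
      proof -
        have "d k (f y) = d k (x \<odot>\<^bsub>P (Suc k)\<^esub> y) \<ominus>\<^bsub>P k\<^esub> d k (s (d k y))"
          unfolding f_def using y
          by (intro lin_hom_zero_minus(3)[OF resolution_module resolution_module resolution_hom] closed)
        also have "\<dots> = x \<odot>\<^bsub>P k\<^esub> d k y \<ominus>\<^bsub>P k\<^esub> x \<odot>\<^bsub>P k\<^esub> d k y"
          using y s x by (simp add: good_def lin_homD(3)[OF resolution_hom])
        also have "\<dots> = \<zero>\<^bsub>P k\<^esub>"
          using y x closed by (simp add: a_minus_def P0.M.r_neg)
        finally show ?thesis .
      qed
      then show ?thesis
        unfolding resolution_exact(2)[symmetric] using lin_homD(1)[OF f] by auto
    qed
    from projective_lift_into_image[OF cring_resolution_ring resolution_projective resolution_module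
        resolution_module resolution_hom f this]
    obtain s' where s': "s' \<in> lin_hom (group_ring G) (P (Suc k)) (P (Suc (Suc k)))"
      "\<And>y. y \<in> carrier (P (Suc k)) \<Longrightarrow> d (Suc k) (s' y) = f y" by blast
    have "d (Suc k) (s' (d (Suc k) y)) = x \<odot>\<^bsub>P (Suc k)\<^esub> d (Suc k) y"
      if "y \<in> carrier (P (Suc (Suc k)))" for y
      using that
      by (simp add: s' f_def closed lin_homD(1)[OF resolution_hom] resolution_complex
          lin_hom_zero_minus(1)[OF resolution_module resolution_module s_hom] a_minus_def x)
    then have "good (Suc k) s'" "next_to k s s'"
      using s' by (auto simp: good_def next_to_def f_def)
    then show ?thesis by blast
  qed
  ultimately have "\<exists>s. \<forall>k. good k (s k) \<and> next_to k (s k) (s (Suc k))"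
    by (rule dependent_nat_choice)
  then show ?thesis unfolding good_def next_to_def by blast
qed

end

text \<open>
  For elements \<open>\<xi>\<^sub>0, \<xi>\<^sub>1, \<dots>\<close> of the ring: the submodule \<open>\<xi>\<^sub>0N + \<dots> + \<xi>\<^sub>j\<^sub>-\<^sub>1N\<close> of \<open>N\<close>.
\<close>

primrec span_multiples :: "(nat \<Rightarrow> 'r) \<Rightarrow> ('r, 'm, 't) module_scheme \<Rightarrow> nat \<Rightarrow> 'm set" where
  "span_multiples \<xi> N 0 = {\<zero>\<^bsub>N\<^esub>}"
| "span_multiples \<xi> N (Suc j) =
    {\<xi> j \<odot>\<^bsub>N\<^esub> m \<oplus>\<^bsub>N\<^esub> w | m w. m \<in> carrier N \<and> w \<in> span_multiples \<xi> N j}"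

lemma span_multiples_closed:
  assumes "module R N" "\<And>i. \<xi> i \<in> carrier R" "w \<in> span_multiples \<xi> N j"
  shows "w \<in> carrier N" and "\<ominus>\<^bsub>N\<^esub> w \<in> span_multiples \<xi> N j"
proof -
  interpret module R N by fact
  have "w \<in> carrier N \<and> \<ominus>\<^bsub>N\<^esub> w \<in> span_multiples \<xi> N j"
    using assms(3)
  proof (induction j arbitrary: w)
    case (Suc j)
    obtain m v where w: "w = \<xi> j \<odot>\<^bsub>N\<^esub> m \<oplus>\<^bsub>N\<^esub> v" and m: "m \<in> carrier N" and v: "v \<in> span_multiples \<xi> N j"
      using Suc.prems by auto
    have "\<ominus>\<^bsub>N\<^esub> w = \<xi> j \<odot>\<^bsub>N\<^esub> (\<ominus>\<^bsub>N\<^esub> m) \<oplus>\<^bsub>N\<^esub> (\<ominus>\<^bsub>N\<^esub> v)"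
      using Suc.IH[OF v] m assms(2) by (simp add: w minus_add smult_r_minus)
    then show ?case using Suc.IH[OF v] m assms(2) by (auto simp: w)
  qed auto
  then show "w \<in> carrier N" "\<ominus>\<^bsub>N\<^esub> w \<in> span_multiples \<xi> N j" by auto
qed

lemma span_multiples_hom:
  assumes "module R M" "module R N" "\<And>i. \<xi> i \<in> carrier R" "f \<in> lin_hom R M N"
    and "w \<in> span_multiples \<xi> M j"
  shows "f w \<in> span_multiples \<xi> N j"
  using assms(5)
proof (induction j arbitrary: w)
  case 0
  then show ?case using lin_hom_zero_minus(1)[OF assms(1,2,4)] by simp
next
  case (Suc j)
  interpret module R M by fact
  obtain m v where w: "w = \<xi> j \<odot>\<^bsub>M\<^esub> m \<oplus>\<^bsub>M\<^esub> v" and m: "m \<in> carrier M" and v: "v \<in> span_multiples \<xi> M j"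
    using Suc.prems by auto
  have "f w = \<xi> j \<odot>\<^bsub>N\<^esub> f m \<oplus>\<^bsub>N\<^esub> f v"
    using m assms(3) span_multiples_closed(1)[where R = R and \<xi> = \<xi>, OF assms(1,3) v]
    by (simp add: w lin_homD(2,3)[OF assms(4)])
  then show ?case using Suc.IH[OF v] lin_homD(1)[OF assms(4) m] by auto
qed

text \<open>
  The elements \<open>u\<^sub>j\<close> are obtained from \<open>u\<^sub>0\<close> by applying the homotopies of \<open>\<xi>\<^sub>0, \<xi>\<^sub>1, \<dots>\<close> in turn. Up to
  sign, \<open>u\<^sub>j\<close> is the image of the exterior product of the first \<open>j\<close> basis vectors under a chain map
  from the Koszul complex; the other basis elements of that complex are not needed.
\<close>

lemma koszul_chain:
  assumes G: "comm_group G" and res: "projective_resolution G P d \<epsilon>"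
    and \<xi>: "\<And>i. \<xi> i \<in> carrier (group_ring G)" "\<And>i. pairing (\<xi> i) (\<lambda>g. 1) = 0"
  shows "\<exists>u. (\<forall>j. u j \<in> carrier (P j)) \<and> \<epsilon> (u 0) = 1 \<and>
    (\<forall>j. \<exists>w \<in> span_multiples \<xi> (P j) j. d j (u (Suc j)) = \<xi> j \<odot>\<^bsub>P j\<^esub> u j \<oplus>\<^bsub>P j\<^esub> w)"
proof -
  let ?R = "group_ring G :: ('a \<Rightarrow> int) ring"
  note M = resolution_module[OF G res]
  have "\<forall>i. \<exists>s. (\<forall>k. s k \<in> lin_hom ?R (P k) (P (Suc k))) \<and>
    (\<forall>y \<in> carrier (P 0). d 0 (s 0 y) = \<xi> i \<odot>\<^bsub>P 0\<^esub> y) \<and>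
    (\<forall>k. \<forall>y \<in> carrier (P (Suc k)). d (Suc k) (s (Suc k) y) = \<xi> i \<odot>\<^bsub>P (Suc k)\<^esub> y \<ominus>\<^bsub>P (Suc k)\<^esub> s k (d k y))"
    using multiplication_null_homotopic[OF G res \<xi>] by blast
  then obtain s where s: "\<And>i k. s i k \<in> lin_hom ?R (P k) (P (Suc k))"
    and s0: "\<And>i y. y \<in> carrier (P 0) \<Longrightarrow> d 0 (s i 0 y) = \<xi> i \<odot>\<^bsub>P 0\<^esub> y"
    and sS: "\<And>i k y. y \<in> carrier (P (Suc k)) \<Longrightarrow>
      d (Suc k) (s i (Suc k) y) = \<xi> i \<odot>\<^bsub>P (Suc k)\<^esub> y \<ominus>\<^bsub>P (Suc k)\<^esub> s i k (d k y)"
    by metis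
  obtain u0 where u0: "u0 \<in> carrier (P 0)" "\<epsilon> u0 = 1"
    using resolution_augmentation(2)[OF G res] by (metis UNIV_I imageE)
  define u where "u = rec_nat u0 (\<lambda>j. s j j)"
  have u: "u 0 = u0" "u (Suc j) = s j j (u j)" for j by (simp_all add: u_def)
  have uP: "u j \<in> carrier (P j)" for j
    by (induction j) (auto simp: u u0 lin_homD(1)[OF s])
  have "\<exists>w \<in> span_multiples \<xi> (P j) j. d j (u (Suc j)) = \<xi> j \<odot>\<^bsub>P j\<^esub> u j \<oplus>\<^bsub>P j\<^esub> w" for j
  proof (induction j)
    case 0
    interpret module ?R "P 0" by (rule M)
    show ?case using s0[OF uP[of 0], of 0] \<xi>(1) uP[of 0] by (simp add: u(2))
  next
    case (Suc j)
    interpret module ?R "P (Suc j)" by (rule M)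
    have "d j (u (Suc j)) \<in> span_multiples \<xi> (P j) (Suc j)"
      using Suc uP[of j] by auto
    then have "s (Suc j) j (d j (u (Suc j))) \<in> span_multiples \<xi> (P (Suc j)) (Suc j)"
      by (rule span_multiples_hom[where R = ?R, OF M M \<xi>(1) s])
    then have "\<ominus>\<^bsub>P (Suc j)\<^esub> s (Suc j) j (d j (u (Suc j))) \<in> span_multiples \<xi> (P (Suc j)) (Suc j)"
      by (rule span_multiples_closed(2)[where R = ?R, OF M \<xi>(1)])
    moreover have "d (Suc j) (u (Suc (Suc j)))
      = \<xi> (Suc j) \<odot>\<^bsub>P (Suc j)\<^esub> u (Suc j) \<oplus>\<^bsub>P (Suc j)\<^esub> (\<ominus>\<^bsub>P (Suc j)\<^esub> s (Suc j) j (d j (u (Suc j))))"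
      using sS[OF uP[of "Suc j"], of "Suc j"] by (simp add: u(2) a_minus_def)
    ultimately show ?case by blast
  qed
  then show ?thesis using uP u0 u(1) by (intro exI[of _ u]) auto
qed

section \<open>A cocycle with values in the group ring\<close>

text \<open>
  The group ring of \<open>G\<close> as a module over itself, where scalars act through the push-forward along
  the endomorphism \<open>q\<close> of \<open>G\<close>.
\<close>

definition pushforward_module ::
    "('g, 'x) monoid_scheme \<Rightarrow> ('g \<Rightarrow> 'g) \<Rightarrow> ('g \<Rightarrow> int, 'g \<Rightarrow> int) module" where
  "pushforward_module G q =
    \<lparr>carrier = carrier (group_ring G), monoid.mult = undefined, one = undefined,
     ring.zero = (\<lambda>g. 0), add = (\<lambda>a b g. a g + b g),
     module.smult = (\<lambda>a b. convolution G (pushforward q a) b)\<rparr>"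

abbreviation regular_module :: "('g, 'x) monoid_scheme \<Rightarrow> ('g \<Rightarrow> int, 'g \<Rightarrow> int) module" where
  "regular_module G \<equiv> pushforward_module G (\<lambda>g. g)"

lemma pushforward_module_simps [simp]:
  "carrier (pushforward_module G q) = carrier (group_ring G)"
  "\<zero>\<^bsub>pushforward_module G q\<^esub> = (\<lambda>g. 0)"
  "a \<oplus>\<^bsub>pushforward_module G q\<^esub> b = (\<lambda>g. a g + b g)"
  "a \<odot>\<^bsub>pushforward_module G q\<^esub> b = convolution G (pushforward q a) b"
  by (simp_all add: pushforward_module_def)

lemma group_ring_simps:
  "\<zero>\<^bsub>group_ring G\<^esub> = (\<lambda>g. 0)"
  "a \<oplus>\<^bsub>group_ring G\<^esub> b = (\<lambda>g. a g + b g)"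
  "a \<otimes>\<^bsub>group_ring G\<^esub> b = convolution G a b"
  "\<one>\<^bsub>group_ring G\<^esub> = unit_mass \<one>\<^bsub>G\<^esub>"
  by (simp_all add: group_ring_def unit_mass_def)

lemma pushforward_identity:
  assumes "a \<in> carrier (group_ring G)"
  shows "pushforward (\<lambda>g. g) a = a"
  using assms by (intro pushforward_id) (auto simp: carrier_group_ring)

lemma module_pushforward_module:
  assumes G: "comm_group G" and q: "q \<in> hom G G"
  shows "module (group_ring G) (pushforward_module G q)"
proof -
  let ?M = "pushforward_module G q"
  let ?R = "group_ring G :: ('a \<Rightarrow> int) ring"
  interpret comm_group G by fact
  interpret R: cring ?R by (rule cring_group_ring[OF G])
  have q': "q \<in> carrier G \<rightarrow> carrier G" using q by (auto simp: hom_def)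
  have closed: "pushforward q a \<in> carrier ?R" if "a \<in> carrier ?R" for a
    using that by (rule pushforward_closed[OF _ q'])
  have fin: "finite {g. a g \<noteq> 0}" if "a \<in> carrier ?R" for a :: "'a \<Rightarrow> int"
    using that by (simp add: carrier_group_ring)
  have one: "pushforward q (unit_mass \<one>\<^bsub>G\<^esub>) = unit_mass \<one>\<^bsub>G\<^esub>"
    unfolding pushforward_def pairing_unit_mass using hom_one[OF q is_group is_group]
    by (auto simp: unit_mass_def fun_eq_iff)
  have "abelian_group (?M)"
  proof (rule abelian_groupI)
    fix x assume "x \<in> carrier (?M)"
    then show "\<exists>y\<in>carrier (?M).
      y \<oplus>\<^bsub>?M\<^esub> x = \<zero>\<^bsub>?M\<^esub>"
      using R.l_neg[of x] R.a_inv_closed[of x] by (auto simp: group_ring_simps)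
  qed (use R.a_closed R.zero_closed in \<open>auto simp: group_ring_simps algebra_simps\<close>)
  then show ?thesis
  proof (rule moduleI[OF R.cring_axioms])
    fix a x assume a: "a \<in> carrier ?R" and x: "x \<in> carrier (?M)"
    show "a \<odot>\<^bsub>?M\<^esub> x \<in> carrier (?M)"
      using R.m_closed[OF closed[OF a]] x by (simp add: group_ring_simps)
    show "(a \<oplus>\<^bsub>?R\<^esub> b) \<odot>\<^bsub>?M\<^esub> x =
      a \<odot>\<^bsub>?M\<^esub> x \<oplus>\<^bsub>?M\<^esub> b \<odot>\<^bsub>?M\<^esub> x"
      if b: "b \<in> carrier ?R" for b
      using R.l_distr[OF closed[OF a] closed[OF b]] x
      by (simp add: group_ring_simps pushforward_add fin a b)
    show "a \<odot>\<^bsub>?M\<^esub> (x \<oplus>\<^bsub>?M\<^esub> y) =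
      a \<odot>\<^bsub>?M\<^esub> x \<oplus>\<^bsub>?M\<^esub> a \<odot>\<^bsub>?M\<^esub> y"
      if y: "y \<in> carrier (?M)" for y
      using R.r_distr[OF _ _ closed[OF a]] x y by (simp add: group_ring_simps)
    show "(a \<otimes>\<^bsub>?R\<^esub> b) \<odot>\<^bsub>?M\<^esub> x =
      a \<odot>\<^bsub>?M\<^esub> (b \<odot>\<^bsub>?M\<^esub> x)"
      if b: "b \<in> carrier ?R" for b
      using R.m_assoc[OF closed[OF a] closed[OF b]] x
      by (simp add: group_ring_simps pushforward_convolution[OF is_group q a b])
  next
    fix x assume x: "x \<in> carrier (?M)"
    show "\<one>\<^bsub>?R\<^esub> \<odot>\<^bsub>?M\<^esub> x = x"
      using R.l_one x by (simp add: group_ring_simps one)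
  qed
qed

lemma convolution_zero_left: "convolution G (\<lambda>g. 0) b = (\<lambda>g. 0)"
  unfolding convolution_def by (rule ext) (simp del: Collect_conj_eq)

text \<open>Only the coordinate \<open>j\<close> is kept, and so the factors \<open>e\<^sub>0 - 1, \<dots>, e\<^sub>i\<^sub>-\<^sub>1 - 1\<close> become zero.\<close>

lemma pushforward_span_multiples:
  assumes "i \<le> j"
    and "w \<in> span_multiples (difference_element n) (regular_module (free_abelian_group_of_rank n)) i"
  shows "pushforward (keep_coordinates n {j}) w = (\<lambda>g. 0)"
  using assms
proof (induction i arbitrary: w)
  case 0
  then show ?case by (simp add: pushforward_def pairing_def)
next
  case (Suc i)
  let ?G = "free_abelian_group_of_rank n"
  let ?R = "group_ring ?G :: ((nat \<Rightarrow> int) \<Rightarrow> int) ring"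
  note module = module_pushforward_module[OF comm_group_free_abelian[of n], of "\<lambda>g. g"]
  note G = group_free_abelian[of n]
  obtain m v where m: "m \<in> carrier ?R"
    and v: "v \<in> span_multiples (difference_element n) (regular_module ?G) i"
    and w: "w = (\<lambda>g. convolution ?G (difference_element n i) m g + v g)"
    using Suc.prems by (auto simp: pushforward_identity[OF difference_element_closed])
  have vR: "v \<in> carrier ?R"
    using span_multiples_closed(1)[OF module _ v] difference_element_closed
    by (auto simp: hom_def)
  have mR: "convolution ?G (difference_element n i) m \<in> carrier ?R"
    by (intro convolution_closed G difference_element_closed m)
  have "pushforward (keep_coordinates n {j}) w
      = (\<lambda>g. pushforward (keep_coordinates n {j}) (convolution ?G (difference_element n i) m) g
          + pushforward (keep_coordinates n {j}) v g)"
    unfolding w using mR vR by (intro pushforward_add) (simp_all add: carrier_group_ring)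
  moreover have "pushforward (keep_coordinates n {j}) v = (\<lambda>g. 0)"
    using Suc.IH[OF _ v] Suc.prems(1) by simp
  moreover have "pushforward (keep_coordinates n {j}) (convolution ?G (difference_element n i) m) = (\<lambda>g. 0)"
    unfolding pushforward_convolution[OF G keep_coordinates_hom difference_element_closed m]
    using Suc.prems(1) by (simp add: pushforward_difference_element convolution_zero_left)
  ultimately show ?case by simp
qed

lemma pairing_augmentation_pushforward:
  assumes "a \<in> carrier (group_ring G)"
  shows "pairing (pushforward q a) (\<lambda>g. 1) = pairing a (\<lambda>g. 1)"
  using assms by (simp add: pairing_pushforward carrier_group_ring)

text \<open>
  The induction constructs linear maps \<open>c\<^sub>j : P\<^sub>j \<rightarrow> R\<close> that are cocycles after the push-forward \<open>p\<^sub>j\<close>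
  to the first \<open>j\<close> coordinates, that is, modulo \<open>x\<^sub>j, \<dots>, x\<^sub>n\<^sub>-\<^sub>1\<close>. The next map is determined modulo
  \<open>x\<^sub>j\<^sub>+\<^sub>1, \<dots>, x\<^sub>n\<^sub>-\<^sub>1\<close> by the congruence \<open>x\<^sub>j c\<^sub>j\<^sub>+\<^sub>1 \<equiv> c\<^sub>j d\<close>.
\<close>

lemma koszul_cocycle:
  fixes n :: nat and P :: "nat \<Rightarrow> ((nat \<Rightarrow> int) \<Rightarrow> int, 'p) module"
  defines "G \<equiv> free_abelian_group_of_rank n"
  assumes res: "projective_resolution G P d \<epsilon>"
    and u: "\<And>j. u j \<in> carrier (P j)" "\<epsilon> (u 0) = 1"
    and du: "\<And>j. \<exists>w \<in> span_multiples (difference_element n) (P j) j.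
      d j (u (Suc j)) = difference_element n j \<odot>\<^bsub>P j\<^esub> u j \<oplus>\<^bsub>P j\<^esub> w"
  shows "\<exists>c \<in> lin_hom (group_ring G) (P n) (regular_module G).
    (\<forall>y \<in> carrier (P (Suc n)). c (d n y) = (\<lambda>g. 0)) \<and> pairing (c (u n)) (\<lambda>g. 1) = 1"
proof -
  let ?R = "group_ring G :: ((nat \<Rightarrow> int) \<Rightarrow> int) ring"
  let ?N = "regular_module G"
  let ?x = "difference_element n"
  define p where "p j = keep_coordinates n {..<j}" for j
  have commG: "comm_group G" by (simp add: G_def comm_group_free_abelian)
  then interpret comm_group G .
  interpret R: cring ?R by (rule cring_group_ring[OF commG])
  have p_hom: "p j \<in> hom G G" for j by (simp add: p_def G_def keep_coordinates_hom)
  have id_hom: "(\<lambda>g. g) \<in> hom G G" by (simp add: hom_def Pi_def)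
  have x: "?x i \<in> carrier ?R" for i by (simp add: G_def difference_element_closed)
  note P = resolution_module[OF commG res] and d = resolution_hom[OF commG res]
  note N = module_pushforward_module[OF commG id_hom]
  have fin: "finite {g. a g \<noteq> 0}" if "a \<in> carrier ?R" for a
    using that by (simp add: carrier_group_ring)
  have push_closed: "pushforward (p j) a \<in> carrier ?R" if "a \<in> carrier ?R" for a j
    using that p_hom[of j] by (intro pushforward_closed) (auto simp: hom_def)
  have "\<exists>c \<in> lin_hom ?R (P j) ?N. (\<forall>y \<in> carrier (P (Suc j)). pushforward (p j) (c (d j y)) = (\<lambda>g. 0)) \<and>
      pairing (c (u j)) (\<lambda>g. 1) = 1" if "j \<le> n" for j
    using that
  proof (induction j)
    case 0
    let ?aug = "\<lambda>a. pairing a (\<lambda>g. 1) :: int"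
    have aug: "?aug \<in> lin_hom ?R ?N (trivial_module G)"
    proof (rule lin_homI)
      fix a b assume "a \<in> carrier ?N" "b \<in> carrier ?N"
      then show "?aug (a \<oplus>\<^bsub>?N\<^esub> b) = ?aug a \<oplus>\<^bsub>trivial_module G\<^esub> ?aug b"
        using pairing_add[OF fin fin] by (simp add: trivial_module_def)
    next
      fix r a assume "r \<in> carrier ?R" "a \<in> carrier ?N"
      then show "?aug (r \<odot>\<^bsub>?N\<^esub> a) = r \<odot>\<^bsub>trivial_module G\<^esub> ?aug a"
        by (simp add: pushforward_identity pairing_convolution[OF is_group] trivial_module_smult)
          (simp add: pairing_def sum_distrib_right)
    qed (simp add: trivial_module_def)
    have "\<epsilon> ` carrier (P 0) \<subseteq> ?aug ` carrier ?N"
    proof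
      fix m :: int
      have "(\<lambda>g. m * unit_mass \<one>\<^bsub>G\<^esub> g) \<in> carrier ?N"
        by (auto simp: carrier_group_ring unit_mass_def)
      moreover have "?aug (\<lambda>g. m * unit_mass \<one>\<^bsub>G\<^esub> g) = m"
        by (subst pairing_superset[of "{\<one>\<^bsub>G\<^esub>}"]) (auto simp: unit_mass_def)
      ultimately show "m \<in> ?aug ` carrier ?N" by (metis image_eqI)
    qed
    from projective_lift_into_image[OF R.cring_axioms resolution_projective[OF commG res] N
        module_if_left_module[OF R.cring_axioms left_module_trivial_module[OF is_group]]
        aug resolution_augmentation(1)[OF commG res] this]
    obtain c where c: "c \<in> lin_hom ?R (P 0) ?N"
      and aug_c: "\<And>y. y \<in> carrier (P 0) \<Longrightarrow> ?aug (c y) = \<epsilon> y" by blast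
    have "pushforward (p 0) (c (d 0 y)) = (\<lambda>g. 0)" if y: "y \<in> carrier (P (Suc 0))" for y
    proof
      fix g
      have "pushforward (p 0) (c (d 0 y)) g = ?aug (c (d 0 y)) * (if p 0 undefined = g then 1 else 0)"
        by (simp add: pushforward_def p_def keep_coordinates_def pairing_def)
      also have "?aug (c (d 0 y)) = 0"
        using aug_c[OF lin_homD(1)[OF d y]] resolution_complex(1)[OF commG res y] by simp
      finally show "pushforward (p 0) (c (d 0 y)) g = 0" by simp
    qed
    then show ?case using c aug_c[OF u(1)] u(2) by auto
  next
    case (Suc j)
    then have j: "j < n" by simp
    obtain c where c: "c \<in> lin_hom ?R (P j) ?N"
      and pc: "\<And>y. y \<in> carrier (P (Suc j)) \<Longrightarrow> pushforward (p j) (c (d j y)) = (\<lambda>g. 0)"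
      and aug_c: "pairing (c (u j)) (\<lambda>g. 1) = 1"
      using Suc by auto
    let ?B = "pushforward_module G (p (Suc j))"
    \<comment> \<open>The division by \<open>x\<^sub>j\<close> is a lift of \<open>f\<close> along \<open>e\<close>; the target carries the scalar action through \<open>p\<close>.\<close>
    define e where "e r = pushforward (p (Suc j)) (convolution G (?x j) r)" for r
    define f where "f y = pushforward (p (Suc j)) (c (d j y))" for y
    note B = module_pushforward_module[OF commG p_hom, of "Suc j"]
    have conv_closed: "convolution G a b \<in> carrier ?R" if "a \<in> carrier ?R" "b \<in> carrier ?R" for a b :: "(nat \<Rightarrow> int) \<Rightarrow> int"
      using that by (rule convolution_closed[OF is_group])
    have c_closed: "c y \<in> carrier ?R" if "y \<in> carrier (P j)" for y
      using lin_homD(1)[OF c that] by simp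
    have e: "e \<in> lin_hom ?R ?N ?B"
    proof (rule lin_homI)
      fix a b assume ab: "a \<in> carrier ?N" "b \<in> carrier ?N"
      show "e a \<in> carrier ?B" using ab by (simp add: e_def push_closed conv_closed x)
      show "e (a \<oplus>\<^bsub>?N\<^esub> b) = e a \<oplus>\<^bsub>?B\<^esub> e b"
        using ab R.r_distr[of a b "?x j"] x
        by (simp add: e_def group_ring_simps pushforward_add fin conv_closed)
    next
      fix r a assume r: "r \<in> carrier ?R" and a: "a \<in> carrier ?N"
      have "convolution G (?x j) (convolution G r a) = convolution G r (convolution G (?x j) a)"
        using r a x R.m_lcomm[of "?x j" r a] by (simp add: group_ring_simps)
      then show "e (r \<odot>\<^bsub>?N\<^esub> a) = r \<odot>\<^bsub>?B\<^esub> e a"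
        using r a
        by (simp add: e_def pushforward_identity pushforward_convolution[OF is_group p_hom] conv_closed x)
    qed
    have f: "f \<in> lin_hom ?R (P (Suc j)) ?B"
    proof (rule lin_homI)
      fix y z assume yz: "y \<in> carrier (P (Suc j))" "z \<in> carrier (P (Suc j))"
      show "f y \<in> carrier ?B"
        using yz by (simp add: f_def push_closed c_closed lin_homD(1)[OF d])
      show "f (y \<oplus>\<^bsub>P (Suc j)\<^esub> z) = f y \<oplus>\<^bsub>?B\<^esub> f z"
        using yz by (simp add: f_def lin_homD(1,2)[OF d] lin_homD(2)[OF c] pushforward_add fin c_closed)
    next
      fix r y assume r: "r \<in> carrier ?R" and y: "y \<in> carrier (P (Suc j))"
      show "f (r \<odot>\<^bsub>P (Suc j)\<^esub> y) = r \<odot>\<^bsub>?B\<^esub> f y"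
        using r y by (simp add: f_def lin_homD(1,3)[OF d] lin_homD(3)[OF c] c_closed
            pushforward_identity pushforward_convolution[OF is_group p_hom])
    qed
    have "f ` carrier (P (Suc j)) \<subseteq> e ` carrier ?N"
    proof
      fix b assume "b \<in> f ` carrier (P (Suc j))"
      then obtain y where y: "y \<in> carrier (P (Suc j))" and b: "b = f y" by auto
      have cd: "c (d j y) \<in> carrier ?R" by (intro c_closed lin_homD(1)[OF d] y)
      have bR: "b \<in> carrier ?R" unfolding b f_def by (intro push_closed cd)
      have "pushforward (p j) b = (\<lambda>g. 0)"
      proof -
        have "pushforward (p j) b = pushforward (p j) (c (d j y))"
          unfolding b f_def pushforward_pushforward[OF fin[OF cd]] p_def keep_coordinates_compose
          by (simp add: Int_absorb2 lessThan_subset_iff)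
        then show ?thesis by (simp add: pc[OF y])
      qed
      moreover have "g k = 0" if "b g \<noteq> 0" "j < k" "k < n" for g k
      proof -
        have "g \<in> p (Suc j) ` {g. c (d j y) g \<noteq> 0}"
          using that pushforward_support[of "p (Suc j)" "c (d j y)"] by (auto simp: b f_def)
        then show ?thesis using that by (auto simp: p_def keep_coordinates_def)
      qed
      ultimately obtain r where r: "r \<in> carrier ?R" "b = convolution G (?x j) r"
        using difference_element_division[OF j bR[unfolded G_def]] unfolding G_def p_def by blast
      have "e r = pushforward (p (Suc j)) b" by (simp add: e_def r(2))
      also have "\<dots> = b"
        unfolding b f_def pushforward_pushforward[OF fin[OF cd]] by (simp add: p_def keep_coordinates_compose)
      finally show "b \<in> e ` carrier ?N" using r(1) by (metis image_eqI pushforward_module_simps(1))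
    qed
    from projective_lift_into_image[OF R.cring_axioms resolution_projective[OF commG res] N B e f this]
    obtain c' where c': "c' \<in> lin_hom ?R (P (Suc j)) ?N"
      and ec': "\<And>y. y \<in> carrier (P (Suc j)) \<Longrightarrow> e (c' y) = f y" by blast
    have c'_closed: "c' y \<in> carrier ?R" if "y \<in> carrier (P (Suc j))" for y
      using lin_homD(1)[OF c' that] by simp
    have "pushforward (p (Suc j)) (c' (d (Suc j) y)) = (\<lambda>g. 0)" if y: "y \<in> carrier (P (Suc (Suc j)))" for y
    proof -
      let ?y = "d (Suc j) y"
      have dy: "?y \<in> carrier (P (Suc j))" by (rule lin_homD(1)[OF d y])
      have "f ?y = (\<lambda>g. 0)"
        unfolding f_def resolution_complex(2)[OF commG res y] lin_hom_zero_minus(1)[OF P N c]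
        by (simp add: pushforward_def pairing_def)
      then have "convolution G (?x j) (pushforward (p (Suc j)) (c' ?y)) = (\<lambda>g. 0)"
        using ec'[OF dy] j pushforward_convolution[OF is_group p_hom x c'_closed[OF dy], of "Suc j" j]
        by (simp add: e_def p_def pushforward_difference_element)
      then show ?thesis
        using difference_element_regular[OF j push_closed[OF c'_closed[OF dy], unfolded G_def]]
        unfolding G_def by blast
    qed
    moreover have "pairing (c' (u (Suc j))) (\<lambda>g. 1) = 1"
    proof -
      \<comment> \<open>Keeping only the coordinate \<open>j\<close> preserves augmentations and removes the contribution to
        \<open>c (d u\<^sub>j\<^sub>+\<^sub>1)\<close> of all terms other than \<open>x\<^sub>j u\<^sub>j\<close>. The factor \<open>x\<^sub>j\<close> can then be cancelled.\<close>
      let ?\<pi> = "keep_coordinates n {j}"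
      have \<pi>_hom: "?\<pi> \<in> hom G G" by (simp add: G_def keep_coordinates_hom)
      have \<pi>_closed: "pushforward ?\<pi> a \<in> carrier ?R" if "a \<in> carrier ?R" for a
        using that \<pi>_hom by (intro pushforward_closed) (auto simp: hom_def)
      have \<pi>p: "pushforward ?\<pi> (pushforward (p (Suc j)) a) = pushforward ?\<pi> a" if "a \<in> carrier ?R" for a :: "(nat \<Rightarrow> int) \<Rightarrow> int"
        unfolding pushforward_pushforward[OF fin[OF that]] by (simp add: p_def keep_coordinates_compose)
      have \<pi>x: "pushforward ?\<pi> (convolution G (?x j) a) = convolution G (?x j) (pushforward ?\<pi> a)"
        if "a \<in> carrier ?R" for a
        using pushforward_convolution[OF is_group \<pi>_hom x that] by (simp add: pushforward_difference_element)
      obtain w where w: "w \<in> span_multiples ?x (P j) j"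
        and duj: "d j (u (Suc j)) = ?x j \<odot>\<^bsub>P j\<^esub> u j \<oplus>\<^bsub>P j\<^esub> w" using du by blast
      interpret Pj: module ?R "P j" by (rule P)
      have wP: "w \<in> carrier (P j)" by (rule span_multiples_closed(1)[OF P x w])
      have \<pi>w: "pushforward ?\<pi> (c w) = (\<lambda>g. 0)"
        using span_multiples_hom[OF P N x c w] pushforward_span_multiples[of j j] unfolding G_def by blast
      have "convolution G (?x j) (pushforward ?\<pi> (c' (u (Suc j))))
          = pushforward ?\<pi> (e (c' (u (Suc j))))"
        by (simp add: e_def \<pi>p conv_closed x c'_closed u \<pi>x)
      also have "\<dots> = pushforward ?\<pi> (c (d j (u (Suc j))))"
        by (simp add: ec' u f_def \<pi>p c_closed lin_homD(1)[OF d])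
      also have "\<dots> = pushforward ?\<pi> (\<lambda>g. convolution G (?x j) (c (u j)) g + c w g)"
        using wP u x by (simp add: duj lin_homD(2,3)[OF c] pushforward_identity[OF x])
      also have "\<dots> = convolution G (?x j) (pushforward ?\<pi> (c (u j)))"
        by (simp add: pushforward_add fin conv_closed x c_closed u wP \<pi>w \<pi>x)
      finally have eq: "convolution G (?x j) (pushforward ?\<pi> (c' (u (Suc j))))
        = convolution G (?x j) (pushforward ?\<pi> (c (u j)))" .
      define a where "a = pushforward ?\<pi> (c' (u (Suc j)))"
      define b where "b = pushforward ?\<pi> (c (u j))"
      have ab: "a \<in> carrier ?R" "b \<in> carrier ?R"
        by (simp_all add: a_def b_def \<pi>_closed c_closed c'_closed u)
      have "?x j \<otimes>\<^bsub>?R\<^esub> (a \<ominus>\<^bsub>?R\<^esub> b) = \<zero>\<^bsub>?R\<^esub>"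
      proof -
        have "?x j \<otimes>\<^bsub>?R\<^esub> a = ?x j \<otimes>\<^bsub>?R\<^esub> b" using eq by (simp add: group_ring_simps a_def b_def)
        then show ?thesis using ab x[of j] by (simp add: a_minus_def R.r_distr R.r_minus R.r_neg)
      qed
      then have "a \<ominus>\<^bsub>?R\<^esub> b = \<zero>\<^bsub>?R\<^esub>"
        using difference_element_regular[OF j, of "a \<ominus>\<^bsub>?R\<^esub> b"] R.minus_closed[OF ab]
        by (simp add: group_ring_simps(1,3) G_def)
      then have "a = b" using ab by (simp add: R.r_right_minus_eq)
      then have "pairing (c' (u (Suc j))) (\<lambda>g. 1) = pairing (c (u j)) (\<lambda>g. 1)"
        unfolding a_def b_def using pairing_augmentation_pushforward c_closed c'_closed u by metis
      then show ?thesis using aug_c by simp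
    qed
    ultimately show ?case using c' by blast
  qed
  from this[OF order_refl] obtain c where c: "c \<in> lin_hom ?R (P n) ?N"
    and pc: "\<And>y. y \<in> carrier (P (Suc n)) \<Longrightarrow> pushforward (p n) (c (d n y)) = (\<lambda>g. 0)"
    and aug_c: "pairing (c (u n)) (\<lambda>g. 1) = 1" by blast
  have "c (d n y) = (\<lambda>g. 0)" if y: "y \<in> carrier (P (Suc n))" for y
  proof -
    have "c (d n y) \<in> carrier ?R" using lin_homD(1)[OF c lin_homD(1)[OF d y]] by simp
    then have "pushforward (p n) (c (d n y)) = c (d n y)"
      by (intro pushforward_id) (auto simp: carrier_group_ring p_def G_def intro!: keep_coordinates_eq)
    then show ?thesis using pc[OF y] by simp
  qed
  then show ?thesis using c aug_c by blast
qed

section \<open>Square-summable functions on a group\<close>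

text \<open>
  Membership in the Hilbert space and the norm are controlled by the finite partial sums.
\<close>

lemma l2_boundI:
  assumes "\<And>g. g \<notin> carrier G \<Longrightarrow> \<beta> g = 0" "K \<ge> 0"
    and "\<And>F. finite F \<Longrightarrow> F \<subseteq> carrier G \<Longrightarrow> L2_set (\<lambda>g. cmod (\<beta> g)) F \<le> K"
  shows "\<beta> \<in> l2_space G" and "l2_norm G \<beta> \<le> K"
proof -
  have *: "(\<Sum>g\<in>F. (cmod (\<beta> g))\<^sup>2) \<le> K\<^sup>2" if "finite F" "F \<subseteq> carrier G" for F
  proof -
    have "(L2_set (\<lambda>g. cmod (\<beta> g)) F)\<^sup>2 \<le> K\<^sup>2"
      using assms(3)[OF that] by (intro power_mono) auto
    then show ?thesis by (simp add: L2_set_def sum_nonneg)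
  qed
  have sum: "(\<lambda>g. (cmod (\<beta> g))\<^sup>2) summable_on carrier G"
    using * by (intro nonneg_bdd_above_summable_on bdd_aboveI[of _ "K\<^sup>2"]) auto
  then show "\<beta> \<in> l2_space G" using assms(1) by (simp add: l2_space_def)
  have "(\<Sum>\<^sub>\<infinity>g\<in>carrier G. (cmod (\<beta> g))\<^sup>2) \<le> K\<^sup>2"
    using sum * by (intro infsum_le_finite_sums) auto
  then show "l2_norm G \<beta> \<le> K"
    unfolding l2_norm_def using assms(2) by (simp add: real_le_lsqrt)
qed

lemma l2_norm_nonneg: "0 \<le> l2_norm G \<beta>"
  by (simp add: l2_norm_def infsum_nonneg)

lemma L2_set_le_l2_norm:
  assumes "\<beta> \<in> l2_space G" "finite F" "F \<subseteq> carrier G"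
  shows "L2_set (\<lambda>g. cmod (\<beta> g)) F \<le> l2_norm G \<beta>"
proof -
  have "(\<Sum>g\<in>F. (cmod (\<beta> g))\<^sup>2) \<le> (\<Sum>\<^sub>\<infinity>g\<in>carrier G. (cmod (\<beta> g))\<^sup>2)"
    using assms by (intro finite_sum_le_infsum) (auto simp: l2_space_def)
  then show ?thesis by (simp add: L2_set_def l2_norm_def)
qed

lemma l2_outside: "\<beta> \<in> l2_space G \<Longrightarrow> g \<notin> carrier G \<Longrightarrow> \<beta> g = 0"
  by (simp add: l2_space_def)

lemma cmod_le_l2_norm:
  assumes "\<beta> \<in> l2_space G"
  shows "cmod (\<beta> g) \<le> l2_norm G \<beta>"
  using L2_set_le_l2_norm[OF assms, of "{g}"] l2_outside[OF assms] l2_norm_nonneg[of G \<beta>]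
  by (cases "g \<in> carrier G") (auto simp: L2_set_def)

lemma l2_add:
  assumes "\<beta> \<in> l2_space G" "\<gamma> \<in> l2_space G"
  shows "(\<lambda>g. \<beta> g + \<gamma> g) \<in> l2_space G"
    and "l2_norm G (\<lambda>g. \<beta> g + \<gamma> g) \<le> l2_norm G \<beta> + l2_norm G \<gamma>"
proof -
  have "L2_set (\<lambda>g. cmod (\<beta> g + \<gamma> g)) F \<le> l2_norm G \<beta> + l2_norm G \<gamma>"
    if F: "finite F" "F \<subseteq> carrier G" for F
  proof -
    have "L2_set (\<lambda>g. cmod (\<beta> g + \<gamma> g)) F \<le> L2_set (\<lambda>g. cmod (\<beta> g) + cmod (\<gamma> g)) F"
      by (intro L2_set_mono norm_triangle_ineq) auto
    also have "\<dots> \<le> L2_set (\<lambda>g. cmod (\<beta> g)) F + L2_set (\<lambda>g. cmod (\<gamma> g)) F"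
      by (rule L2_set_triangle_ineq)
    finally show ?thesis
      using L2_set_le_l2_norm[OF assms(1) F] L2_set_le_l2_norm[OF assms(2) F] by linarith
  qed
  then show "(\<lambda>g. \<beta> g + \<gamma> g) \<in> l2_space G"
    and "l2_norm G (\<lambda>g. \<beta> g + \<gamma> g) \<le> l2_norm G \<beta> + l2_norm G \<gamma>"
    using l2_boundI[of G "\<lambda>g. \<beta> g + \<gamma> g" "l2_norm G \<beta> + l2_norm G \<gamma>"]
      l2_outside[OF assms(1)] l2_outside[OF assms(2)] l2_norm_nonneg[of G]
    by (auto simp: add_nonneg_nonneg)
qed

lemma l2_dominated:
  assumes "\<beta> \<in> l2_space G" "c \<ge> 0" "\<And>g. cmod (\<gamma> g) \<le> c * cmod (\<beta> g)"
  shows "\<gamma> \<in> l2_space G" and "l2_norm G \<gamma> \<le> c * l2_norm G \<beta>"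
proof -
  have "L2_set (\<lambda>g. cmod (\<gamma> g)) F \<le> c * l2_norm G \<beta>" if F: "finite F" "F \<subseteq> carrier G" for F
  proof -
    have "L2_set (\<lambda>g. cmod (\<gamma> g)) F \<le> L2_set (\<lambda>g. c * cmod (\<beta> g)) F"
      using assms(3) by (intro L2_set_mono) auto
    also have "\<dots> = c * L2_set (\<lambda>g. cmod (\<beta> g)) F"
      using assms(2) by (simp add: L2_set_right_distrib)
    also have "\<dots> \<le> c * l2_norm G \<beta>"
      using assms(2) by (intro mult_left_mono L2_set_le_l2_norm assms(1) F)
    finally show ?thesis .
  qed
  moreover have "\<gamma> g = 0" if "g \<notin> carrier G" for g
    using assms(3)[of g] l2_outside[OF assms(1) that] by simp
  ultimately show "\<gamma> \<in> l2_space G" and "l2_norm G \<gamma> \<le> c * l2_norm G \<beta>"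
    using l2_boundI[of G \<gamma> "c * l2_norm G \<beta>"] assms(2) l2_norm_nonneg[of G \<beta>] by auto
qed

lemma l2_scale:
  assumes "\<beta> \<in> l2_space G"
  shows "(\<lambda>g. c * \<beta> g) \<in> l2_space G" and "l2_norm G (\<lambda>g. c * \<beta> g) \<le> cmod c * l2_norm G \<beta>"
  using l2_dominated[OF assms, of "cmod c" "\<lambda>g. c * \<beta> g"] by (auto simp: norm_mult)

lemma l2_diff:
  assumes "\<beta> \<in> l2_space G" "\<gamma> \<in> l2_space G"
  shows "(\<lambda>g. \<beta> g - \<gamma> g) \<in> l2_space G"
    and "l2_norm G (\<lambda>g. \<beta> g - \<gamma> g) \<le> l2_norm G \<beta> + l2_norm G \<gamma>"
  using l2_add[OF assms(1) l2_scale(1)[OF assms(2), of "-1"]] l2_scale(2)[OF assms(2), of "-1"] by auto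

lemma l2_zero: "(\<lambda>g. 0) \<in> l2_space G" "l2_norm G (\<lambda>g. 0) = 0"
  by (simp_all add: l2_space_def l2_norm_def)

lemma l2_norm_scale:
  assumes "\<beta> \<in> l2_space G"
  shows "l2_norm G (\<lambda>g. c * \<beta> g) = cmod c * l2_norm G \<beta>"
  by (simp add: l2_norm_def norm_mult power_mult_distrib infsum_cmult_right' real_sqrt_mult)

lemma l2_norm_eq_0:
  assumes "\<beta> \<in> l2_space G" "l2_norm G \<beta> = 0"
  shows "\<beta> = (\<lambda>g. 0)"
  using cmod_le_l2_norm[OF assms(1)] assms(2) by (auto simp: fun_eq_iff)

lemma l2_norm_triangle_diff:
  assumes "\<beta> \<in> l2_space G" "\<gamma> \<in> l2_space G"
  shows "l2_norm G \<beta> \<le> l2_norm G (\<lambda>g. \<beta> g - \<gamma> g) + l2_norm G \<gamma>"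
  using l2_add(2)[OF l2_diff(1)[OF assms] assms(2)] by simp

lemma l2_sum:
  assumes "finite F" "\<And>i. i \<in> F \<Longrightarrow> \<beta> i \<in> l2_space G"
  shows "(\<lambda>g. \<Sum>i\<in>F. \<beta> i g) \<in> l2_space G"
    and "l2_norm G (\<lambda>g. \<Sum>i\<in>F. \<beta> i g) \<le> (\<Sum>i\<in>F. l2_norm G (\<beta> i))"
proof -
  have "(\<lambda>g. \<Sum>i\<in>F. \<beta> i g) \<in> l2_space G \<and>
    l2_norm G (\<lambda>g. \<Sum>i\<in>F. \<beta> i g) \<le> (\<Sum>i\<in>F. l2_norm G (\<beta> i))"
    using assms
  proof (induction F rule: finite_induct)
    case empty
    then show ?case by (simp add: l2_zero)
  next
    case (insert i F)
    then show ?case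
      using l2_add[of "\<beta> i" G "\<lambda>g. \<Sum>i\<in>F. \<beta> i g"] by fastforce
  qed
  then show "(\<lambda>g. \<Sum>i\<in>F. \<beta> i g) \<in> l2_space G"
    and "l2_norm G (\<lambda>g. \<Sum>i\<in>F. \<beta> i g) \<le> (\<Sum>i\<in>F. l2_norm G (\<beta> i))" by auto
qed

text \<open>Fatou's lemma for the \<open>l\<^sup>2\<close> norm.\<close>

lemma l2_limit:
  assumes "\<And>N. \<beta> N \<in> l2_space G" "\<And>N. l2_norm G (\<beta> N) \<le> K"
    and lim: "\<And>g. (\<lambda>N. \<beta> N g) \<longlonglongrightarrow> \<gamma> g"
  shows "\<gamma> \<in> l2_space G" and "l2_norm G \<gamma> \<le> K"
proof -
  have "L2_set (\<lambda>g. cmod (\<gamma> g)) F \<le> K" if F: "finite F" "F \<subseteq> carrier G" for F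
  proof (rule LIMSEQ_le_const2)
    show "(\<lambda>N. L2_set (\<lambda>g. cmod (\<beta> N g)) F) \<longlonglongrightarrow> L2_set (\<lambda>g. cmod (\<gamma> g)) F"
      unfolding L2_set_def by (intro tendsto_intros lim)
    show "\<exists>N. \<forall>m\<ge>N. L2_set (\<lambda>g. cmod (\<beta> m g)) F \<le> K"
      using L2_set_le_l2_norm[OF assms(1) F] assms(2) order_trans by blast
  qed
  moreover have "\<gamma> g = 0" if "g \<notin> carrier G" for g
    using lim[of g] by (simp add: l2_outside[OF assms(1) that] LIMSEQ_const_iff)
  moreover have "K \<ge> 0" using assms(2)[of 0] l2_norm_nonneg[of G "\<beta> 0"] by linarith
  ultimately show "\<gamma> \<in> l2_space G" and "l2_norm G \<gamma> \<le> K"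
    using l2_boundI[of G \<gamma> K] by auto
qed

section \<open>The left regular representation\<close>

context
  fixes G :: "('g, 'x) monoid_scheme"
  assumes G: "Group.group G"
begin

interpretation Group.group G by (fact G)

lemma l2_translate:
  assumes h: "h \<in> carrier G" and \<beta>: "\<beta> \<in> l2_space G"
  shows "convolution G (unit_mass h) \<beta> \<in> l2_space G"
    and "l2_norm G (convolution G (unit_mass h) \<beta>) \<le> l2_norm G \<beta>"
proof -
  have "L2_set (\<lambda>g. cmod (convolution G (unit_mass h) \<beta> g)) F \<le> l2_norm G \<beta>"
    if F: "finite F" "F \<subseteq> carrier G" for F
  proof -
    have inj: "inj_on ((\<otimes>\<^bsub>G\<^esub>) (inv\<^bsub>G\<^esub> h)) F"
      using F h by (intro inj_onI) (metis inv_closed l_cancel subsetD)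
    have "L2_set (\<lambda>g. cmod (convolution G (unit_mass h) \<beta> g)) F = L2_set (\<lambda>g. cmod (\<beta> (inv\<^bsub>G\<^esub> h \<otimes>\<^bsub>G\<^esub> g))) F"
      using F h by (intro L2_set_cong) (auto simp: convolution_unit_mass subset_iff)
    also have "\<dots> = L2_set (\<lambda>g. cmod (\<beta> g)) ((\<otimes>\<^bsub>G\<^esub>) (inv\<^bsub>G\<^esub> h) ` F)"
      unfolding L2_set_def by (simp add: sum.reindex[OF inj])
    also have "\<dots> \<le> l2_norm G \<beta>"
      using F h by (intro L2_set_le_l2_norm \<beta>) auto
    finally show ?thesis .
  qed
  then show "convolution G (unit_mass h) \<beta> \<in> l2_space G"
    and "l2_norm G (convolution G (unit_mass h) \<beta>) \<le> l2_norm G \<beta>"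
    using l2_boundI[of G "convolution G (unit_mass h) \<beta>" "l2_norm G \<beta>"] l2_norm_nonneg[of G \<beta>]
    by (auto simp: convolution_outside)
qed

lemma convolution_eq_sum_translates:
  fixes a \<beta> :: "'g \<Rightarrow> 'a::comm_ring_1"
  assumes a: "a \<in> carrier (group_ring G)"
  shows "convolution G a \<beta> = (\<lambda>g. \<Sum>h | a h \<noteq> 0. a h * convolution G (unit_mass h) \<beta> g)"
proof
  fix g
  show "convolution G a \<beta> g = (\<Sum>h | a h \<noteq> 0. a h * convolution G (unit_mass h) \<beta> g)"
  proof (cases "g \<in> carrier G")
    case True
    then show ?thesis
      unfolding convolution_eq_pairing[OF a True] pairing_def using a
      by (intro sum.cong refl) (auto simp: convolution_unit_mass carrier_group_ring)
  qed (simp add: convolution_outside)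
qed

lemma l2_convolution:
  assumes a: "a \<in> carrier (group_ring G)" and \<beta>: "\<beta> \<in> l2_space G"
  shows "convolution G a \<beta> \<in> l2_space G"
    and "l2_norm G (convolution G a \<beta>) \<le> (\<Sum>h | a h \<noteq> 0. cmod (a h)) * l2_norm G \<beta>"
proof -
  have fin: "finite {h. a h \<noteq> 0}" using a by (simp add: carrier_group_ring)
  have tr: "(\<lambda>g. a h * convolution G (unit_mass h) \<beta> g) \<in> l2_space G"
    "l2_norm G (\<lambda>g. a h * convolution G (unit_mass h) \<beta> g) \<le> cmod (a h) * l2_norm G \<beta>"
    if "h \<in> {h. a h \<noteq> 0}" for h
  proof -
    have h: "h \<in> carrier G" using a that by (auto simp: carrier_group_ring)
    show "(\<lambda>g. a h * convolution G (unit_mass h) \<beta> g) \<in> l2_space G"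
      by (intro l2_scale l2_translate h \<beta>)
    show "l2_norm G (\<lambda>g. a h * convolution G (unit_mass h) \<beta> g) \<le> cmod (a h) * l2_norm G \<beta>"
      using l2_scale(2)[OF l2_translate(1)[OF h \<beta>], of "a h"] l2_translate(2)[OF h \<beta>]
      by (meson mult_left_mono norm_ge_zero order_trans)
  qed
  show "convolution G a \<beta> \<in> l2_space G"
    unfolding convolution_eq_sum_translates[OF a] by (intro l2_sum fin tr)
  have "l2_norm G (convolution G a \<beta>) \<le> (\<Sum>h | a h \<noteq> 0. cmod (a h) * l2_norm G \<beta>)"
    unfolding convolution_eq_sum_translates[OF a, of \<beta>]
    by (rule order_trans[OF l2_sum(2)[OF fin tr(1)] sum_mono[OF tr(2)]])
  then show "l2_norm G (convolution G a \<beta>) \<le> (\<Sum>h | a h \<noteq> 0. cmod (a h)) * l2_norm G \<beta>"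
    by (simp add: sum_distrib_right)
qed

lemma convolution_linear:
  fixes a \<beta> \<gamma> :: "'g \<Rightarrow> 'a::comm_ring_1"
  shows "convolution G a (\<lambda>g. \<beta> g + \<gamma> g) = (\<lambda>g. convolution G a \<beta> g + convolution G a \<gamma> g)"
    and "convolution G a (\<lambda>g. c * \<beta> g) = (\<lambda>g. c * convolution G a \<beta> g)"
    and "convolution G a (\<lambda>g. 0) = (\<lambda>g. 0 :: 'a)"
  unfolding convolution_def
  by (auto simp: fun_eq_iff distrib_left sum.distrib sum_distrib_left mult.left_commute)

lemma convolution_add_left:
  fixes a b \<beta> :: "'g \<Rightarrow> 'a::comm_ring_1"
  assumes "a \<in> carrier (group_ring G)" "b \<in> carrier (group_ring G)"
  shows "convolution G (\<lambda>g. a g + b g) \<beta> = (\<lambda>g. convolution G a \<beta> g + convolution G b \<beta> g)"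
proof
  fix g
  have "finite {g. a g \<noteq> 0}" "finite {g. b g \<noteq> 0}" using assms by (auto simp: carrier_group_ring)
  then show "convolution G (\<lambda>g. a g + b g) \<beta> g = convolution G a \<beta> g + convolution G b \<beta> g"
    by (cases "g \<in> carrier G")
      (simp_all add: convolution_eq_pairing convolution_outside group_ring_add assms pairing_add)
qed

lemma convolution_scale_left:
  fixes a \<beta> :: "'g \<Rightarrow> 'a::comm_ring_1"
  assumes "a \<in> carrier (group_ring G)"
  shows "convolution G (\<lambda>g. c * a g) \<beta> = (\<lambda>g. c * convolution G a \<beta> g)"
proof
  fix g
  have "finite {g. a g \<noteq> 0}" using assms by (auto simp: carrier_group_ring)
  then show "convolution G (\<lambda>g. c * a g) \<beta> g = c * convolution G a \<beta> g"
    by (cases "g \<in> carrier G")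
      (simp_all add: convolution_eq_pairing convolution_outside group_ring_scale assms pairing_scale_left)
qed

lemma convolution_one:
  assumes "\<beta> \<in> l2_space G"
  shows "convolution G (unit_mass \<one>\<^bsub>G\<^esub>) \<beta> = \<beta>"
proof
  fix g
  show "convolution G (unit_mass \<one>\<^bsub>G\<^esub>) \<beta> g = \<beta> g"
    using l2_outside[OF assms, of g]
    by (cases "g \<in> carrier G") (auto simp: convolution_unit_mass convolution_outside)
qed

section \<open>Bounded operators and the reduced group C*-algebra\<close>

lemma bounded_operatorD:
  assumes "bounded_operator G T"
  shows "\<beta> \<in> l2_space G \<Longrightarrow> T \<beta> \<in> l2_space G"
    and "\<beta> \<notin> l2_space G \<Longrightarrow> T \<beta> = (\<lambda>g. 0)"
    and "\<beta> \<in> l2_space G \<Longrightarrow> \<gamma> \<in> l2_space G \<Longrightarrow> T (\<lambda>g. \<beta> g + \<gamma> g) = (\<lambda>g. T \<beta> g + T \<gamma> g)"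
    and "\<beta> \<in> l2_space G \<Longrightarrow> T (\<lambda>g. c * \<beta> g) = (\<lambda>g. c * T \<beta> g)"
  using assms by (auto simp: bounded_operator_def)

lemma bounded_operator_range:
  assumes "bounded_operator G T"
  shows "T \<beta> \<in> l2_space G"
  using bounded_operatorD[OF assms] l2_zero(1) by (cases "\<beta> \<in> l2_space G") auto

lemma bounded_operator_bound:
  assumes "bounded_operator G T"
  obtains C where "C \<ge> 0" "\<And>\<beta>. \<beta> \<in> l2_space G \<Longrightarrow> l2_norm G (T \<beta>) \<le> C * l2_norm G \<beta>"
proof -
  obtain C where C: "\<And>\<beta>. \<beta> \<in> l2_space G \<Longrightarrow> l2_norm G (T \<beta>) \<le> C * l2_norm G \<beta>"
    using assms unfolding bounded_operator_def by blast
  have "l2_norm G (T \<beta>) \<le> \<bar>C\<bar> * l2_norm G \<beta>" if "\<beta> \<in> l2_space G" for \<beta>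
    using C[OF that] mult_right_mono[OF abs_ge_self[of C] l2_norm_nonneg[of G \<beta>]] by linarith
  then show ?thesis using that[of "\<bar>C\<bar>"] by auto
qed

lemma bounded_operator_add:
  assumes S: "bounded_operator G S" and T: "bounded_operator G T"
  shows "bounded_operator G (\<lambda>\<beta> g. S \<beta> g + T \<beta> g)"
proof -
  obtain C D where C: "\<And>\<beta>. \<beta> \<in> l2_space G \<Longrightarrow> l2_norm G (S \<beta>) \<le> C * l2_norm G \<beta>"
    and D: "\<And>\<beta>. \<beta> \<in> l2_space G \<Longrightarrow> l2_norm G (T \<beta>) \<le> D * l2_norm G \<beta>"
    using bounded_operator_bound[OF S] bounded_operator_bound[OF T] by metis
  have "l2_norm G (\<lambda>g. S \<beta> g + T \<beta> g) \<le> (C + D) * l2_norm G \<beta>" if \<beta>: "\<beta> \<in> l2_space G" for \<beta>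
    using C[OF \<beta>] D[OF \<beta>] l2_add(2)[OF bounded_operator_range[OF S] bounded_operator_range[OF T], of \<beta> \<beta>]
    by (simp add: distrib_right)
  then show ?thesis
    unfolding bounded_operator_def
    using l2_add(1)[OF bounded_operator_range[OF S] bounded_operator_range[OF T]]
    by (auto simp: bounded_operatorD[OF S] bounded_operatorD[OF T] algebra_simps intro!: exI[of _ "C + D"])
qed

lemma bounded_operator_scale:
  assumes T: "bounded_operator G T"
  shows "bounded_operator G (\<lambda>\<beta> g. c * T \<beta> g)"
proof -
  obtain C where C: "\<And>\<beta>. \<beta> \<in> l2_space G \<Longrightarrow> l2_norm G (T \<beta>) \<le> C * l2_norm G \<beta>"
    using bounded_operator_bound[OF T] by metis
  have "l2_norm G (\<lambda>g. c * T \<beta> g) \<le> (cmod c * C) * l2_norm G \<beta>" if \<beta>: "\<beta> \<in> l2_space G" for \<beta>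
    using mult_left_mono[OF C[OF \<beta>] norm_ge_zero[of c]]
    by (simp add: l2_norm_scale bounded_operator_range[OF T] mult.assoc)
  then show ?thesis
    unfolding bounded_operator_def
    using l2_scale(1)[OF bounded_operator_range[OF T]]
    by (auto simp: bounded_operatorD[OF T] algebra_simps intro!: exI[of _ "cmod c * C"])
qed

lemma bounded_operator_compose:
  assumes S: "bounded_operator G S" and T: "bounded_operator G T"
  shows "bounded_operator G (S \<circ> T)"
proof -
  obtain C D where C: "C \<ge> 0" "\<And>\<beta>. \<beta> \<in> l2_space G \<Longrightarrow> l2_norm G (S \<beta>) \<le> C * l2_norm G \<beta>"
    and D: "\<And>\<beta>. \<beta> \<in> l2_space G \<Longrightarrow> l2_norm G (T \<beta>) \<le> D * l2_norm G \<beta>"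
    using bounded_operator_bound[OF S] bounded_operator_bound[OF T] by metis
  have "l2_norm G (S (T \<beta>)) \<le> (C * D) * l2_norm G \<beta>" if \<beta>: "\<beta> \<in> l2_space G" for \<beta>
    using C(2)[OF bounded_operator_range[OF T], of \<beta>] mult_left_mono[OF D[OF \<beta>] C(1)]
    by (simp add: mult.assoc)
  moreover have "S (\<lambda>g. 0) = (\<lambda>g. 0)"
    using bounded_operatorD(4)[OF S l2_zero(1), of 0] by simp
  ultimately show ?thesis
    unfolding bounded_operator_def
    using bounded_operator_range[OF S] bounded_operator_range[OF T]
    by (auto simp: bounded_operatorD[OF S] bounded_operatorD[OF T] intro!: exI[of _ "C * D"])
qed

lemma bounded_operator_left_mult:
  assumes "a \<in> carrier (group_ring G)"
  shows "bounded_operator G (left_mult G a)"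
  unfolding bounded_operator_def left_mult_def
  using l2_convolution[OF assms]
  by (auto simp: l2_add l2_scale convolution_linear)

lemma op_norm_bound_iff:
  assumes T: "bounded_operator G T" and K: "K \<ge> 0"
  shows "op_norm G T \<le> K \<longleftrightarrow> (\<forall>\<beta> \<in> l2_space G. l2_norm G (T \<beta>) \<le> K * l2_norm G \<beta>)"
proof -
  let ?U = "{\<beta> \<in> l2_space G. l2_norm G \<beta> = 1}"
  obtain C where C: "\<And>\<beta>. \<beta> \<in> l2_space G \<Longrightarrow> l2_norm G (T \<beta>) \<le> C * l2_norm G \<beta>"
    using bounded_operator_bound[OF T] by metis
  have bdd: "bdd_above ((\<lambda>\<beta>. l2_norm G (T \<beta>)) ` ?U)"
    using C by (intro bdd_aboveI[of _ C]) fastforce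
  have ne: "?U \<noteq> {}"
  proof -
    have *: "(\<Sum>\<^sub>\<infinity>g\<in>carrier G. (cmod (unit_mass \<one>\<^bsub>G\<^esub> g))\<^sup>2) = 1"
      and "(\<lambda>g. (cmod (unit_mass \<one>\<^bsub>G\<^esub> g))\<^sup>2) summable_on carrier G"
    proof -
      have "((\<lambda>g. (cmod (unit_mass \<one>\<^bsub>G\<^esub> g))\<^sup>2) has_sum (\<Sum>g\<in>{\<one>\<^bsub>G\<^esub>}. (cmod (unit_mass \<one>\<^bsub>G\<^esub> g))\<^sup>2)) (carrier G)"
        by (rule has_sum_finite_neutralI[of "{\<one>\<^bsub>G\<^esub>}"]) (auto simp: unit_mass_def)
      then have "((\<lambda>g. (cmod (unit_mass \<one>\<^bsub>G\<^esub> g))\<^sup>2) has_sum 1) (carrier G)"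
        by (simp add: unit_mass_def)
      then show "(\<Sum>\<^sub>\<infinity>g\<in>carrier G. (cmod (unit_mass \<one>\<^bsub>G\<^esub> g))\<^sup>2) = 1"
        and "(\<lambda>g. (cmod (unit_mass \<one>\<^bsub>G\<^esub> g))\<^sup>2) summable_on carrier G"
        by (auto intro: infsumI has_sum_imp_summable)
    qed
    then have "unit_mass \<one>\<^bsub>G\<^esub> \<in> ?U"
      by (auto simp: l2_space_def l2_norm_def) (auto simp: unit_mass_def)
    then show ?thesis by blast
  qed
  show ?thesis
  proof
    assume le: "op_norm G T \<le> K"
    show "\<forall>\<beta> \<in> l2_space G. l2_norm G (T \<beta>) \<le> K * l2_norm G \<beta>"
    proof
      fix \<beta> assume \<beta>: "\<beta> \<in> l2_space G"
      show "l2_norm G (T \<beta>) \<le> K * l2_norm G \<beta>"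
      proof (cases "l2_norm G \<beta> = 0")
        case True
        then show ?thesis using C[OF \<beta>] by simp
      next
        case False
        define r where "r = l2_norm G \<beta>"
        have r: "r > 0" using False l2_norm_nonneg[of G \<beta>] by (simp add: r_def)
        define \<gamma> where "\<gamma> = (\<lambda>g. complex_of_real (1 / r) * \<beta> g)"
        have \<gamma>: "\<gamma> \<in> l2_space G" unfolding \<gamma>_def by (rule l2_scale(1)[OF \<beta>])
        have "l2_norm G \<gamma> = 1"
          unfolding \<gamma>_def l2_norm_scale[OF \<beta>] using r by (simp add: r_def[symmetric] norm_divide)
        then have "l2_norm G (T \<gamma>) \<le> op_norm G T"
          unfolding op_norm_def using \<gamma> by (intro cSUP_upper bdd) auto
        moreover have "l2_norm G (T \<gamma>) = l2_norm G (T \<beta>) / r"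
          unfolding \<gamma>_def bounded_operatorD(4)[OF T \<beta>] l2_norm_scale[OF bounded_operator_range[OF T]]
          using r by (simp add: norm_divide)
        ultimately have "l2_norm G (T \<beta>) / r \<le> K" using le by simp
        then show ?thesis using r by (simp add: r_def pos_divide_le_eq)
      qed
    qed
  next
    assume "\<forall>\<beta> \<in> l2_space G. l2_norm G (T \<beta>) \<le> K * l2_norm G \<beta>"
    then show "op_norm G T \<le> K"
      unfolding op_norm_def using ne by (intro cSUP_least) fastforce+
  qed
qed

text \<open>Membership in the norm closure, with the operator norm replaced by estimates for each vector.\<close>

lemma cstar_red_iff:
  "T \<in> carrier (cstar_red G) \<longleftrightarrow> bounded_operator G T \<and>
    (\<forall>e>0. \<exists>a \<in> carrier (group_ring G). \<forall>\<beta> \<in> l2_space G.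
      l2_norm G (\<lambda>g. T \<beta> g - convolution G a \<beta> g) \<le> e * l2_norm G \<beta>)"
proof -
  have "(\<exists>a \<in> carrier (group_ring G). op_norm G (\<lambda>\<beta> g. T \<beta> g - left_mult G a \<beta> g) \<le> e)
    \<longleftrightarrow> (\<exists>a \<in> carrier (group_ring G). \<forall>\<beta> \<in> l2_space G.
      l2_norm G (\<lambda>g. T \<beta> g - convolution G a \<beta> g) \<le> e * l2_norm G \<beta>)"
    if T: "bounded_operator G T" and "e \<ge> 0" for e
  proof (intro bex_cong refl)
    fix a :: "'g \<Rightarrow> complex" assume a: "a \<in> carrier (group_ring G)"
    have "bounded_operator G (\<lambda>\<beta> g. T \<beta> g - left_mult G a \<beta> g)"
      using bounded_operator_add[OF T bounded_operator_scale[OF bounded_operator_left_mult[OF a], of "-1"]]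
      by simp
    from op_norm_bound_iff[OF this \<open>e \<ge> 0\<close>]
    show "op_norm G (\<lambda>\<beta> g. T \<beta> g - left_mult G a \<beta> g) \<le> e
      \<longleftrightarrow> (\<forall>\<beta> \<in> l2_space G. l2_norm G (\<lambda>g. T \<beta> g - convolution G a \<beta> g) \<le> e * l2_norm G \<beta>)"
      by (simp add: left_mult_def)
  qed
  note * = this
  have "(\<forall>e>0. \<exists>a \<in> carrier (group_ring G). op_norm G (\<lambda>\<beta> g. T \<beta> g - left_mult G a \<beta> g) < e)
    \<longleftrightarrow> (\<forall>e>0. \<exists>a \<in> carrier (group_ring G). op_norm G (\<lambda>\<beta> g. T \<beta> g - left_mult G a \<beta> g) \<le> e)"
    by (meson dense le_less_trans less_imp_le)
  then show ?thesis
    unfolding cstar_red_def using * by (auto simp del: not_ex)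
qed

end

section \<open>The reduced group C*-algebra as a module\<close>

lemma complex_field_simps [simp]:
  "carrier complex_field = UNIV"
  "\<zero>\<^bsub>complex_field\<^esub> = 0" "\<one>\<^bsub>complex_field\<^esub> = 1"
  "a \<oplus>\<^bsub>complex_field\<^esub> b = a + b" "a \<otimes>\<^bsub>complex_field\<^esub> b = a * b"
  by (simp_all add: ring_of_type_algebra_def)

lemma cstar_red_simps [simp]:
  "\<zero>\<^bsub>cstar_red G\<^esub> = (\<lambda>\<beta> g. 0)"
  "S \<oplus>\<^bsub>cstar_red G\<^esub> T = (\<lambda>\<beta> g. S \<beta> g + T \<beta> g)"
  "c \<odot>\<^bsub>cstar_red G\<^esub> T = (\<lambda>\<beta> g. c * T \<beta> g)"
  by (simp_all add: cstar_red_def)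

context
  fixes G :: "('g, 'x) monoid_scheme"
  assumes G: "Group.group G"
begin

interpretation Group.group G by (fact G)

lemma cstar_redD:
  assumes "T \<in> carrier (cstar_red G)"
  shows "bounded_operator G T"
    and "e > 0 \<Longrightarrow> \<exists>a \<in> carrier (group_ring G). \<forall>\<beta> \<in> l2_space G.
      l2_norm G (\<lambda>g. T \<beta> g - convolution G a \<beta> g) \<le> e * l2_norm G \<beta>"
  using assms by (simp_all add: cstar_red_iff[OF G])

lemma cstar_red_range: "T \<in> carrier (cstar_red G) \<Longrightarrow> T \<beta> \<in> l2_space G"
  by (intro bounded_operator_range G cstar_redD)

lemma cstar_red_add:
  assumes S: "S \<in> carrier (cstar_red G)" and T: "T \<in> carrier (cstar_red G)"
  shows "(\<lambda>\<beta> g. S \<beta> g + T \<beta> g) \<in> carrier (cstar_red G)"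
  unfolding cstar_red_iff[OF G]
proof (intro conjI allI impI)
  show "bounded_operator G (\<lambda>\<beta> g. S \<beta> g + T \<beta> g)"
    by (intro bounded_operator_add G cstar_redD S T)
  fix e :: real assume "e > 0"
  then have e: "e / 2 > 0" by simp
  from cstar_redD(2)[OF S e] obtain a where a: "a \<in> carrier (group_ring G)"
    and aS: "\<And>\<beta>. \<beta> \<in> l2_space G \<Longrightarrow> l2_norm G (\<lambda>g. S \<beta> g - convolution G a \<beta> g) \<le> e / 2 * l2_norm G \<beta>" by blast
  from cstar_redD(2)[OF T e] obtain b where b: "b \<in> carrier (group_ring G)"
    and bT: "\<And>\<beta>. \<beta> \<in> l2_space G \<Longrightarrow> l2_norm G (\<lambda>g. T \<beta> g - convolution G b \<beta> g) \<le> e / 2 * l2_norm G \<beta>" by blast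
  have "l2_norm G (\<lambda>g. S \<beta> g + T \<beta> g - convolution G (\<lambda>g. a g + b g) \<beta> g) \<le> e * l2_norm G \<beta>"
    if \<beta>: "\<beta> \<in> l2_space G" for \<beta>
  proof -
    have "(\<lambda>g. S \<beta> g + T \<beta> g - convolution G (\<lambda>g. a g + b g) \<beta> g)
        = (\<lambda>g. (S \<beta> g - convolution G a \<beta> g) + (T \<beta> g - convolution G b \<beta> g))"
      by (simp add: convolution_add_left[OF G a b] algebra_simps)
    then have "l2_norm G (\<lambda>g. S \<beta> g + T \<beta> g - convolution G (\<lambda>g. a g + b g) \<beta> g)
        \<le> l2_norm G (\<lambda>g. S \<beta> g - convolution G a \<beta> g) + l2_norm G (\<lambda>g. T \<beta> g - convolution G b \<beta> g)"
      using \<beta> by (simp only:)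
        (intro l2_add(2) l2_diff(1) cstar_red_range[OF S] cstar_red_range[OF T]
          l2_convolution(1)[OF G a] l2_convolution(1)[OF G b])
    then show ?thesis using aS[OF \<beta>] bT[OF \<beta>] by simp
  qed
  then show "\<exists>a \<in> carrier (group_ring G). \<forall>\<beta> \<in> l2_space G.
      l2_norm G (\<lambda>g. S \<beta> g + T \<beta> g - convolution G a \<beta> g) \<le> e * l2_norm G \<beta>"
    using group_ring_add[OF a b] by blast
qed

lemma cstar_red_scale:
  assumes T: "T \<in> carrier (cstar_red G)"
  shows "(\<lambda>\<beta> g. c * T \<beta> g) \<in> carrier (cstar_red G)"
  unfolding cstar_red_iff[OF G]
proof (intro conjI allI impI)
  show "bounded_operator G (\<lambda>\<beta> g. c * T \<beta> g)"
    by (intro bounded_operator_scale G cstar_redD T)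
  fix e :: real assume e: "e > 0"
  then have "e / (cmod c + 1) > 0" by (simp add: add_nonneg_pos)
  from cstar_redD(2)[OF T this] obtain a where a: "a \<in> carrier (group_ring G)"
    and aT: "\<And>\<beta>. \<beta> \<in> l2_space G \<Longrightarrow>
      l2_norm G (\<lambda>g. T \<beta> g - convolution G a \<beta> g) \<le> e / (cmod c + 1) * l2_norm G \<beta>" by blast
  have "l2_norm G (\<lambda>g. c * T \<beta> g - convolution G (\<lambda>g. c * a g) \<beta> g) \<le> e * l2_norm G \<beta>"
    if \<beta>: "\<beta> \<in> l2_space G" for \<beta>
  proof -
    have "(\<lambda>g. c * T \<beta> g - convolution G (\<lambda>g. c * a g) \<beta> g) = (\<lambda>g. c * (T \<beta> g - convolution G a \<beta> g))"
      by (simp add: convolution_scale_left[OF G a] right_diff_distrib)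
    then have "l2_norm G (\<lambda>g. c * T \<beta> g - convolution G (\<lambda>g. c * a g) \<beta> g)
        \<le> cmod c * l2_norm G (\<lambda>g. T \<beta> g - convolution G a \<beta> g)"
      using \<beta> by (simp only:) (intro l2_scale(2) l2_diff(1) cstar_red_range[OF T] l2_convolution(1)[OF G a])
    also have "\<dots> \<le> cmod c * (e / (cmod c + 1) * l2_norm G \<beta>)"
      by (intro mult_left_mono aT \<beta>) simp
    also have "\<dots> = cmod c / (cmod c + 1) * (e * l2_norm G \<beta>)" by simp
    also have "\<dots> \<le> 1 * (e * l2_norm G \<beta>)"
      using e l2_norm_nonneg[of G \<beta>] by (intro mult_right_mono) (auto simp: divide_simps add_nonneg_pos)
    finally show ?thesis by simp
  qed
  then show "\<exists>a \<in> carrier (group_ring G). \<forall>\<beta> \<in> l2_space G.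
      l2_norm G (\<lambda>g. c * T \<beta> g - convolution G a \<beta> g) \<le> e * l2_norm G \<beta>"
    using group_ring_scale[OF a, of c] by blast
qed

lemma cstar_red_zero: "(\<lambda>\<beta> g. 0) \<in> carrier (cstar_red G)"
  unfolding cstar_red_iff[OF G]
proof (intro conjI allI impI)
  show "bounded_operator G (\<lambda>\<beta> g. 0)"
    by (auto simp: bounded_operator_def l2_zero l2_norm_nonneg intro!: exI[of _ 0])
  have "(\<lambda>g. 0) \<in> carrier (group_ring G)" by (simp add: carrier_group_ring)
  moreover have "convolution G (\<lambda>g. 0) \<beta> = (\<lambda>g. 0 :: complex)" for \<beta>
    unfolding convolution_def by (rule ext) (simp del: Collect_conj_eq)
  ultimately show "\<exists>a \<in> carrier (group_ring G). \<forall>\<beta> \<in> l2_space G.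
      l2_norm G (\<lambda>g. 0 - convolution G a \<beta> g) \<le> e * l2_norm G \<beta>" if "e > 0" for e
    using that by (intro bexI[of _ "\<lambda>g. 0"]) (auto simp: l2_zero l2_norm_nonneg)
qed

lemma cstar_red_convolution:
  assumes a: "a \<in> carrier (group_ring G)" and T: "T \<in> carrier (cstar_red G)"
  shows "(\<lambda>\<beta>. convolution G a (T \<beta>)) \<in> carrier (cstar_red G)"
  unfolding cstar_red_iff[OF G]
proof (intro conjI allI impI)
  have "bounded_operator G (left_mult G a \<circ> T)"
    by (intro bounded_operator_compose bounded_operator_left_mult G a cstar_redD T)
  moreover have "left_mult G a \<circ> T = (\<lambda>\<beta>. convolution G a (T \<beta>))"
    by (simp add: fun_eq_iff left_mult_def cstar_red_range[OF T])
  ultimately show "bounded_operator G (\<lambda>\<beta>. convolution G a (T \<beta>))" by simp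
  fix e :: real assume e: "e > 0"
  define A where "A = (\<Sum>h | a h \<noteq> 0. cmod (a h))"
  have A: "A \<ge> 0" by (simp add: A_def sum_nonneg)
  have "e / (A + 1) > 0" using e A by simp
  from cstar_redD(2)[OF T this] obtain b where b: "b \<in> carrier (group_ring G)"
    and bT: "\<And>\<beta>. \<beta> \<in> l2_space G \<Longrightarrow>
      l2_norm G (\<lambda>g. T \<beta> g - convolution G b \<beta> g) \<le> e / (A + 1) * l2_norm G \<beta>" by blast
  have "l2_norm G (\<lambda>g. convolution G a (T \<beta>) g - convolution G (convolution G a b) \<beta> g) \<le> e * l2_norm G \<beta>"
    if \<beta>: "\<beta> \<in> l2_space G" for \<beta>
  proof -
    have diff: "(\<lambda>g. T \<beta> g - convolution G b \<beta> g) \<in> l2_space G"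
      by (intro l2_diff(1) cstar_red_range T l2_convolution(1)[OF G] b \<beta>)
    have "(\<lambda>g. convolution G a (T \<beta>) g - convolution G (convolution G a b) \<beta> g)
        = convolution G a (\<lambda>g. T \<beta> g - convolution G b \<beta> g)"
      using convolution_linear(1)[of G a "T \<beta>" "\<lambda>g. - 1 * convolution G b \<beta> g"]
        convolution_linear(2)[of G a "-1" "convolution G b \<beta>"]
      by (simp add: convolution_assoc[OF G a b])
    then have "l2_norm G (\<lambda>g. convolution G a (T \<beta>) g - convolution G (convolution G a b) \<beta> g)
        \<le> A * l2_norm G (\<lambda>g. T \<beta> g - convolution G b \<beta> g)"
      using l2_convolution(2)[OF G a diff] by (simp add: A_def)
    also have "\<dots> \<le> A * (e / (A + 1) * l2_norm G \<beta>)"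
      by (intro mult_left_mono bT \<beta> A)
    also have "\<dots> = A / (A + 1) * (e * l2_norm G \<beta>)" by simp
    also have "\<dots> \<le> 1 * (e * l2_norm G \<beta>)"
      using e A l2_norm_nonneg[of G \<beta>] by (intro mult_right_mono) (auto simp: divide_simps)
    finally show ?thesis by simp
  qed
  then show "\<exists>b \<in> carrier (group_ring G). \<forall>\<beta> \<in> l2_space G.
      l2_norm G (\<lambda>g. convolution G a (T \<beta>) g - convolution G b \<beta> g) \<le> e * l2_norm G \<beta>"
    using convolution_closed[OF G a b] by blast
qed

lemma module_cstar_red: "module complex_field (cstar_red G)"
proof -
  have "abelian_group (cstar_red G)"
  proof (rule abelian_groupI)
    fix T assume "T \<in> carrier (cstar_red G)"
    then show "\<exists>S\<in>carrier (cstar_red G). S \<oplus>\<^bsub>cstar_red G\<^esub> T = \<zero>\<^bsub>cstar_red G\<^esub>"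
      using cstar_red_scale[of T "-1"] by (intro bexI[of _ "\<lambda>\<beta> g. - 1 * T \<beta> g"]) auto
  qed (auto simp: cstar_red_add cstar_red_zero algebra_simps)
  then show ?thesis
    by (rule moduleI[OF cring_from_type_algebra]) (auto simp: cstar_red_scale algebra_simps)
qed

lemma finsum_cstar_red:
  assumes "finite F" "\<And>i. i \<in> F \<Longrightarrow> f i \<in> carrier (cstar_red G)"
  shows "(\<Oplus>\<^bsub>cstar_red G\<^esub>i \<in> F. f i) = (\<lambda>\<beta> g. \<Sum>i\<in>F. f i \<beta> g)"
proof -
  interpret module complex_field "cstar_red G" by (rule module_cstar_red)
  show ?thesis
    using assms
  proof (induction F rule: finite_induct)
    case (insert i F)
    then have "(\<Oplus>\<^bsub>cstar_red G\<^esub>i \<in> insert i F. f i) = f i \<oplus>\<^bsub>cstar_red G\<^esub> (\<Oplus>\<^bsub>cstar_red G\<^esub>i \<in> F. f i)"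
      by (intro finsum_insert) auto
    then show ?case using insert by simp
  qed simp
qed

lemma of_int_closed:
  assumes "a \<in> carrier (group_ring G)"
  shows "(\<lambda>g. of_int (a g) :: complex) \<in> carrier (group_ring G)"
  using assms by (simp add: carrier_group_ring)

text \<open>The integral group ring acts on the reduced C*-algebra by convolution on the values.\<close>

lemma cstar_module_smult:
  assumes a: "a \<in> carrier (group_ring G)" and T: "T \<in> carrier (cstar_red G)"
  shows "a \<odot>\<^bsub>integral_module (cstar_action G) (cstar_red G)\<^esub> T
    = (\<lambda>\<beta>. convolution G (\<lambda>g. of_int (a g)) (T \<beta>))"
proof -
  have act: "cstar_action G h T = (\<lambda>\<beta>. convolution G (unit_mass h) (T \<beta>))" for h
    by (simp add: cstar_action_def left_mult_def fun_eq_iff cstar_red_range[OF T] unit_mass_def)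
  have fin: "finite {g. a g \<noteq> 0}" "{g. a g \<noteq> 0} \<subseteq> carrier G"
    using a by (auto simp: carrier_group_ring)
  have "(\<Oplus>\<^bsub>cstar_red G\<^esub>h \<in> {h. a h \<noteq> 0}. of_int (a h) \<odot>\<^bsub>cstar_red G\<^esub> cstar_action G h T)
      = (\<lambda>\<beta> g. \<Sum>h | a h \<noteq> 0. (of_int (a h) \<odot>\<^bsub>cstar_red G\<^esub> cstar_action G h T) \<beta> g)"
    using fin by (intro finsum_cstar_red)
      (auto simp: act intro!: cstar_red_scale cstar_red_convolution T unit_mass_closed)
  also have "\<dots> = (\<lambda>\<beta>. convolution G (\<lambda>g. of_int (a g)) (T \<beta>))"
    unfolding convolution_eq_sum_translates[OF G of_int_closed[OF a]] by (simp add: act)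
  finally show ?thesis by (simp add: integral_module_def)
qed

lemma of_int_convolution:
  assumes "a \<in> carrier (group_ring G)"
  shows "(\<lambda>g. of_int (convolution G a b g)) = convolution G (\<lambda>g. of_int (a g)) (\<lambda>g. of_int (b g) :: complex)"
  by (simp add: convolution_def fun_eq_iff)

lemma left_module_cstar:
  "left_module (group_ring G) (integral_module (cstar_action G) (cstar_red G))" (is "left_module ?R ?M")
proof -
  interpret C: module complex_field "cstar_red G" by (rule module_cstar_red)
  have simps: "carrier ?M = carrier (cstar_red G)" "\<zero>\<^bsub>?M\<^esub> = (\<lambda>\<beta> g. 0)"
    "S \<oplus>\<^bsub>?M\<^esub> T = (\<lambda>\<beta> g. S \<beta> g + T \<beta> g)" for S T
    by (simp_all add: integral_module_def cstar_red_def)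
  have "abelian_group ?M"
  proof (rule abelian_groupI)
    fix T assume "T \<in> carrier ?M"
    then show "\<exists>S\<in>carrier ?M. S \<oplus>\<^bsub>?M\<^esub> T = \<zero>\<^bsub>?M\<^esub>"
      using cstar_red_scale[of T "-1"] by (intro bexI[of _ "\<lambda>\<beta> g. - 1 * T \<beta> g"]) (auto simp: simps)
  qed (auto simp: simps cstar_red_add cstar_red_zero algebra_simps)
  moreover have "left_module_axioms ?R ?M"
  proof
    fix a S assume a: "a \<in> carrier ?R" and S: "S \<in> carrier ?M"
    then have S': "S \<in> carrier (cstar_red G)" by (simp add: simps)
    show "a \<odot>\<^bsub>?M\<^esub> S \<in> carrier ?M"
      unfolding cstar_module_smult[OF a S'] simps by (intro cstar_red_convolution of_int_closed a S')
    show "(a \<oplus>\<^bsub>?R\<^esub> b) \<odot>\<^bsub>?M\<^esub> S = a \<odot>\<^bsub>?M\<^esub> S \<oplus>\<^bsub>?M\<^esub> b \<odot>\<^bsub>?M\<^esub> S" if b: "b \<in> carrier ?R" for b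
    proof -
      have ab: "a \<oplus>\<^bsub>?R\<^esub> b \<in> carrier ?R" "a \<oplus>\<^bsub>?R\<^esub> b = (\<lambda>g. a g + b g)"
        using ring.ring_simprules(1)[OF ring_group_ring[OF G] a b] by (simp_all add: group_ring_def)
      show ?thesis
        unfolding cstar_module_smult[OF ab(1) S'] cstar_module_smult[OF a S'] cstar_module_smult[OF b S'] simps
        by (simp add: ab(2) convolution_add_left[OF G of_int_closed[OF a] of_int_closed[OF b]])
    qed
    show "(a \<otimes>\<^bsub>?R\<^esub> b) \<odot>\<^bsub>?M\<^esub> S = a \<odot>\<^bsub>?M\<^esub> (b \<odot>\<^bsub>?M\<^esub> S)" if b: "b \<in> carrier ?R" for b
    proof -
      have ab: "a \<otimes>\<^bsub>?R\<^esub> b \<in> carrier ?R" "a \<otimes>\<^bsub>?R\<^esub> b = convolution G a b"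
        using convolution_closed[OF G a b] by (simp_all add: group_ring_def)
      have "b \<odot>\<^bsub>?M\<^esub> S \<in> carrier (cstar_red G)"
        unfolding cstar_module_smult[OF b S'] by (intro cstar_red_convolution of_int_closed b S')
      then have "a \<odot>\<^bsub>?M\<^esub> (b \<odot>\<^bsub>?M\<^esub> S)
          = (\<lambda>\<beta>. convolution G (\<lambda>g. of_int (a g)) (convolution G (\<lambda>g. of_int (b g)) (S \<beta>)))"
        using cstar_module_smult[OF a] cstar_module_smult[OF b S'] by metis
      moreover have "(a \<otimes>\<^bsub>?R\<^esub> b) \<odot>\<^bsub>?M\<^esub> S
          = (\<lambda>\<beta>. convolution G (convolution G (\<lambda>g. of_int (a g)) (\<lambda>g. of_int (b g))) (S \<beta>))"
        using cstar_module_smult[OF ab(1) S'] by (simp add: ab(2) of_int_convolution[OF a])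
      ultimately show ?thesis
        by (simp add: convolution_assoc[OF G of_int_closed[OF a] of_int_closed[OF b]])
    qed
    show "a \<odot>\<^bsub>?M\<^esub> (S \<oplus>\<^bsub>?M\<^esub> T) = a \<odot>\<^bsub>?M\<^esub> S \<oplus>\<^bsub>?M\<^esub> a \<odot>\<^bsub>?M\<^esub> T" if T: "T \<in> carrier ?M" for T
    proof -
      have T': "T \<in> carrier (cstar_red G)" using T by (simp add: simps)
      show ?thesis
        unfolding simps cstar_module_smult[OF a S'] cstar_module_smult[OF a T']
          cstar_module_smult[OF a cstar_red_add[OF S' T']]
        by (simp add: convolution_linear(1))
    qed
  next
    fix S assume "S \<in> carrier ?M"
    then have S: "S \<in> carrier (cstar_red G)" by (simp add: simps)
    have one: "\<one>\<^bsub>?R\<^esub> \<in> carrier ?R" "(\<lambda>g. of_int (\<one>\<^bsub>?R\<^esub> g)) = (unit_mass \<one>\<^bsub>G\<^esub> :: 'g \<Rightarrow> complex)"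
      using ring.ring_simprules(6)[OF ring_group_ring[OF G]]
      by (auto simp: group_ring_def unit_mass_def fun_eq_iff)
    show "\<one>\<^bsub>?R\<^esub> \<odot>\<^bsub>?M\<^esub> S = S"
      unfolding cstar_module_smult[OF one(1) S] one(2)
      by (simp add: convolution_one[OF G cstar_red_range[OF S]])
  qed
  ultimately show ?thesis
    by (intro left_module.intro ring_group_ring G)
qed

end

section \<open>Approximate eigenvectors of the translations\<close>

text \<open>The word length with respect to the standard generators.\<close>

definition word_length :: "nat \<Rightarrow> (nat \<Rightarrow> int) \<Rightarrow> nat" where
  "word_length n h = (\<Sum>i<n. nat \<bar>h i\<bar>)"

text \<open>
  A character with frequency \<open>t\<close> in the coordinate \<open>0\<close> and frequency \<open>0\<close> in the others, damped by a
  factor that makes it square-summable for \<open>0 < r < 1\<close>. Since the word length is subadditive,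
  translation by \<open>h\<close> changes the damping by a factor between \<open>r ^ \<bar>h\<bar>\<close> and its inverse, so no norm has
  to be computed.
\<close>

definition test_vector :: "nat \<Rightarrow> real \<Rightarrow> real \<Rightarrow> (nat \<Rightarrow> int) \<Rightarrow> complex" where
  "test_vector n t r h = (if h \<in> carrier (free_abelian_group_of_rank n)
     then cis (t * of_int (h 0)) * of_real (r ^ word_length n h) else 0)"

text \<open>The approximate eigenvalue of convolution with \<open>a\<close> on the test vectors of frequency \<open>t\<close>.\<close>

definition character_value :: "real \<Rightarrow> ((nat \<Rightarrow> int) \<Rightarrow> complex) \<Rightarrow> complex" where
  "character_value t a = pairing a (\<lambda>h. cis (- t * of_int (h 0)))"

lemma sum_power_abs_le:
  fixes s :: real
  assumes s: "0 \<le> s" "s < 1"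
  shows "(\<Sum>k\<in>{- int N..int N}. s ^ nat \<bar>k\<bar>) \<le> 2 / (1 - s)"
proof -
  have geom: "(\<Sum>k\<le>N. s ^ k) \<le> 1 / (1 - s)"
    using s by (intro order_trans[OF sum_le_suminf]) (auto simp: suminf_geometric summable_geometric)
  have "{- int N..int N} \<subseteq> int ` {..N} \<union> (\<lambda>k. - int k) ` {..N}"
  proof
    fix k assume k: "k \<in> {- int N..int N}"
    then have "k = int (nat k) \<or> k = - int (nat (- k))" "nat k \<le> N" "nat (- k) \<le> N" by auto
    then show "k \<in> int ` {..N} \<union> (\<lambda>k. - int k) ` {..N}" by blast
  qed
  then have "(\<Sum>k\<in>{- int N..int N}. s ^ nat \<bar>k\<bar>)
      \<le> (\<Sum>k\<in>int ` {..N} \<union> (\<lambda>k. - int k) ` {..N}. s ^ nat \<bar>k\<bar>)"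
    using s by (intro sum_mono2) auto
  also have "\<dots> \<le> (\<Sum>k\<in>int ` {..N}. s ^ nat \<bar>k\<bar>) + (\<Sum>k\<in>(\<lambda>k. - int k) ` {..N}. s ^ nat \<bar>k\<bar>)"
    using s by (subst sum.union_inter[symmetric]) (auto intro!: sum_nonneg)
  also have "\<dots> = (\<Sum>k\<le>N. s ^ k) + (\<Sum>k\<le>N. s ^ k)"
    by (subst (1 2) sum.reindex) (auto simp: inj_on_def)
  finally show ?thesis using geom by simp
qed

lemma sum_power_word_length_le:
  fixes s :: real
  assumes s: "0 \<le> s" "s < 1" and F: "finite F" "F \<subseteq> carrier (free_abelian_group_of_rank n)"
  shows "(\<Sum>h\<in>F. s ^ word_length n h) \<le> (2 / (1 - s)) ^ n"
proof -
  define N where "N = Max (insert 0 (word_length n ` F))"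
  have N: "word_length n h \<le> N" if "h \<in> F" for h
    using F that by (auto simp: N_def)
  have "F \<subseteq> (\<Pi>\<^sub>E i\<in>{..<n}. {- int N..int N})"
  proof
    fix h assume h: "h \<in> F"
    have "h i \<in> {- int N..int N}" if "i < n" for i
    proof -
      have "nat \<bar>h i\<bar> \<le> word_length n h"
        unfolding word_length_def using that by (intro member_le_sum) auto
      then show ?thesis using N[OF h] by auto
    qed
    then show "h \<in> (\<Pi>\<^sub>E i\<in>{..<n}. {- int N..int N})"
      using h F(2) by (auto simp: PiE_def)
  qed
  then have "(\<Sum>h\<in>F. s ^ word_length n h)
      \<le> (\<Sum>h\<in>(\<Pi>\<^sub>E i\<in>{..<n}. {- int N..int N}). s ^ word_length n h)"
    using s by (intro sum_mono2 finite_PiE) auto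
  also have "\<dots> = (\<Sum>h\<in>(\<Pi>\<^sub>E i\<in>{..<n}. {- int N..int N}). \<Prod>i<n. s ^ nat \<bar>h i\<bar>)"
    by (simp add: word_length_def power_sum)
  also have "\<dots> = (\<Prod>i<n. \<Sum>k\<in>{- int N..int N}. s ^ nat \<bar>k\<bar>)"
    by (intro prod_sum_PiE[symmetric]) auto
  also have "\<dots> \<le> (2 / (1 - s)) ^ n"
    using sum_power_abs_le[OF s, of N] s by (simp add: power_mono sum_nonneg)
  finally show ?thesis .
qed

lemma test_vector_l2:
  assumes r: "0 < r" "r < 1"
  shows "test_vector n t r \<in> l2_space (free_abelian_group_of_rank n)"
proof (rule l2_boundI(1))
  let ?K = "sqrt ((2 / (1 - r\<^sup>2)) ^ n)"
  have r2: "0 \<le> r\<^sup>2" "r\<^sup>2 < 1" using r by (auto simp: power_less_one_iff)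
  show "0 \<le> ?K" using r2 by (intro real_sqrt_ge_zero zero_le_power) simp
  fix F assume F: "finite F" "F \<subseteq> carrier (free_abelian_group_of_rank n)"
  have "(\<Sum>h\<in>F. (cmod (test_vector n t r h))\<^sup>2) = (\<Sum>h\<in>F. (r\<^sup>2) ^ word_length n h)"
    using F r by (intro sum.cong refl)
      (auto simp: test_vector_def norm_mult norm_power power_mult[symmetric] mult.commute)
  also have "\<dots> \<le> (2 / (1 - r\<^sup>2)) ^ n"
    by (rule sum_power_word_length_le[OF r2 F])
  finally show "L2_set (\<lambda>h. cmod (test_vector n t r h)) F \<le> ?K"
    by (simp add: L2_set_def)
qed (simp add: test_vector_def)

lemma test_vector_norm_pos:
  assumes "0 < r" "r < 1"
  shows "l2_norm (free_abelian_group_of_rank n) (test_vector n t r) > 0"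
proof -
  have "cmod (test_vector n t r (\<lambda>i\<in>{..<n}. 0)) = 1"
    by (simp add: test_vector_def word_length_def norm_mult)
  then show ?thesis
    using cmod_le_l2_norm[OF test_vector_l2[OF assms], of n t "\<lambda>i\<in>{..<n}. 0"] by simp
qed

lemma power_diff_le:
  fixes r :: real
  assumes r: "0 < r" "r < 1" and ab: "a \<le> b + c" "b \<le> a + c"
  shows "\<bar>r ^ a - r ^ b\<bar> \<le> (1 / r ^ c - 1) * r ^ b"
proof -
  have pos: "r ^ a > 0" "r ^ b > 0" "r ^ c > 0" and c1: "r ^ c \<le> 1"
    using r by (auto simp: power_le_one)
  have upper: "r ^ a \<le> r ^ b / r ^ c"
    using power_decreasing[OF ab(2), of r] r pos by (simp add: power_add pos_le_divide_eq)
  have lower: "r ^ b * r ^ c \<le> r ^ a"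
    using power_decreasing[OF ab(1), of r] r by (simp add: power_add)
  have "1 - y \<le> 1 / y - 1" if "y > 0" for y :: real
  proof -
    have "(1 / y - 1) - (1 - y) = (1 - y) * (1 - y) / y"
      using that by (simp add: field_simps)
    also have "\<dots> \<ge> 0" using that by (intro divide_nonneg_pos zero_le_square)
    finally show ?thesis by simp
  qed
  from mult_right_mono[OF this[OF pos(3)], of "r ^ b"] pos
  have "r ^ b - r ^ b * r ^ c \<le> (1 / r ^ c - 1) * r ^ b" by (simp add: algebra_simps)
  then show ?thesis using upper lower by (auto simp: abs_le_iff algebra_simps)
qed

lemma test_vector_translate:
  fixes n :: nat
  defines "G \<equiv> free_abelian_group_of_rank n"
  assumes n: "0 < n" and r: "0 < r" "r < 1" and g: "g \<in> carrier G" and h: "h \<in> carrier G"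
  shows "cmod (test_vector n t r (inv\<^bsub>G\<^esub> h \<otimes>\<^bsub>G\<^esub> g) - cis (- t * of_int (h 0)) * test_vector n t r g)
    \<le> (1 / r ^ word_length n h - 1) * cmod (test_vector n t r g)"
proof -
  define k where "k = (\<lambda>i\<in>{..<n}. g i - h i)"
  have k: "inv\<^bsub>G\<^esub> h \<otimes>\<^bsub>G\<^esub> g = k"
    using h by (auto simp: G_def k_def fun_eq_iff)
  have kG: "k \<in> carrier G" by (simp add: G_def k_def)
  have "nat \<bar>k i\<bar> \<le> nat \<bar>g i\<bar> + nat \<bar>h i\<bar>" "nat \<bar>g i\<bar> \<le> nat \<bar>k i\<bar> + nat \<bar>h i\<bar>" if "i < n" for i
    using that by (auto simp: k_def)
  then have len: "word_length n k \<le> word_length n g + word_length n h"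
    "word_length n g \<le> word_length n k + word_length n h"
    unfolding word_length_def by (auto simp: sum.distrib[symmetric] intro!: sum_mono)
  have "cis (t * of_int (k 0)) = cis (- t * of_int (h 0)) * cis (t * of_int (g 0))"
    using n by (simp add: cis_mult k_def algebra_simps)
  then have "test_vector n t r k - cis (- t * of_int (h 0)) * test_vector n t r g
    = cis (t * of_int (k 0)) * of_real (r ^ word_length n k - r ^ word_length n g)"
    using kG g unfolding G_def by (simp add: test_vector_def algebra_simps)
  then have "cmod (test_vector n t r k - cis (- t * of_int (h 0)) * test_vector n t r g)
    = \<bar>r ^ word_length n k - r ^ word_length n g\<bar>"
    by (simp only: norm_mult norm_cis norm_of_real mult_1)
  also have "\<dots> \<le> (1 / r ^ word_length n h - 1) * r ^ word_length n g"
    by (rule power_diff_le[OF r len])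
  also have "r ^ word_length n g = cmod (test_vector n t r g)"
    using g r unfolding G_def by (simp add: test_vector_def norm_mult norm_power)
  finally show ?thesis unfolding k .
qed

text \<open>A bound for the relative error in the eigenvector equation; it tends to \<open>0\<close> as \<open>r\<close> tends to \<open>1\<close>.\<close>

definition eigenvector_error :: "nat \<Rightarrow> ((nat \<Rightarrow> int) \<Rightarrow> complex) \<Rightarrow> real \<Rightarrow> real" where
  "eigenvector_error n a r = (\<Sum>h | a h \<noteq> 0. cmod (a h) * (1 / r ^ word_length n h - 1))"

lemma eigenvector_error_tendsto: "(eigenvector_error n a \<longlongrightarrow> 0) (at_left 1)"
proof -
  have "(eigenvector_error n a \<longlongrightarrow> (\<Sum>h | a h \<noteq> 0. cmod (a h) * (1 / 1 ^ word_length n h - 1))) (at_left 1)"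
    unfolding eigenvector_error_def by (intro tendsto_intros) auto
  then show ?thesis by simp
qed

lemma convolution_test_vector:
  fixes n :: nat
  defines "G \<equiv> free_abelian_group_of_rank n"
  assumes n: "0 < n" and r: "0 < r" "r < 1" and a: "a \<in> carrier (group_ring G)"
  shows "l2_norm G (\<lambda>g. convolution G a (test_vector n t r) g - character_value t a * test_vector n t r g)
    \<le> eigenvector_error n a r * l2_norm G (test_vector n t r)"
proof -
  let ?\<xi> = "test_vector n t r"
  have fin: "finite {h. a h \<noteq> 0}" "{h. a h \<noteq> 0} \<subseteq> carrier G"
    using a by (auto simp: carrier_group_ring)
  have err: "1 / r ^ word_length n h - 1 \<ge> 0" for h
    using r by (simp add: power_le_one)
  have "cmod (convolution G a ?\<xi> g - character_value t a * ?\<xi> g) \<le> eigenvector_error n a r * cmod (?\<xi> g)" for g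
  proof (cases "g \<in> carrier G")
    case True
    have "convolution G a ?\<xi> g - character_value t a * ?\<xi> g
        = (\<Sum>h | a h \<noteq> 0. a h * (?\<xi> (inv\<^bsub>G\<^esub> h \<otimes>\<^bsub>G\<^esub> g) - cis (- t * of_int (h 0)) * ?\<xi> g))"
      by (simp add: convolution_superset[OF fin(1) subset_refl fin(2) True] character_value_def pairing_def
          sum_distrib_right sum_subtractf[symmetric] right_diff_distrib mult.assoc)
    also have "cmod \<dots> \<le> (\<Sum>h | a h \<noteq> 0. cmod (a h) * ((1 / r ^ word_length n h - 1) * cmod (?\<xi> g)))"
    proof (rule order_trans[OF norm_sum sum_mono])
      fix h assume "h \<in> {h. a h \<noteq> 0}"
      then have "h \<in> carrier G" using fin(2) by blast
      from test_vector_translate[OF n r True[unfolded G_def] this[unfolded G_def], of t]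
      show "cmod (a h * (?\<xi> (inv\<^bsub>G\<^esub> h \<otimes>\<^bsub>G\<^esub> g) - cis (- t * of_int (h 0)) * ?\<xi> g))
          \<le> cmod (a h) * ((1 / r ^ word_length n h - 1) * cmod (?\<xi> g))"
        unfolding norm_mult[of "a h"] G_def by (intro mult_left_mono) auto
    qed
    finally show ?thesis
      by (simp add: eigenvector_error_def sum_distrib_right mult.assoc)
  next
    case False
    then show ?thesis by (simp add: convolution_outside test_vector_def G_def)
  qed
  then show ?thesis
    unfolding G_def using err
    by (intro l2_dominated(2)[OF test_vector_l2[OF r]])
      (auto simp: eigenvector_error_def intro!: sum_nonneg mult_nonneg_nonneg)
qed

lemma character_value_convolution:
  fixes n :: nat
  defines "G \<equiv> free_abelian_group_of_rank n"
  assumes n: "0 < n" and ab: "a \<in> carrier (group_ring G)" "b \<in> carrier (group_ring G)"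
  shows "character_value t (convolution G a b) = character_value t a * character_value t b"
proof -
  have "character_value t (convolution G a b)
      = pairing a (\<lambda>h. pairing b (\<lambda>k. cis (- t * of_int ((h \<otimes>\<^bsub>G\<^esub> k) 0))))"
    unfolding character_value_def G_def
    by (rule pairing_convolution[OF group_free_abelian ab[unfolded G_def]])
  also have "\<dots> = pairing a (\<lambda>h. pairing b (\<lambda>k. cis (- t * of_int (h 0)) * cis (- t * of_int (k 0))))"
    using n by (simp add: G_def cis_mult algebra_simps)
  also have "\<dots> = character_value t a * character_value t b"
    by (simp add: pairing_scale character_value_def mult.commute[of _ "pairing b _"])
  finally show ?thesis .
qed

text \<open>
  If an operator is close to convolution with \<open>a\<close> and dominated by the convolutions with the \<open>x\<^sub>i\<close>,
  then the value of \<open>a\<close> at a character is bounded by the values of the \<open>x\<^sub>i\<close>: apply the operator to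
  the test vectors and let \<open>r\<close> tend to \<open>1\<close>.
\<close>

lemma character_value_bound:
  fixes n :: nat and T :: "((nat \<Rightarrow> int) \<Rightarrow> complex) \<Rightarrow> (nat \<Rightarrow> int) \<Rightarrow> complex"
  defines "G \<equiv> free_abelian_group_of_rank n"
  assumes n: "0 < n" and a: "a \<in> carrier (group_ring G)" and x: "\<And>i. x i \<in> carrier (group_ring G)"
    and T: "\<And>\<beta>. \<beta> \<in> l2_space G \<Longrightarrow> T \<beta> \<in> l2_space G"
    and close: "\<And>\<beta>. \<beta> \<in> l2_space G \<Longrightarrow> l2_norm G (\<lambda>g. T \<beta> g - convolution G a \<beta> g) \<le> \<delta> * l2_norm G \<beta>"
    and dominated: "\<And>\<beta>. \<beta> \<in> l2_space G \<Longrightarrow> l2_norm G (T \<beta>) \<le> C * (\<Sum>i<n. l2_norm G (convolution G (x i) \<beta>))"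
    and C: "C \<ge> 0"
  shows "cmod (character_value t a) \<le> C * (\<Sum>i<n. cmod (character_value t (x i))) + \<delta>"
proof (rule tendsto_le)
  note grp = group_free_abelian[of n, folded G_def]
  show "((\<lambda>r. C * (\<Sum>i<n. cmod (character_value t (x i)) + eigenvector_error n (x i) r) + \<delta> + eigenvector_error n a r)
      \<longlongrightarrow> C * (\<Sum>i<n. cmod (character_value t (x i))) + \<delta>) (at_left 1)"
    by (rule tendsto_eq_intros eigenvector_error_tendsto refl | simp)+
  show "((\<lambda>r. cmod (character_value t a)) \<longlongrightarrow> cmod (character_value t a)) (at_left 1)" by simp
  have "cmod (character_value t a)
      \<le> C * (\<Sum>i<n. cmod (character_value t (x i)) + eigenvector_error n (x i) r) + \<delta> + eigenvector_error n a r"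
    if r: "0 < r" "r < 1" for r
  proof -
    define \<xi> where "\<xi> = test_vector n t r"
    have \<xi>: "\<xi> \<in> l2_space G" "l2_norm G \<xi> > 0"
      using test_vector_l2[OF r] test_vector_norm_pos[OF r] by (auto simp: \<xi>_def G_def)
    have conv: "convolution G b \<xi> \<in> l2_space G" "(\<lambda>g. character_value t b * \<xi> g) \<in> l2_space G"
      "l2_norm G (\<lambda>g. convolution G b \<xi> g - character_value t b * \<xi> g) \<le> eigenvector_error n b r * l2_norm G \<xi>"
      if "b \<in> carrier (group_ring G)" for b
      using l2_convolution(1)[OF grp that \<xi>(1)] l2_scale(1)[OF \<xi>(1)]
        convolution_test_vector[OF n r that[unfolded G_def], of t] by (auto simp: \<xi>_def G_def)
    have "l2_norm G (convolution G (x i) \<xi>)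
        \<le> (cmod (character_value t (x i)) + eigenvector_error n (x i) r) * l2_norm G \<xi>" for i
      using l2_norm_triangle_diff[OF conv(1)[OF x] conv(2)[OF x], of i i] conv(3)[OF x, of i] l2_norm_scale[OF \<xi>(1)]
      by (simp add: distrib_right)
    then have "l2_norm G (T \<xi>)
        \<le> C * ((\<Sum>i<n. cmod (character_value t (x i)) + eigenvector_error n (x i) r) * l2_norm G \<xi>)"
      unfolding sum_distrib_right by (intro order_trans[OF dominated[OF \<xi>(1)]] mult_left_mono sum_mono C)
    moreover have "l2_norm G (\<lambda>g. character_value t a * \<xi> g) \<le> l2_norm G (T \<xi>) + \<delta> * l2_norm G \<xi>
        + eigenvector_error n a r * l2_norm G \<xi>"
    proof -
      have swap: "l2_norm G (\<lambda>g. \<beta> g - \<gamma> g) = l2_norm G (\<lambda>g. \<gamma> g - \<beta> g)" for \<beta> \<gamma> :: "(nat \<Rightarrow> int) \<Rightarrow> complex"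
        by (simp add: l2_norm_def norm_minus_commute)
      have "l2_norm G (\<lambda>g. character_value t a * \<xi> g)
          \<le> l2_norm G (\<lambda>g. convolution G a \<xi> g - character_value t a * \<xi> g) + l2_norm G (convolution G a \<xi>)"
        using l2_norm_triangle_diff[OF conv(2)[OF a] conv(1)[OF a]]
        by (simp only: swap[of "convolution G a \<xi>"])
      moreover have "l2_norm G (convolution G a \<xi>)
          \<le> l2_norm G (\<lambda>g. T \<xi> g - convolution G a \<xi> g) + l2_norm G (T \<xi>)"
        using l2_norm_triangle_diff[OF conv(1)[OF a] T[OF \<xi>(1)]]
        by (simp only: swap[of "T \<xi>"])
      ultimately show ?thesis using conv(3)[OF a] close[OF \<xi>(1)] by linarith
    qed
    ultimately have "cmod (character_value t a) * l2_norm G \<xi>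
      \<le> (C * (\<Sum>i<n. cmod (character_value t (x i)) + eigenvector_error n (x i) r) + \<delta> + eigenvector_error n a r)
        * l2_norm G \<xi>"
      unfolding l2_norm_scale[OF \<xi>(1)] distrib_right[where c = "l2_norm G \<xi>"] mult.assoc by linarith
    then show ?thesis using \<xi>(2) by simp
  qed
  then show "\<forall>\<^sub>F r in at_left 1. cmod (character_value t a)
      \<le> C * (\<Sum>i<n. cmod (character_value t (x i)) + eigenvector_error n (x i) r) + \<delta> + eigenvector_error n a r"
    using eventually_at_left_real[of 0 1] by (auto elim: eventually_mono)
qed simp

section \<open>Operators in the submodule generated by the differences\<close>

lemma cstar_red_commute:
  assumes G: "comm_group G" and T: "T \<in> carrier (cstar_red G)" and a: "a \<in> carrier (group_ring G)"
    and \<beta>: "\<beta> \<in> l2_space G"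
  shows "T (convolution G a \<beta>) = convolution G a (T \<beta>)"
proof -
  interpret comm_group G by fact
  note grp = is_group
  define A where "A = (\<Sum>h | a h \<noteq> 0. cmod (a h))"
  have A: "A \<ge> 0" by (simp add: A_def sum_nonneg)
  have Ta: "T \<gamma> \<in> l2_space G" for \<gamma> by (rule cstar_red_range[OF grp T])
  have a\<beta>: "convolution G a \<gamma> \<in> l2_space G" "l2_norm G (convolution G a \<gamma>) \<le> A * l2_norm G \<gamma>"
    if "\<gamma> \<in> l2_space G" for \<gamma>
    using l2_convolution[OF grp a that] by (auto simp: A_def)
  define \<gamma> where "\<gamma> g = T (convolution G a \<beta>) g - convolution G a (T \<beta>) g" for g
  have \<gamma>: "\<gamma> \<in> l2_space G" unfolding \<gamma>_def by (intro l2_diff(1) Ta a\<beta>(1) \<beta>)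
  have "l2_norm G \<gamma> \<le> e" if e: "e > 0" for e
  proof -
    define K where "K = 2 * A * l2_norm G \<beta> + 1"
    have K: "K > 0" using A l2_norm_nonneg[of G \<beta>] by (simp add: K_def add_nonneg_pos)
    have "e / K > 0" using e K by simp
    from cstar_redD(2)[OF grp T this] obtain b where b: "b \<in> carrier (group_ring G)"
      and bT: "\<And>\<beta>. \<beta> \<in> l2_space G \<Longrightarrow> l2_norm G (\<lambda>g. T \<beta> g - convolution G b \<beta> g) \<le> e / K * l2_norm G \<beta>" by blast
    have bl2: "convolution G b \<gamma> \<in> l2_space G" if "\<gamma> \<in> l2_space G" for \<gamma>
      by (rule l2_convolution(1)[OF grp b that])
    have comm: "convolution G a (convolution G b \<beta>) = convolution G b (convolution G a \<beta>)"
      using convolution_assoc[OF grp a b, of \<beta>] convolution_assoc[OF grp b a, of \<beta>]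
        convolution_commute[OF G a b] by simp
    have eq: "\<gamma> = (\<lambda>g. (T (convolution G a \<beta>) g - convolution G b (convolution G a \<beta>) g)
        - convolution G a (\<lambda>g. T \<beta> g - convolution G b \<beta> g) g)"
    proof -
      have "convolution G a (\<lambda>g. T \<beta> g - convolution G b \<beta> g)
          = (\<lambda>g. convolution G a (T \<beta>) g - convolution G b (convolution G a \<beta>) g)"
        using convolution_linear(1)[OF grp, of a "T \<beta>" "\<lambda>g. - 1 * convolution G b \<beta> g"]
          convolution_linear(2)[OF grp, of a "-1" "convolution G b \<beta>"] by (simp add: comm)
      then show ?thesis by (simp add: \<gamma>_def fun_eq_iff)
    qed
    have "l2_norm G \<gamma> \<le> l2_norm G (\<lambda>g. T (convolution G a \<beta>) g - convolution G b (convolution G a \<beta>) g)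
        + l2_norm G (convolution G a (\<lambda>g. T \<beta> g - convolution G b \<beta> g))"
      by (subst eq) (rule l2_diff(2)[OF l2_diff(1)[OF Ta bl2[OF a\<beta>(1)[OF \<beta>]]] a\<beta>(1)[OF l2_diff(1)[OF Ta bl2[OF \<beta>]]]])
    also have "\<dots> \<le> e / K * (A * l2_norm G \<beta>) + A * (e / K * l2_norm G \<beta>)"
    proof (rule add_mono)
      show "l2_norm G (\<lambda>g. T (convolution G a \<beta>) g - convolution G b (convolution G a \<beta>) g)
          \<le> e / K * (A * l2_norm G \<beta>)"
        using \<open>e / K > 0\<close> by (intro order_trans[OF bT[OF a\<beta>(1)[OF \<beta>]]] mult_left_mono a\<beta>(2) \<beta>) auto
      show "l2_norm G (convolution G a (\<lambda>g. T \<beta> g - convolution G b \<beta> g)) \<le> A * (e / K * l2_norm G \<beta>)"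
        by (intro order_trans[OF a\<beta>(2)] mult_left_mono bT \<beta> A l2_diff(1) Ta bl2)
    qed
    also have "\<dots> = e / K * (K - 1)" by (simp add: K_def algebra_simps)
    also have "\<dots> \<le> e" using e K by (simp add: field_simps)
    finally show ?thesis .
  qed
  then have "l2_norm G \<gamma> \<le> 0" using field_le_epsilon[of "l2_norm G \<gamma>" 0] by simp
  then have "\<gamma> = (\<lambda>g. 0)" using l2_norm_eq_0[OF \<gamma>] l2_norm_nonneg[of G \<gamma>] by simp
  then show ?thesis by (simp add: \<gamma>_def fun_eq_iff)
qed

text \<open>
  An operator \<open>x\<^sub>0S\<^sub>0 + \<dots> + x\<^sub>j\<^sub>-\<^sub>1S\<^sub>j\<^sub>-\<^sub>1\<close> is dominated by the \<open>x\<^sub>i\<close>, because the bounded operators \<open>S\<^sub>i\<close>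
  commute with them.
\<close>

lemma span_multiples_dominated:
  fixes x :: "nat \<Rightarrow> 'g \<Rightarrow> int"
  assumes G: "comm_group G" and x: "\<And>i. x i \<in> carrier (group_ring G)"
    and T: "T \<in> span_multiples x (integral_module (cstar_action G) (cstar_red G)) j"
  shows "\<exists>C\<ge>0. \<forall>\<beta>\<in>l2_space G.
    l2_norm G (T \<beta>) \<le> C * (\<Sum>i<j. l2_norm G (convolution G (\<lambda>g. of_int (x i g)) \<beta>))"
  using T
proof (induction j arbitrary: T)
  case 0
  then show ?case by (auto simp: integral_module_def l2_zero)
next
  case (Suc j)
  interpret comm_group G by fact
  note grp = is_group
  let ?M = "integral_module (cstar_action G) (cstar_red G)"
  let ?x = "\<lambda>i g. of_int (x i g) :: complex"
  obtain S v where S: "S \<in> carrier ?M" and v: "v \<in> span_multiples x ?M j"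
    and T: "T = x j \<odot>\<^bsub>?M\<^esub> S \<oplus>\<^bsub>?M\<^esub> v" using Suc.prems by auto
  have S': "S \<in> carrier (cstar_red G)" using S by (simp add: integral_module_def)
  have v': "v \<in> carrier (cstar_red G)"
    using span_multiples_closed(1)[OF module_if_left_module[OF cring_group_ring[OF G] left_module_cstar[OF grp]] x v]
    by (simp add: integral_module_def)
  obtain C where C: "C \<ge> 0" "\<And>\<beta>. \<beta> \<in> l2_space G \<Longrightarrow> l2_norm G (S \<beta>) \<le> C * l2_norm G \<beta>"
    using bounded_operator_bound[OF grp cstar_redD(1)[OF grp S']] by metis
  obtain D where D: "D \<ge> 0" "\<And>\<beta>. \<beta> \<in> l2_space G \<Longrightarrow>
      l2_norm G (v \<beta>) \<le> D * (\<Sum>i<j. l2_norm G (convolution G (?x i) \<beta>))"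
    using Suc.IH[OF v] by blast
  have "l2_norm G (T \<beta>) \<le> (C + D) * (\<Sum>i<Suc j. l2_norm G (convolution G (?x i) \<beta>))"
    if \<beta>: "\<beta> \<in> l2_space G" for \<beta>
  proof -
    have xj: "convolution G (?x j) \<beta> \<in> l2_space G"
      by (rule l2_convolution(1)[OF grp of_int_closed[OF grp x] \<beta>])
    have "T \<beta> = (\<lambda>g. S (convolution G (?x j) \<beta>) g + v \<beta> g)"
      unfolding T cstar_module_smult[OF grp x S'] cstar_red_commute[OF G S' of_int_closed[OF grp x] \<beta>]
      by (simp add: integral_module_def cstar_red_def)
    then have "l2_norm G (T \<beta>) \<le> l2_norm G (S (convolution G (?x j) \<beta>)) + l2_norm G (v \<beta>)"
      using l2_add(2)[OF cstar_red_range[OF grp S'] cstar_red_range[OF grp v']] by metis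
    also have "\<dots> \<le> C * l2_norm G (convolution G (?x j) \<beta>) + D * (\<Sum>i<j. l2_norm G (convolution G (?x i) \<beta>))"
      by (intro add_mono C(2) D(2) xj \<beta>)
    also have "\<dots> \<le> (C + D) * (\<Sum>i<Suc j. l2_norm G (convolution G (?x i) \<beta>))"
    proof -
      have "0 \<le> (\<Sum>i<j. l2_norm G (convolution G (?x i) \<beta>))" "0 \<le> l2_norm G (convolution G (?x j) \<beta>)"
        by (auto intro: sum_nonneg l2_norm_nonneg)
      then show ?thesis using C(1) D(1) by (simp add: algebra_simps)
    qed
    finally show ?thesis .
  qed
  then show ?case using C(1) D(1) by (intro exI[of _ "C + D"]) auto
qed

section \<open>Lacunary operators\<close>

text \<open>
  The terms are \<open>e\<^sub>0\<^sup>M\<^sup>(\<^sup>j\<^sup>) - 1\<close> with \<open>M(j) = 2 ^ j\<^sup>2\<close>. Each exponent is an even multiple of all the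
  preceding ones, so at the frequency \<open>\<pi> / M(m)\<close> all later terms vanish; the exponents grow fast
  enough for the earlier terms to be negligible. Like every operator here, the sum of the weighted
  series is set to zero outside the Hilbert space.
\<close>

definition lacunary_term :: "nat \<Rightarrow> nat \<Rightarrow> (nat \<Rightarrow> int) \<Rightarrow> complex" where
  "lacunary_term n j = (\<lambda>g. unit_mass (\<lambda>i\<in>{..<n}. if i = 0 then 2 ^ j\<^sup>2 else 0) g
     - unit_mass (\<lambda>i\<in>{..<n}. 0) g)"

definition lacunary_partial :: "nat \<Rightarrow> (nat \<Rightarrow> complex) \<Rightarrow> nat \<Rightarrow> (nat \<Rightarrow> int) \<Rightarrow> complex" where
  "lacunary_partial n b N = (\<lambda>g. \<Sum>j<N. b j / 2 ^ j * lacunary_term n j g)"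

definition lacunary_operator ::
    "nat \<Rightarrow> (nat \<Rightarrow> complex) \<Rightarrow> ((nat \<Rightarrow> int) \<Rightarrow> complex) \<Rightarrow> (nat \<Rightarrow> int) \<Rightarrow> complex" where
  "lacunary_operator n b \<beta> = (if \<beta> \<in> l2_space (free_abelian_group_of_rank n)
     then (\<lambda>g. \<Sum>j. b j / 2 ^ j * convolution (free_abelian_group_of_rank n) (lacunary_term n j) \<beta> g)
     else (\<lambda>g. 0))"

lemma lacunary_term_closed: "lacunary_term n j \<in> carrier (group_ring (free_abelian_group_of_rank n))"
  unfolding lacunary_term_def by (rule unit_mass_diff_closed) simp_all

lemma l2_lacunary_term:
  fixes n :: nat
  defines "G \<equiv> free_abelian_group_of_rank n"
  assumes \<beta>: "\<beta> \<in> l2_space G"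
  shows "convolution G (lacunary_term n j) \<beta> \<in> l2_space G"
    and "l2_norm G (convolution G (lacunary_term n j) \<beta>) \<le> 2 * l2_norm G \<beta>"
proof -
  note grp = group_free_abelian[of n, folded G_def]
  note closed = lacunary_term_closed[of n j, folded G_def]
  let ?s = "\<lambda>i\<in>{..<n}. if i = 0 then 2 ^ j\<^sup>2 else 0 :: int" and ?o = "\<lambda>i\<in>{..<n}. 0 :: int"
  show "convolution G (lacunary_term n j) \<beta> \<in> l2_space G"
    by (rule l2_convolution(1)[OF grp closed \<beta>])
  have so: "?s \<in> carrier G" "?o \<in> carrier G" by (simp_all add: G_def)
  have "convolution G (lacunary_term n j) \<beta> g
      = convolution G (unit_mass ?s) \<beta> g - convolution G (unit_mass ?o) \<beta> g" for g
  proof (cases "g \<in> carrier G")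
    case True
    show ?thesis
      unfolding convolution_eq_pairing[OF closed True] convolution_unit_mass[OF so(1) True]
        convolution_unit_mass[OF so(2) True]
      unfolding lacunary_term_def pairing_unit_mass_diff ..
  qed (simp add: convolution_outside)
  then have "convolution G (lacunary_term n j) \<beta>
      = (\<lambda>g. convolution G (unit_mass ?s) \<beta> g - convolution G (unit_mass ?o) \<beta> g)" by blast
  then show "l2_norm G (convolution G (lacunary_term n j) \<beta>) \<le> 2 * l2_norm G \<beta>"
    using l2_diff(2)[OF l2_translate(1)[OF grp so(1) \<beta>] l2_translate(1)[OF grp so(2) \<beta>]]
      l2_translate(2)[OF grp so(1) \<beta>] l2_translate(2)[OF grp so(2) \<beta>] by simp
qed

lemma lacunary_partial_closed: "lacunary_partial n b N \<in> carrier (group_ring (free_abelian_group_of_rank n))"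
proof (induction N)
  case 0
  then show ?case by (simp add: lacunary_partial_def carrier_group_ring)
next
  case (Suc N)
  have "lacunary_partial n b (Suc N) = (\<lambda>g. lacunary_partial n b N g + b N / 2 ^ N * lacunary_term n N g)"
    by (simp add: lacunary_partial_def)
  then show ?case
    using group_ring_add[OF Suc group_ring_scale[OF lacunary_term_closed[of n N], where c = "b N / 2 ^ N"]] by simp
qed

lemma convolution_lacunary_partial:
  "convolution (free_abelian_group_of_rank n) (lacunary_partial n b N) \<beta>
    = (\<lambda>g. \<Sum>j<N. b j / 2 ^ j * convolution (free_abelian_group_of_rank n) (lacunary_term n j) \<beta> g)"
proof (induction N)
  case 0
  then show ?case by (simp add: lacunary_partial_def convolution_zero_left)
next
  case (Suc N)
  have "lacunary_partial n b (Suc N)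
      = (\<lambda>g. lacunary_partial n b N g + b N / 2 ^ N * lacunary_term n N g)"
    by (simp add: lacunary_partial_def)
  then show ?case
    using convolution_add_left[OF group_free_abelian[of n] lacunary_partial_closed[of n b N]
        group_ring_scale[OF lacunary_term_closed[of n N], where c = "b N / 2 ^ N"], of \<beta>]
      convolution_scale_left[OF group_free_abelian lacunary_term_closed[of n N], of "b N / 2 ^ N" \<beta>] Suc
    by simp
qed

lemma sum_half_powers_le: "(\<Sum>j\<in>{N..<K}. 1 / 2 ^ j :: real) \<le> 2 / 2 ^ N"
proof (cases "N \<le> K")
  case True
  then have "(\<Sum>j\<in>{N..<K}. 1 / 2 ^ j :: real) = 2 / 2 ^ N - 2 / 2 ^ K"
  proof (induction K rule: dec_induct)
    case (step K)
    then have "(\<Sum>j\<in>{N..<Suc K}. 1 / 2 ^ j :: real) = 2 / 2 ^ N - 2 / 2 ^ K + 1 / 2 ^ K"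
      by (simp only: sum.atLeastLessThan_Suc)
    then show ?case by simp
  qed simp
  then show ?thesis by simp
qed simp

lemma lacunary_operator_approx:
  fixes n :: nat
  defines "G \<equiv> free_abelian_group_of_rank n"
  assumes b: "\<And>j. cmod (b j) \<le> B" and \<beta>: "\<beta> \<in> l2_space G"
  shows "summable (\<lambda>j. b j / 2 ^ j * convolution G (lacunary_term n j) \<beta> g)"
    and "(\<lambda>g. lacunary_operator n b \<beta> g - convolution G (lacunary_partial n b N) \<beta> g) \<in> l2_space G"
    and "l2_norm G (\<lambda>g. lacunary_operator n b \<beta> g - convolution G (lacunary_partial n b N) \<beta> g)
      \<le> 4 * B / 2 ^ N * l2_norm G \<beta>"
proof -
  have B: "B \<ge> 0" using b[of 0] norm_ge_zero order_trans by blast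
  define D where "D j = convolution G (lacunary_term n j) \<beta>" for j
  have D: "D j \<in> l2_space G" "l2_norm G (D j) \<le> 2 * l2_norm G \<beta>" for j
    using l2_lacunary_term[of \<beta> n j] \<beta> by (auto simp: D_def G_def)
  have term_l2: "(\<lambda>g. b j / 2 ^ j * D j g) \<in> l2_space G"
    "l2_norm G (\<lambda>g. b j / 2 ^ j * D j g) \<le> 2 * B * l2_norm G \<beta> * (1 / 2 ^ j)" for j
  proof -
    show "(\<lambda>g. b j / 2 ^ j * D j g) \<in> l2_space G" by (rule l2_scale(1)[OF D(1)])
    have "cmod (b j / 2 ^ j) * l2_norm G (D j) \<le> B / 2 ^ j * (2 * l2_norm G \<beta>)"
      using b[of j] B by (intro mult_mono D(2)) (auto simp: norm_divide norm_power divide_right_mono l2_norm_nonneg)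
    then show "l2_norm G (\<lambda>g. b j / 2 ^ j * D j g) \<le> 2 * B * l2_norm G \<beta> * (1 / 2 ^ j)"
      using l2_norm_scale[OF D(1), of "b j / 2 ^ j" j] by (simp add: mult_ac)
  qed
  have sum: "summable (\<lambda>j. b j / 2 ^ j * D j g)" for g
  proof (rule summable_comparison_test')
    show "summable (\<lambda>j. 2 * B * l2_norm G \<beta> * (1 / 2) ^ j)"
      by (intro summable_mult summable_geometric) simp
    show "norm (b j / 2 ^ j * D j g) \<le> 2 * B * l2_norm G \<beta> * (1 / 2) ^ j" for j
      using cmod_le_l2_norm[OF term_l2(1), of j g] term_l2(2)[of j] by (simp add: power_one_over)
  qed
  then show "summable (\<lambda>j. b j / 2 ^ j * convolution G (lacunary_term n j) \<beta> g)" by (simp add: D_def)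
  define \<gamma> where "\<gamma> K = (\<lambda>g. \<Sum>j\<in>{N..<K}. b j / 2 ^ j * D j g)" for K
  have \<gamma>_l2: "\<gamma> K \<in> l2_space G" for K
    unfolding \<gamma>_def by (intro l2_sum(1) term_l2(1)) simp
  have \<gamma>_norm: "l2_norm G (\<gamma> K) \<le> 4 * B / 2 ^ N * l2_norm G \<beta>" for K
  proof -
    have "l2_norm G (\<gamma> K) \<le> (\<Sum>j\<in>{N..<K}. 2 * B * l2_norm G \<beta> * (1 / 2 ^ j))"
      unfolding \<gamma>_def
      by (intro order_trans[OF l2_sum(2) sum_mono] term_l2) simp_all
    also have "\<dots> = 2 * B * l2_norm G \<beta> * (\<Sum>j\<in>{N..<K}. 1 / 2 ^ j)"
      by (simp only: sum_distrib_left)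
    also have "\<dots> \<le> 2 * B * l2_norm G \<beta> * (2 / 2 ^ N)"
      using B by (intro mult_left_mono sum_half_powers_le) (simp add: l2_norm_nonneg)
    finally show ?thesis by (simp add: mult_ac)
  qed
  have lim: "(\<lambda>K. \<gamma> K g) \<longlonglongrightarrow> lacunary_operator n b \<beta> g - convolution G (lacunary_partial n b N) \<beta> g" for g
  proof -
    have "(\<lambda>K. (\<Sum>j<K. b j / 2 ^ j * D j g) - (\<Sum>j<N. b j / 2 ^ j * D j g))
        \<longlonglongrightarrow> (\<Sum>j. b j / 2 ^ j * D j g) - (\<Sum>j<N. b j / 2 ^ j * D j g)"
      by (intro tendsto_diff summable_LIMSEQ sum tendsto_const)
    moreover have "\<forall>\<^sub>F K in sequentially. (\<Sum>j<K. b j / 2 ^ j * D j g) - (\<Sum>j<N. b j / 2 ^ j * D j g) = \<gamma> K g"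
      using eventually_ge_at_top[of N]
    proof eventually_elim
      case (elim K)
      then have "{..<K} = {..<N} \<union> {N..<K}" "{..<N} \<inter> {N..<K} = {}" by auto
      then show ?case by (simp add: \<gamma>_def sum.union_disjoint)
    qed
    ultimately have "(\<lambda>K. \<gamma> K g) \<longlonglongrightarrow> (\<Sum>j. b j / 2 ^ j * D j g) - (\<Sum>j<N. b j / 2 ^ j * D j g)"
      by (rule Lim_transform_eventually)
    then show ?thesis
      using \<beta> by (simp add: lacunary_operator_def convolution_lacunary_partial D_def G_def)
  qed
  show "(\<lambda>g. lacunary_operator n b \<beta> g - convolution G (lacunary_partial n b N) \<beta> g) \<in> l2_space G"
    by (rule l2_limit(1)[OF \<gamma>_l2 \<gamma>_norm lim])
  show "l2_norm G (\<lambda>g. lacunary_operator n b \<beta> g - convolution G (lacunary_partial n b N) \<beta> g)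
      \<le> 4 * B / 2 ^ N * l2_norm G \<beta>"
    by (rule l2_limit(2)[OF \<gamma>_l2 \<gamma>_norm lim])
qed

lemma lacunary_operator_cstar:
  fixes n :: nat
  defines "G \<equiv> free_abelian_group_of_rank n"
  assumes b: "\<And>j. cmod (b j) \<le> B"
  shows "lacunary_operator n b \<in> carrier (cstar_red G)"
proof -
  note grp = group_free_abelian[of n, folded G_def]
  have B: "B \<ge> 0" using b[of 0] norm_ge_zero order_trans by blast
  note approx = lacunary_operator_approx[of b B, OF b, of _ n, folded G_def]
  have 0: "convolution G (lacunary_partial n b 0) \<beta> = (\<lambda>g. 0)" for \<beta>
    by (simp add: lacunary_partial_def convolution_zero_left)
  have conv: "convolution G (lacunary_term n j) (\<lambda>g. \<beta> g + \<gamma> g)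
      = (\<lambda>g. convolution G (lacunary_term n j) \<beta> g + convolution G (lacunary_term n j) \<gamma> g)"
    "convolution G (lacunary_term n j) (\<lambda>g. c * \<beta> g) = (\<lambda>g. c * convolution G (lacunary_term n j) \<beta> g)"
    for j \<beta> \<gamma> c
    by (rule convolution_linear[OF grp])+
  have "bounded_operator G (lacunary_operator n b)"
    unfolding bounded_operator_def
  proof (intro conjI allI ballI impI)
    show "lacunary_operator n b \<in> l2_space G \<rightarrow> l2_space G"
      using approx(2)[of _ 0] by (simp add: 0)
    show "\<exists>C. \<forall>\<beta>\<in>l2_space G. l2_norm G (lacunary_operator n b \<beta>) \<le> C * l2_norm G \<beta>"
      using approx(3)[of _ 0] by (auto simp: 0)
    show "lacunary_operator n b \<beta> = (\<lambda>g. 0)" if "\<beta> \<notin> l2_space G" for \<beta>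
      using that by (simp add: lacunary_operator_def G_def)
  next
    fix \<beta> \<gamma> assume \<beta>: "\<beta> \<in> l2_space G" and \<gamma>: "\<gamma> \<in> l2_space G"
    show "lacunary_operator n b (\<lambda>g. \<beta> g + \<gamma> g) = (\<lambda>g. lacunary_operator n b \<beta> g + lacunary_operator n b \<gamma> g)"
      using \<beta> \<gamma> l2_add(1)[OF \<beta> \<gamma>] suminf_add[OF approx(1)[OF \<beta>] approx(1)[OF \<gamma>]]
      by (simp add: lacunary_operator_def conv[unfolded G_def] G_def distrib_left)
  next
    fix c \<beta> assume \<beta>: "\<beta> \<in> l2_space G"
    show "lacunary_operator n b (\<lambda>g. c * \<beta> g) = (\<lambda>g. c * lacunary_operator n b \<beta> g)"
      using \<beta> l2_scale(1)[OF \<beta>, of c] suminf_mult[OF approx(1)[OF \<beta>], of c]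
      by (simp add: lacunary_operator_def conv[unfolded G_def] G_def mult.left_commute)
  qed
  moreover have "\<exists>a \<in> carrier (group_ring G). \<forall>\<beta> \<in> l2_space G.
      l2_norm G (\<lambda>g. lacunary_operator n b \<beta> g - convolution G a \<beta> g) \<le> e * l2_norm G \<beta>" if e: "e > 0" for e
  proof -
    obtain N where N: "4 * B / e < 2 ^ N" using real_arch_pow[of 2 "4 * B / e"] by auto
    then have "4 * B / 2 ^ N \<le> e" using e by (simp add: field_simps)
    then have "l2_norm G (\<lambda>g. lacunary_operator n b \<beta> g - convolution G (lacunary_partial n b N) \<beta> g)
        \<le> e * l2_norm G \<beta>" if "\<beta> \<in> l2_space G" for \<beta>
      using approx(3)[OF that, of N] mult_right_mono[OF _ l2_norm_nonneg[of G \<beta>]] order_trans by blast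
    then show ?thesis using lacunary_partial_closed[of n b N] unfolding G_def by blast
  qed
  ultimately show ?thesis by (simp add: cstar_red_iff[OF grp])
qed

lemma lacunary_operator_add:
  assumes "\<And>j. cmod (a j) \<le> A" "\<And>j. cmod (b j) \<le> B"
  shows "lacunary_operator n (\<lambda>j. a j + b j) = (\<lambda>\<beta> g. lacunary_operator n a \<beta> g + lacunary_operator n b \<beta> g)"
proof (intro ext)
  fix \<beta> g
  show "lacunary_operator n (\<lambda>j. a j + b j) \<beta> g = lacunary_operator n a \<beta> g + lacunary_operator n b \<beta> g"
  proof (cases "\<beta> \<in> l2_space (free_abelian_group_of_rank n)")
    case True
    show ?thesis
      using True suminf_add[OF lacunary_operator_approx(1)[OF assms(1) True] lacunary_operator_approx(1)[OF assms(2) True]]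
      by (simp add: lacunary_operator_def add_divide_distrib distrib_right)
  qed (simp add: lacunary_operator_def)
qed

lemma lacunary_operator_scale:
  assumes "\<And>j. cmod (b j) \<le> B"
  shows "lacunary_operator n (\<lambda>j. c * b j) = (\<lambda>\<beta> g. c * lacunary_operator n b \<beta> g)"
proof (intro ext)
  fix \<beta> g
  show "lacunary_operator n (\<lambda>j. c * b j) \<beta> g = c * lacunary_operator n b \<beta> g"
  proof (cases "\<beta> \<in> l2_space (free_abelian_group_of_rank n)")
    case True
    show ?thesis
      using True suminf_mult[OF lacunary_operator_approx(1)[OF assms True], of c]
      by (simp add: lacunary_operator_def mult.assoc)
  qed (simp add: lacunary_operator_def)
qed

lemma cmod_cis_diff_one_le: "cmod (cis x - 1) \<le> \<bar>x\<bar>"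
proof -
  have "(cmod (cis x - 1))\<^sup>2 = (cos x - 1)\<^sup>2 + (sin x)\<^sup>2"
    by (simp add: cmod_power2)
  also have "\<dots> = 2 - 2 * cos x"
    using sin_cos_squared_add2[of x] by (simp add: power2_eq_square algebra_simps)
  also have "\<dots> = (2 * sin (x / 2))\<^sup>2"
    using cos_double_sin[of "x / 2"] by (simp add: power_mult_distrib)
  finally have "(cmod (cis x - 1))\<^sup>2 = (2 * sin (x / 2))\<^sup>2" .
  then have "(cmod (cis x - 1))\<^sup>2 = \<bar>2 * sin (x / 2)\<bar>\<^sup>2" by (simp only: power2_abs)
  then have "cmod (cis x - 1) = \<bar>2 * sin (x / 2)\<bar>"
    by (rule power2_eq_imp_eq) simp_all
  also have "\<dots> \<le> \<bar>x\<bar>" using abs_sin_x_le_abs_x[of "x / 2"] by (simp add: abs_mult)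
  finally show ?thesis .
qed

lemma character_value_lacunary_partial:
  assumes n: "0 < n"
  shows "character_value t (lacunary_partial n b N) = (\<Sum>j<N. b j / 2 ^ j * (cis (- t * 2 ^ j\<^sup>2) - 1))"
proof (induction N)
  case 0
  then show ?case by (simp add: character_value_def pairing_def lacunary_partial_def)
next
  case (Suc N)
  let ?c = "b N / 2 ^ N"
  have fin: "finite {g. lacunary_partial n b N g \<noteq> 0}" "finite {g. lacunary_term n N g \<noteq> 0}"
    "finite {g. ?c * lacunary_term n N g \<noteq> 0}"
    using lacunary_partial_closed[of n b N] lacunary_term_closed[of n N]
      group_ring_scale[OF lacunary_term_closed[of n N], where c = ?c]
    by (simp_all add: carrier_group_ring)
  have "pairing (lacunary_term n N) (\<lambda>h. cis (- t * of_int (h 0))) = cis (- t * 2 ^ N\<^sup>2) - 1"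
    unfolding lacunary_term_def pairing_unit_mass_diff using n by simp
  moreover have "lacunary_partial n b (Suc N) = (\<lambda>g. lacunary_partial n b N g + ?c * lacunary_term n N g)"
    by (simp add: lacunary_partial_def)
  ultimately show ?case
    using Suc pairing_add[OF fin(1,3)] pairing_scale_left[OF fin(2), of ?c] by (simp add: character_value_def)
qed

text \<open>
  At the frequency \<open>\<pi> / 2 ^ m\<^sup>2\<close> the term with index \<open>m\<close> has the value \<open>- 2 b\<^sub>m / 2\<^sup>m\<close>.
\<close>

lemma lacunary_partial_lower_bound:
  assumes n: "0 < n" and b: "\<And>j. cmod (b j) \<le> B" and m: "m < N"
  shows "2 * cmod (b m) / 2 ^ m - 4 * pi * B / 4 ^ m
    \<le> cmod (character_value (pi / 2 ^ m\<^sup>2) (lacunary_partial n b N))"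
proof -
  define f where "f j = b j / 2 ^ j * (cis (- (pi / 2 ^ m\<^sup>2) * 2 ^ j\<^sup>2) - 1)" for j
  have B: "B \<ge> 0" using b[of 0] norm_ge_zero order_trans by blast
  have large: "f j = 0" if "m < j" for j
  proof -
    have "m\<^sup>2 < j\<^sup>2" using that by (simp add: power_strict_mono)
    then obtain k where k: "j\<^sup>2 = m\<^sup>2 + Suc k" using less_imp_Suc_add by fastforce
    have "pi / 2 ^ m\<^sup>2 * 2 ^ j\<^sup>2 = 2 * pi * of_nat (2 ^ k)"
      by (simp add: k power_add)
    moreover have "cis (2 * pi * of_nat l) = 1" for l
      by (simp add: cis_multiple_2pi)
    ultimately show ?thesis by (simp add: f_def cis_cnj[symmetric])
  qed
  have "cis (- pi) = - 1" by (simp add: complex_eq_iff)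
  then have "f m = - 2 * b m / 2 ^ m" by (simp add: f_def)
  then have mid: "cmod (f m) = 2 * cmod (b m) / 2 ^ m" by (simp add: norm_mult norm_divide norm_power)
  have small: "cmod (f j) \<le> 2 * pi * B / 4 ^ m * (1 / 2 ^ j)" if j: "j < m" for j
  proof -
    have "j\<^sup>2 + 2 * m \<le> m\<^sup>2 + 1"
    proof -
      obtain k where k: "m = Suc k" "j \<le> k" using j by (cases m) auto
      have "j\<^sup>2 \<le> k\<^sup>2" using k(2) by (simp add: power_mono)
      then show ?thesis by (simp add: k(1) power2_eq_square)
    qed
    then have "(2::real) ^ (j\<^sup>2 + 2 * m) \<le> 2 ^ (m\<^sup>2 + 1)" by (intro power_increasing) auto
    then have "(2::real) ^ j\<^sup>2 * 4 ^ m \<le> 2 * 2 ^ m\<^sup>2" by (simp add: power_add power_mult)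
    then have le: "pi / 2 ^ m\<^sup>2 * 2 ^ j\<^sup>2 \<le> 2 * pi / 4 ^ m" by (simp add: field_simps)
    have "cmod (f j) \<le> cmod (b j / 2 ^ j) * (pi / 2 ^ m\<^sup>2 * 2 ^ j\<^sup>2)"
      unfolding f_def norm_mult
      by (intro mult_left_mono order_trans[OF cmod_cis_diff_one_le]) (auto simp: abs_mult)
    also have "\<dots> \<le> B / 2 ^ j * (2 * pi / 4 ^ m)"
      using b[of j] B by (intro mult_mono le) (auto simp: norm_divide norm_power divide_right_mono)
    finally show ?thesis by (simp add: mult_ac)
  qed
  have "(\<Sum>j<N. f j) = (\<Sum>j<Suc m. f j)"
    using m large by (intro sum.mono_neutral_right) auto
  then have sum: "character_value (pi / 2 ^ m\<^sup>2) (lacunary_partial n b N) = (\<Sum>j<m. f j) + f m"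
    unfolding character_value_lacunary_partial[OF n] by (simp add: f_def)
  have "cmod (\<Sum>j<m. f j) \<le> (\<Sum>j<m. 2 * pi * B / 4 ^ m * (1 / 2 ^ j))"
    by (rule order_trans[OF norm_sum sum_mono]) (use small in auto)
  also have "\<dots> = 2 * pi * B / 4 ^ m * (\<Sum>j\<in>{0..<m}. 1 / 2 ^ j)"
    by (simp only: sum_distrib_left atLeast0LessThan)
  also have "\<dots> \<le> 2 * pi * B / 4 ^ m * (2 / 2 ^ 0)"
    using B by (intro mult_left_mono sum_half_powers_le) auto
  finally have "cmod (\<Sum>j<m. f j) \<le> 4 * pi * B / 4 ^ m" by simp
  then show ?thesis
    unfolding sum mid[symmetric] using norm_triangle_ineq4[of "(\<Sum>j<m. f j) + f m" "\<Sum>j<m. f j"] by simp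
qed

lemma tendsto_zero_comparison:
  fixes f :: "'a \<Rightarrow> 'b::real_normed_vector"
  assumes "\<forall>\<^sub>F x in F. norm (f x) \<le> g x" "(g \<longlongrightarrow> 0) F"
  shows "(f \<longlongrightarrow> 0) F"
proof (rule tendsto_0_le[OF assms(2), where K = 1])
  show "\<forall>\<^sub>F x in F. norm (f x) \<le> norm (g x) * 1"
    using assms(1) by (rule eventually_mono) simp
qed

lemma lacunary_coefficients_tendsto_zero:
  fixes n :: nat
  defines "G \<equiv> free_abelian_group_of_rank n"
  assumes n: "0 < n" and b: "\<And>j. cmod (b j) \<le> B"
    and c: "c \<in> carrier (group_ring G)" "pairing c (\<lambda>g. 1) = 1"
    and span: "(\<lambda>\<beta>. convolution G (\<lambda>g. of_int (c g)) (lacunary_operator n b \<beta>))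
      \<in> span_multiples (difference_element n) (integral_module (cstar_action G) (cstar_red G)) n"
  shows "b \<longlonglongrightarrow> 0"
proof -
  note grp = group_free_abelian[of n, folded G_def]
  have comm: "comm_group G" by (simp add: G_def comm_group_free_abelian)
  have B: "B \<ge> 0" using b[of 0] norm_ge_zero order_trans by blast
  define x where "x i g = (of_int (difference_element n i g) :: complex)" for i g
  define cc where "cc g = (of_int (c g) :: complex)" for g
  define A where "A = (\<Sum>h | cc h \<noteq> 0. cmod (cc h))"
  define T where "T \<beta> = convolution G cc (lacunary_operator n b \<beta>)" for \<beta>
  have dR: "difference_element n i \<in> carrier (group_ring G)" for i
    by (simp add: G_def difference_element_closed)
  have xR: "x i \<in> carrier (group_ring G)" for i
    using of_int_closed[OF grp dR[of i]] by (simp add: x_def[abs_def])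
  have ccR: "cc \<in> carrier (group_ring G)"
    using of_int_closed[OF grp c(1)] by (simp add: cc_def[abs_def])
  have A: "A \<ge> 0" by (simp add: A_def sum_nonneg)
  have L: "lacunary_operator n b \<in> carrier (cstar_red G)"
    unfolding G_def by (rule lacunary_operator_cstar[OF b])
  obtain C where C: "C \<ge> 0" "\<And>\<beta>. \<beta> \<in> l2_space G \<Longrightarrow> l2_norm G (T \<beta>) \<le> C * (\<Sum>i<n. l2_norm G (convolution G (x i) \<beta>))"
    using span_multiples_dominated[OF comm dR span] unfolding T_def cc_def[abs_def] x_def[abs_def] by blast
  have T_l2: "T \<beta> \<in> l2_space G" for \<beta>
    unfolding T_def by (intro l2_convolution(1)[OF grp ccR] cstar_red_range[OF grp L])
  have close: "l2_norm G (\<lambda>g. T \<beta> g - convolution G (convolution G cc (lacunary_partial n b N)) \<beta> g)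
      \<le> 4 * A * B / 2 ^ N * l2_norm G \<beta>" if \<beta>: "\<beta> \<in> l2_space G" for \<beta> N
  proof -
    note p = lacunary_partial_closed[of n b N, folded G_def]
    note approx = lacunary_operator_approx(2,3)[OF b \<beta>[unfolded G_def], where N = N, folded G_def]
    have "(\<lambda>g. T \<beta> g - convolution G (convolution G cc (lacunary_partial n b N)) \<beta> g)
        = convolution G cc (\<lambda>g. lacunary_operator n b \<beta> g - convolution G (lacunary_partial n b N) \<beta> g)"
      using convolution_linear(1)[OF grp, of cc "lacunary_operator n b \<beta>" "\<lambda>g. - 1 * convolution G (lacunary_partial n b N) \<beta> g"]
        convolution_linear(2)[OF grp, of cc "-1" "convolution G (lacunary_partial n b N) \<beta>"]
      by (simp add: T_def convolution_assoc[OF grp ccR p])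
    then have "l2_norm G (\<lambda>g. T \<beta> g - convolution G (convolution G cc (lacunary_partial n b N)) \<beta> g)
        \<le> A * l2_norm G (\<lambda>g. lacunary_operator n b \<beta> g - convolution G (lacunary_partial n b N) \<beta> g)"
      using l2_convolution(2)[OF grp ccR approx(1)] by (simp add: A_def)
    also have "\<dots> \<le> A * (4 * B / 2 ^ N * l2_norm G \<beta>)"
      by (intro mult_left_mono approx(2) A)
    finally show ?thesis by (simp add: mult_ac)
  qed
  have "(\<Sum>i<n. cmod (character_value t (x i))) \<le> \<bar>t\<bar>" for t
  proof -
    have "character_value t (x i) = cis (- t * of_int (generator n i 0)) - 1" for i
    proof -
      have "x i = (\<lambda>g. unit_mass (generator n i) g - unit_mass (\<lambda>k\<in>{..<n}. 0) g)"
        by (auto simp: x_def difference_element_def unit_mass_def fun_eq_iff)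
      then show ?thesis unfolding character_value_def using n by (simp add: pairing_unit_mass_diff)
    qed
    then have "(\<Sum>i<n. cmod (character_value t (x i))) = (\<Sum>i<n. if i = 0 then cmod (cis (- t) - 1) else 0)"
      using n by (intro sum.cong) (auto simp: generator_def)
    also have "\<dots> = cmod (cis (- t) - 1)" using n by (simp add: sum.delta)
    finally show ?thesis using cmod_cis_diff_one_le[of "- t"] by simp
  qed
  note x_sum = this
  define \<tau> where "\<tau> m = pi / 2 ^ m\<^sup>2" for m :: nat
  \<comment> \<open>From index \<open>m + 1\<close> on, the values of the partial sums at the frequency \<open>\<tau> m\<close> do not change, while the
    distance of the partial sums from the operator tends to zero.\<close>
  have estimate: "cmod (character_value (\<tau> m) cc) * (2 * cmod (b m) / 2 ^ m - 4 * pi * B / 4 ^ m) \<le> C * \<tau> m" for m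
  proof (rule LIMSEQ_le_const)
    show "(\<lambda>N. C * \<tau> m + 4 * A * B / 2 ^ N) \<longlonglongrightarrow> C * \<tau> m"
    proof -
      have "(\<lambda>N. C * \<tau> m + 4 * A * B * (1 / 2) ^ N) \<longlonglongrightarrow> C * \<tau> m + 4 * A * B * 0"
        by (intro tendsto_intros LIMSEQ_power_zero) simp
      then show ?thesis by (simp add: power_one_over)
    qed
    have "cmod (character_value (\<tau> m) cc) * (2 * cmod (b m) / 2 ^ m - 4 * pi * B / 4 ^ m)
        \<le> C * \<tau> m + 4 * A * B / 2 ^ N" if "N \<ge> Suc m" for N
    proof -
      note p = lacunary_partial_closed[of n b N, folded G_def]
      have "cmod (character_value (\<tau> m) (convolution G cc (lacunary_partial n b N)))
          \<le> C * (\<Sum>i<n. cmod (character_value (\<tau> m) (x i))) + 4 * A * B / 2 ^ N"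
        by (rule character_value_bound[OF n, folded G_def, where T = T])
          (use xR T_l2 close C convolution_closed[OF grp ccR p] in auto)
      also have "\<dots> \<le> C * \<tau> m + 4 * A * B / 2 ^ N"
        using mult_left_mono[OF x_sum[of "\<tau> m"] C(1)] by (simp add: \<tau>_def)
      finally have "cmod (character_value (\<tau> m) cc) * cmod (character_value (\<tau> m) (lacunary_partial n b N))
          \<le> C * \<tau> m + 4 * A * B / 2 ^ N"
        using character_value_convolution[OF n ccR[unfolded G_def] p[unfolded G_def]]
        by (simp add: G_def norm_mult)
      moreover have "2 * cmod (b m) / 2 ^ m - 4 * pi * B / 4 ^ m
          \<le> cmod (character_value (\<tau> m) (lacunary_partial n b N))"
        unfolding \<tau>_def using that by (intro lacunary_partial_lower_bound n b) simp
      ultimately show ?thesis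
        using mult_left_mono[OF _ norm_ge_zero[of "character_value (\<tau> m) cc"]] order_trans by blast
    qed
    then show "\<exists>K. \<forall>N\<ge>K. cmod (character_value (\<tau> m) cc) * (2 * cmod (b m) / 2 ^ m - 4 * pi * B / 4 ^ m)
        \<le> C * \<tau> m + 4 * A * B / 2 ^ N" by blast
  qed
  have \<tau>_le: "\<tau> m \<le> pi / 4 ^ m" if "m \<ge> 2" for m
  proof -
    have "2 * m \<le> m\<^sup>2" using that by (simp add: power2_eq_square)
    then have "(2::real) ^ (2 * m) \<le> 2 ^ m\<^sup>2" by (intro power_increasing) auto
    then show ?thesis by (simp add: \<tau>_def power_mult frac_le)
  qed
  have half_zero: "(\<lambda>m. K / 2 ^ m :: real) \<longlonglongrightarrow> 0" for K
    using tendsto_mult_right_zero[OF LIMSEQ_power_zero[of "1 / 2 :: real"], of K] by (simp add: power_one_over)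
  have \<tau>_zero: "\<tau> \<longlonglongrightarrow> 0"
  proof (rule tendsto_zero_comparison[OF _ half_zero[of pi]])
    show "\<forall>\<^sub>F m in sequentially. norm (\<tau> m) \<le> pi / 2 ^ m"
      using eventually_ge_at_top[of 2]
    proof eventually_elim
      case (elim m)
      have "pi / 4 ^ m \<le> pi / 2 ^ m" by (intro divide_left_mono power_mono) auto
      then show ?case using \<tau>_le[OF elim] by (simp add: \<tau>_def)
    qed
  qed
  have "(\<lambda>m. character_value (\<tau> m) cc) \<longlonglongrightarrow> 1"
  proof -
    have "(\<lambda>m. cis (- \<tau> m * of_int (h 0))) \<longlonglongrightarrow> 1" for h :: "nat \<Rightarrow> int"
    proof -
      have "(\<lambda>m. cis (- \<tau> m * of_int (h 0)) - 1) \<longlonglongrightarrow> 0"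
      proof (rule tendsto_zero_comparison)
        show "\<forall>\<^sub>F m in sequentially. norm (cis (- \<tau> m * of_int (h 0)) - 1) \<le> \<bar>\<tau> m * of_int (h 0)\<bar>"
          by (intro always_eventually allI order_trans[OF cmod_cis_diff_one_le]) simp
        show "(\<lambda>m. \<bar>\<tau> m * of_int (h 0)\<bar>) \<longlonglongrightarrow> 0"
          by (intro tendsto_rabs_zero tendsto_mult_left_zero \<tau>_zero)
      qed
      then show ?thesis by (simp add: LIM_zero_iff)
    qed
    then have "(\<lambda>m. character_value (\<tau> m) cc) \<longlonglongrightarrow> (\<Sum>h | cc h \<noteq> 0. cc h * 1)"
      unfolding character_value_def pairing_def by (intro tendsto_intros)
    moreover have "(\<Sum>h | cc h \<noteq> 0. cc h * 1) = of_int (pairing c (\<lambda>g. 1))"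
      by (simp add: cc_def pairing_def)
    ultimately show ?thesis using c(2) by simp
  qed
  then have "(\<lambda>m. cmod (character_value (\<tau> m) cc)) \<longlonglongrightarrow> 1"
    using tendsto_norm by fastforce
  then have half: "\<forall>\<^sub>F m in sequentially. 1 / 2 < cmod (character_value (\<tau> m) cc)"
    by (rule order_tendstoD) simp
  show ?thesis
  proof (rule tendsto_zero_comparison[OF _ half_zero[of "pi * (2 * B + C)"]])
    show "\<forall>\<^sub>F m in sequentially. norm (b m) \<le> pi * (2 * B + C) / 2 ^ m"
      using half eventually_ge_at_top[of 2]
    proof eventually_elim
      case (elim m)
      let ?q = "2 * cmod (b m) / 2 ^ m - 4 * pi * B / 4 ^ m"
      have "1 / 2 * ?q \<le> C * (pi / 4 ^ m)"
      proof (cases "?q \<ge> 0")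
        case True
        have "1 / 2 * ?q \<le> cmod (character_value (\<tau> m) cc) * ?q"
          using elim(1) True by (intro mult_right_mono) auto
        also have "\<dots> \<le> C * \<tau> m" by (rule estimate)
        also have "\<dots> \<le> C * (pi / 4 ^ m)" by (intro mult_left_mono \<tau>_le elim C)
        finally show ?thesis .
      next
        case False
        then have "1 / 2 * ?q \<le> 0" by simp
        also have "0 \<le> C * (pi / 4 ^ m)" using C(1) by simp
        finally show ?thesis .
      qed
      moreover have "1 / 2 * ?q = cmod (b m) / 2 ^ m - 2 * pi * B / 4 ^ m"
        by (simp add: diff_divide_distrib)
      ultimately have "cmod (b m) / 2 ^ m \<le> 2 * pi * B / 4 ^ m + C * (pi / 4 ^ m)"
        by linarith
      also have "\<dots> = pi * (2 * B + C) / 4 ^ m"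
        by (simp add: add_divide_distrib distrib_left mult_ac)
      finally have "cmod (b m) / 2 ^ m \<le> pi * (2 * B + C) / 4 ^ m" .
      then have "cmod (b m) / 2 ^ m * 2 ^ m \<le> pi * (2 * B + C) / 4 ^ m * 2 ^ m"
        by (rule mult_right_mono) simp
      moreover have "(4::real) ^ m = 2 ^ m * 2 ^ m" by (simp add: power_mult_distrib[symmetric])
      ultimately show ?case by simp
    qed
  qed
qed

section \<open>Quotient spaces and infinite dimension\<close>

lemma submodule_additive_subgroup:
  assumes "submodule R W V"
  shows "abelian_subgroup W V"
proof -
  interpret submodule R W V by fact
  interpret module R V by (rule module)
  have "\<ominus>\<^bsub>V\<^esub> w \<in> W" if "w \<in> W" for w
  proof -
    have "(\<ominus>\<^bsub>R\<^esub> \<one>\<^bsub>R\<^esub>) \<odot>\<^bsub>V\<^esub> w \<in> W" using that by simp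
    moreover have "(\<ominus>\<^bsub>R\<^esub> \<one>\<^bsub>R\<^esub>) \<odot>\<^bsub>V\<^esub> w = \<ominus>\<^bsub>V\<^esub> w"
      using that subset by (intro smult_minus_1) auto
    ultimately show ?thesis by (simp only:)
  qed
  moreover have "W \<noteq> {}" using submodule.zero_closed[OF assms] by blast
  ultimately have "subgroup W (add_monoid V)"
    using subset by (intro M.add.subgroupI) (auto simp: a_inv_def[symmetric])
  then show ?thesis
    by (intro abelian_subgroupI3 additive_subgroup.intro M.abelian_group_axioms)
qed

context
  fixes R :: "('r, 's) ring_scheme" and V :: "('r, 'v) module" and W
  assumes W: "submodule R W V"
begin

interpretation W: submodule R W V by (fact W)
interpretation V: module R V by (rule W.module)
interpretation A: abelian_subgroup W V by (rule submodule_additive_subgroup[OF W])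

lemma quotient_space_carrier:
  "carrier (quotient_space V W) = {W +>\<^bsub>V\<^esub> x | x. x \<in> carrier V}"
  by (auto simp: quotient_space_def A_RCOSETS_def')

lemma quotient_space_zero: "\<zero>\<^bsub>quotient_space V W\<^esub> = W"
  by (simp add: quotient_space_def)

lemma quotient_space_coset_eq_zero:
  assumes "x \<in> carrier V"
  shows "W +>\<^bsub>V\<^esub> x = W \<longleftrightarrow> x \<in> W"
  using A.a_rcos_self[OF assms] V.M.a_coset_join2[OF assms] A.a_subgroup by auto

lemma quotient_space_add:
  assumes "x \<in> carrier V" "y \<in> carrier V"
  shows "(W +>\<^bsub>V\<^esub> x) \<oplus>\<^bsub>quotient_space V W\<^esub> (W +>\<^bsub>V\<^esub> y) = W +>\<^bsub>V\<^esub> (x \<oplus>\<^bsub>V\<^esub> y)"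
  using A.a_rcos_sum[OF assms] by (simp add: quotient_space_def)

lemma quotient_space_smult:
  assumes c: "c \<in> carrier R" and x: "x \<in> carrier V"
  shows "c \<odot>\<^bsub>quotient_space V W\<^esub> (W +>\<^bsub>V\<^esub> x) = W +>\<^bsub>V\<^esub> (c \<odot>\<^bsub>V\<^esub> x)"
proof -
  have "W +>\<^bsub>V\<^esub> (c \<odot>\<^bsub>V\<^esub> y) = W +>\<^bsub>V\<^esub> (c \<odot>\<^bsub>V\<^esub> x)" if y: "y \<in> W +>\<^bsub>V\<^esub> x" for y
  proof -
    obtain w where w: "w \<in> W" "y = w \<oplus>\<^bsub>V\<^esub> x"
      using y by (auto simp: a_r_coset_def')
    have "c \<odot>\<^bsub>V\<^esub> y = c \<odot>\<^bsub>V\<^esub> w \<oplus>\<^bsub>V\<^esub> c \<odot>\<^bsub>V\<^esub> x"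
      using w c x W.subset by (simp add: V.smult_r_distr subset_iff)
    moreover have "c \<odot>\<^bsub>V\<^esub> w \<in> W" using w c by simp
    ultimately have "c \<odot>\<^bsub>V\<^esub> y \<in> W +>\<^bsub>V\<^esub> (c \<odot>\<^bsub>V\<^esub> x)" by (auto simp: a_r_coset_def')
    then show ?thesis
      using V.M.a_repr_independence[of "c \<odot>\<^bsub>V\<^esub> y" W "c \<odot>\<^bsub>V\<^esub> x"] A.a_subgroup c x by simp
  qed
  moreover have "x \<in> W +>\<^bsub>V\<^esub> x" by (rule A.a_rcos_self[OF x])
  ultimately have "(\<Union>y \<in> W +>\<^bsub>V\<^esub> x. W +>\<^bsub>V\<^esub> (c \<odot>\<^bsub>V\<^esub> y)) = W +>\<^bsub>V\<^esub> (c \<odot>\<^bsub>V\<^esub> x)" by blast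
  then show ?thesis by (simp add: quotient_space_def)
qed

lemma module_quotient_space: "module R (quotient_space V W)"
proof -
  let ?Q = "quotient_space V W"
  have zero: "\<zero>\<^bsub>?Q\<^esub> = W +>\<^bsub>V\<^esub> \<zero>\<^bsub>V\<^esub>"
    using quotient_space_coset_eq_zero[of "\<zero>\<^bsub>V\<^esub>"] by (simp add: quotient_space_zero)
  have "abelian_group ?Q"
  proof (rule abelian_groupI)
    fix A assume "A \<in> carrier ?Q"
    then obtain x where x: "x \<in> carrier V" "A = W +>\<^bsub>V\<^esub> x" by (auto simp: quotient_space_carrier)
    have "(W +>\<^bsub>V\<^esub> (\<ominus>\<^bsub>V\<^esub> x)) \<oplus>\<^bsub>?Q\<^esub> A = \<zero>\<^bsub>?Q\<^esub>"
      using x by (simp add: quotient_space_add zero V.M.l_neg)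
    then show "\<exists>B\<in>carrier ?Q. B \<oplus>\<^bsub>?Q\<^esub> A = \<zero>\<^bsub>?Q\<^esub>"
      using x by (intro bexI[of _ "W +>\<^bsub>V\<^esub> (\<ominus>\<^bsub>V\<^esub> x)"]) (auto simp: quotient_space_carrier)
    show "\<zero>\<^bsub>?Q\<^esub> \<oplus>\<^bsub>?Q\<^esub> A = A"
      using x by (simp add: zero quotient_space_add)
  next
    show "\<zero>\<^bsub>?Q\<^esub> \<in> carrier ?Q" unfolding zero by (auto simp: quotient_space_carrier)
  next
    fix A B assume "A \<in> carrier ?Q" "B \<in> carrier ?Q"
    then obtain x y where x: "x \<in> carrier V" "A = W +>\<^bsub>V\<^esub> x" and y: "y \<in> carrier V" "B = W +>\<^bsub>V\<^esub> y"
      by (auto simp: quotient_space_carrier)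
    show "A \<oplus>\<^bsub>?Q\<^esub> B \<in> carrier ?Q"
      using x y by (auto simp: quotient_space_add) (auto simp: quotient_space_carrier)
    show "A \<oplus>\<^bsub>?Q\<^esub> B = B \<oplus>\<^bsub>?Q\<^esub> A"
      using x y by (simp add: quotient_space_add V.M.a_comm)
    fix C assume "C \<in> carrier ?Q"
    then obtain z where z: "z \<in> carrier V" "C = W +>\<^bsub>V\<^esub> z" by (auto simp: quotient_space_carrier)
    show "A \<oplus>\<^bsub>?Q\<^esub> B \<oplus>\<^bsub>?Q\<^esub> C = A \<oplus>\<^bsub>?Q\<^esub> (B \<oplus>\<^bsub>?Q\<^esub> C)"
      using x y z by (simp add: quotient_space_add V.M.a_assoc)
  qed
  then show ?thesis
  proof (rule moduleI[OF V.R.cring_axioms])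
    fix a A assume a: "a \<in> carrier R" and "A \<in> carrier ?Q"
    then obtain x where x: "x \<in> carrier V" "A = W +>\<^bsub>V\<^esub> x" by (auto simp: quotient_space_carrier)
    show "a \<odot>\<^bsub>?Q\<^esub> A \<in> carrier ?Q"
      using a x by (auto simp: quotient_space_smult) (auto simp: quotient_space_carrier)
    show "(a \<oplus>\<^bsub>R\<^esub> b) \<odot>\<^bsub>?Q\<^esub> A = a \<odot>\<^bsub>?Q\<^esub> A \<oplus>\<^bsub>?Q\<^esub> b \<odot>\<^bsub>?Q\<^esub> A" if "b \<in> carrier R" for b
      using a x that by (simp add: quotient_space_smult quotient_space_add V.smult_l_distr)
    show "(a \<otimes>\<^bsub>R\<^esub> b) \<odot>\<^bsub>?Q\<^esub> A = a \<odot>\<^bsub>?Q\<^esub> (b \<odot>\<^bsub>?Q\<^esub> A)" if "b \<in> carrier R" for b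
      using a x that by (simp add: quotient_space_smult V.smult_assoc1)
    show "a \<odot>\<^bsub>?Q\<^esub> (A \<oplus>\<^bsub>?Q\<^esub> B) = a \<odot>\<^bsub>?Q\<^esub> A \<oplus>\<^bsub>?Q\<^esub> a \<odot>\<^bsub>?Q\<^esub> B" if B: "B \<in> carrier ?Q" for B
    proof -
      obtain y where y: "y \<in> carrier V" "B = W +>\<^bsub>V\<^esub> y" using B by (auto simp: quotient_space_carrier)
      show ?thesis
        using a x y by (simp add: quotient_space_smult quotient_space_add V.smult_r_distr)
    qed
  next
    fix A assume "A \<in> carrier ?Q"
    then obtain x where x: "x \<in> carrier V" "A = W +>\<^bsub>V\<^esub> x" by (auto simp: quotient_space_carrier)
    show "\<one>\<^bsub>R\<^esub> \<odot>\<^bsub>?Q\<^esub> A = A"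
      using x by (simp add: quotient_space_smult)
  qed
qed

end

text \<open>
  A vector space into which the bounded sequences map linearly, with a kernel consisting of null
  sequences, has infinite dimension: it contains the independent images of the indicator functions
  of the members of a partition of the natural numbers into infinitely many infinite sets.
\<close>

lemma infinite_dimensional_if_bounded_sequences:
  fixes V :: "(complex, 'v, 't) module_scheme" and \<Psi> :: "(nat \<Rightarrow> complex) \<Rightarrow> 'v"
  assumes V: "module complex_field V"
    and closed: "\<And>b. Bseq b \<Longrightarrow> \<Psi> b \<in> carrier V"
    and add: "\<And>a b. Bseq a \<Longrightarrow> Bseq b \<Longrightarrow> \<Psi> (\<lambda>m. a m + b m) = \<Psi> a \<oplus>\<^bsub>V\<^esub> \<Psi> b"
    and scale: "\<And>c b. Bseq b \<Longrightarrow> \<Psi> (\<lambda>m. c * b m) = c \<odot>\<^bsub>V\<^esub> \<Psi> b"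
    and kernel: "\<And>b. Bseq b \<Longrightarrow> \<Psi> b = \<zero>\<^bsub>V\<^esub> \<Longrightarrow> b \<longlonglongrightarrow> 0"
  shows "infinite_dimensional complex_field V"
proof -
  interpret module complex_field V by (fact V)
  interpret V: vectorspace complex_field V
    by (intro vectorspace.intro V field_from_type_algebra)
  define e :: "nat \<Rightarrow> nat \<Rightarrow> complex" where "e k m = (if fst (prod_decode m) = k then 1 else 0)" for k m
  have e_bounded: "Bseq (e k)" for k by (intro BseqI'[of _ 1]) (simp add: e_def)
  have sum_bounded: "Bseq (\<lambda>m. \<Sum>k\<in>F. a k * e k m)" for F a
  proof (rule BseqI')
    show "cmod (\<Sum>k\<in>F. a k * e k m) \<le> (\<Sum>k\<in>F. cmod (a k))" for m
      by (rule order_trans[OF norm_sum sum_mono]) (simp add: e_def norm_mult)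
  qed
  have \<Psi>_sum: "\<Psi> (\<lambda>m. \<Sum>k\<in>F. a k * e k m) = (\<Oplus>\<^bsub>V\<^esub>k\<in>F. a k \<odot>\<^bsub>V\<^esub> \<Psi> (e k))" if "finite F" for F a
    using that
  proof (induction F rule: finite_induct)
    case empty
    have "\<Psi> (\<lambda>m. 0 * e 0 m) = \<zero>\<^bsub>complex_field\<^esub> \<odot>\<^bsub>V\<^esub> \<Psi> (e 0)"
      using scale[OF e_bounded, of 0 0] by simp
    also have "\<dots> = \<zero>\<^bsub>V\<^esub>" by (rule lmult_0[OF closed[OF e_bounded]])
    finally show ?case by simp
  next
    case (insert k F)
    have "Bseq (\<lambda>m. a k * e k m)" using sum_bounded[of a "{k}"] by simp
    from add[OF this sum_bounded[of a F]] insert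
    have "\<Psi> (\<lambda>m. \<Sum>k\<in>insert k F. a k * e k m)
        = a k \<odot>\<^bsub>V\<^esub> \<Psi> (e k) \<oplus>\<^bsub>V\<^esub> (\<Oplus>\<^bsub>V\<^esub>k\<in>F. a k \<odot>\<^bsub>V\<^esub> \<Psi> (e k))"
      by (simp add: scale[OF e_bounded])
    also have "\<dots> = (\<Oplus>\<^bsub>V\<^esub>k\<in>insert k F. a k \<odot>\<^bsub>V\<^esub> \<Psi> (e k))"
      using insert by (intro finsum_insert[symmetric])
        (auto intro!: smult_closed closed e_bounded)
    finally show ?case .
  qed
  have independent: "a k = 0"
    if F: "finite F" and 0: "(\<Oplus>\<^bsub>V\<^esub>k\<in>F. a k \<odot>\<^bsub>V\<^esub> \<Psi> (e k)) = \<zero>\<^bsub>V\<^esub>" and k: "k \<in> F" for F a k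
  proof -
    have lim: "(\<lambda>m. \<Sum>k\<in>F. a k * e k m) \<longlonglongrightarrow> 0"
      by (rule kernel[OF sum_bounded]) (simp add: \<Psi>_sum F 0)
    have "filterlim (\<lambda>l. prod_encode (k, l)) at_top at_top"
      by (rule filterlim_at_top_mono[OF filterlim_ident]) (simp add: le_prod_encode_2)
    from filterlim_compose[OF lim this]
    have "(\<lambda>l. \<Sum>k'\<in>F. a k' * e k' (prod_encode (k, l))) \<longlonglongrightarrow> 0" .
    moreover have "(\<Sum>k'\<in>F. a k' * e k' (prod_encode (k, l))) = a k" for l
      using F k by (simp add: e_def if_distrib[of "\<lambda>x. _ * x"] sum.delta' cong: if_cong)
    ultimately show "a k = 0" by (simp add: LIMSEQ_const_iff)
  qed
  have inj: "inj (\<lambda>k. \<Psi> (e k))"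
  proof (rule injI, rule ccontr)
    fix k l assume eq: "\<Psi> (e k) = \<Psi> (e l)" and "k \<noteq> l"
    define a :: "nat \<Rightarrow> complex" where "a i = (if i = k then 1 else - 1)" for i
    have "(\<lambda>m. \<Sum>i\<in>{k, l}. a i * e i m) = (\<lambda>m. e k m + - 1 * e l m)"
      using \<open>k \<noteq> l\<close> by (simp add: a_def fun_eq_iff)
    moreover have "Bseq (\<lambda>m. - 1 * e l m)" using sum_bounded[of "\<lambda>_. - 1" "{l}"] by simp
    ultimately have "(\<Oplus>\<^bsub>V\<^esub>i\<in>{k, l}. a i \<odot>\<^bsub>V\<^esub> \<Psi> (e i)) = \<Psi> (e k) \<oplus>\<^bsub>V\<^esub> (- 1) \<odot>\<^bsub>V\<^esub> \<Psi> (e l)"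
      using \<Psi>_sum[of "{k, l}" a] add[OF e_bounded, of "\<lambda>m. - 1 * e l m" k] scale[OF e_bounded, of "- 1" l] by simp
    also have "\<dots> = \<Psi> (\<lambda>m. e l m + - 1 * e l m)"
      using add[OF e_bounded \<open>Bseq (\<lambda>m. - 1 * e l m)\<close>, of l] scale[OF e_bounded, of "- 1" l] eq by simp
    also have "\<dots> = \<zero>\<^bsub>V\<^esub>" using \<Psi>_sum[of "{}" a] by simp
    finally have "a k = 0" by (intro independent[of "{k, l}"]) auto
    then show False by (simp add: a_def)
  qed
  have "\<not> lin_dep (range (\<lambda>k. \<Psi> (e k)))"
  proof
    assume "lin_dep (range (\<lambda>k. \<Psi> (e k)))"
    then obtain A a v where A: "finite A" "A \<subseteq> range (\<lambda>k. \<Psi> (e k))"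
      and 0: "(\<Oplus>\<^bsub>V\<^esub>x\<in>A. a x \<odot>\<^bsub>V\<^esub> x) = \<zero>\<^bsub>V\<^esub>" and v: "v \<in> A" "a v \<noteq> 0"
      by (auto simp: lin_dep_def lincomb_def)
    define F where "F = (\<lambda>k. \<Psi> (e k)) -` A"
    have F: "finite F" unfolding F_def by (rule finite_vimageI[OF A(1) inj])
    have image: "(\<lambda>k. \<Psi> (e k)) ` F = A" using A(2) by (auto simp: F_def)
    have "(\<Oplus>\<^bsub>V\<^esub>k\<in>F. a (\<Psi> (e k)) \<odot>\<^bsub>V\<^esub> \<Psi> (e k)) = (\<Oplus>\<^bsub>V\<^esub>x\<in>(\<lambda>k. \<Psi> (e k)) ` F. a x \<odot>\<^bsub>V\<^esub> x)"
      using inj by (intro finsum_reindex[symmetric])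
        (auto intro!: smult_closed closed e_bounded inj_on_subset[OF inj])
    then have "(\<Oplus>\<^bsub>V\<^esub>k\<in>F. a (\<Psi> (e k)) \<odot>\<^bsub>V\<^esub> \<Psi> (e k)) = \<zero>\<^bsub>V\<^esub>" by (simp add: image 0)
    moreover obtain k where "k \<in> F" "v = \<Psi> (e k)" using v(1) image by auto
    ultimately have "a v = 0" using independent[OF F, of "\<lambda>k. a (\<Psi> (e k))"] by blast
    then show False using v(2) by simp
  qed
  moreover have "range (\<lambda>k. \<Psi> (e k)) \<subseteq> carrier V" using closed[OF e_bounded] by auto
  moreover have "infinite (range (\<lambda>k. \<Psi> (e k)))" using inj by (simp add: finite_image_iff)
  ultimately have "\<not> V.fin_dim" using V.fin_dim_li_fin by blast
  then show ?thesis by (simp add: infinite_dimensional_def V.vectorspace_axioms)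
qed

section \<open>Cohomology as a vector space\<close>

context
  fixes G :: "('g, 'x) monoid_scheme" and \<rho> :: "'g \<Rightarrow> 'v \<Rightarrow> 'v" and V :: "(complex, 'v) module"
  assumes V: "module complex_field V"
    and N: "left_module (group_ring G) (integral_module \<rho> V)"
    and commute: "\<forall>r \<in> carrier (group_ring G). \<forall>x \<in> carrier V. \<forall>c.
      r \<odot>\<^bsub>integral_module \<rho> V\<^esub> (c \<odot>\<^bsub>V\<^esub> x) = c \<odot>\<^bsub>V\<^esub> (r \<odot>\<^bsub>integral_module \<rho> V\<^esub> x)"
begin

interpretation V: module complex_field V by (fact V)
interpretation N: left_module "group_ring G" "integral_module \<rho> V" by (fact N)

lemma integral_module_simps:
  "carrier (integral_module \<rho> V) = carrier V"
  "\<zero>\<^bsub>integral_module \<rho> V\<^esub> = \<zero>\<^bsub>V\<^esub>"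
  "x \<oplus>\<^bsub>integral_module \<rho> V\<^esub> y = x \<oplus>\<^bsub>V\<^esub> y"
  by (simp_all add: integral_module_def)

lemma hom_space_carrier:
  "carrier (hom_space G \<rho> V Q)
    = lin_hom (group_ring G) Q (integral_module \<rho> V) \<inter> extensional (carrier Q)"
  by (simp add: hom_space_def)

lemma hom_space_simps:
  "\<zero>\<^bsub>hom_space G \<rho> V Q\<^esub> = (\<lambda>x \<in> carrier Q. \<zero>\<^bsub>V\<^esub>)"
  "f \<oplus>\<^bsub>hom_space G \<rho> V Q\<^esub> f' = (\<lambda>x \<in> carrier Q. f x \<oplus>\<^bsub>V\<^esub> f' x)"
  "c \<odot>\<^bsub>hom_space G \<rho> V Q\<^esub> f = (\<lambda>x \<in> carrier Q. c \<odot>\<^bsub>V\<^esub> f x)"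
  by (simp_all add: hom_space_def)

lemma hom_spaceI:
  assumes "left_module (group_ring G) Q" "f \<in> extensional (carrier Q)"
    "\<And>x. x \<in> carrier Q \<Longrightarrow> f x \<in> carrier V"
    "\<And>x y. x \<in> carrier Q \<Longrightarrow> y \<in> carrier Q \<Longrightarrow> f (x \<oplus>\<^bsub>Q\<^esub> y) = f x \<oplus>\<^bsub>V\<^esub> f y"
    "\<And>r x. r \<in> carrier (group_ring G) \<Longrightarrow> x \<in> carrier Q \<Longrightarrow>
      f (r \<odot>\<^bsub>Q\<^esub> x) = r \<odot>\<^bsub>integral_module \<rho> V\<^esub> f x"
  shows "f \<in> carrier (hom_space G \<rho> V Q)"
  using assms unfolding hom_space_carrier by (auto intro!: lin_homI simp: integral_module_simps)

lemma hom_spaceD: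
  assumes "f \<in> carrier (hom_space G \<rho> V Q)" "x \<in> carrier Q"
  shows "f x \<in> carrier V"
    and "y \<in> carrier Q \<Longrightarrow> f (x \<oplus>\<^bsub>Q\<^esub> y) = f x \<oplus>\<^bsub>V\<^esub> f y"
    and "r \<in> carrier (group_ring G) \<Longrightarrow> f (r \<odot>\<^bsub>Q\<^esub> x) = r \<odot>\<^bsub>integral_module \<rho> V\<^esub> f x"
proof -
  have f: "f \<in> lin_hom (group_ring G) Q (integral_module \<rho> V)"
    using assms(1) by (simp add: hom_space_carrier)
  show "f x \<in> carrier V"
    and "y \<in> carrier Q \<Longrightarrow> f (x \<oplus>\<^bsub>Q\<^esub> y) = f x \<oplus>\<^bsub>V\<^esub> f y"
    and "r \<in> carrier (group_ring G) \<Longrightarrow> f (r \<odot>\<^bsub>Q\<^esub> x) = r \<odot>\<^bsub>integral_module \<rho> V\<^esub> f x"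
    using lin_homD[OF f assms(2)] by (simp_all add: integral_module_simps)
qed

lemma hom_space_ext:
  assumes "f \<in> carrier (hom_space G \<rho> V Q)" "f' \<in> carrier (hom_space G \<rho> V Q)"
    and "\<And>x. x \<in> carrier Q \<Longrightarrow> f x = f' x"
  shows "f = f'"
  using assms unfolding hom_space_carrier by (auto intro: extensionalityI)

lemma module_hom_space:
  assumes Q: "left_module (group_ring G) Q"
  shows "module complex_field (hom_space G \<rho> V Q)" (is "module _ ?H")
proof -
  interpret Q: left_module "group_ring G" Q by fact
  have smult_closed: "c \<odot>\<^bsub>V\<^esub> x \<in> carrier V" if "x \<in> carrier V" for c x
    using V.smult_closed[OF _ that, of c] by simp
  have smult_r_distr: "c \<odot>\<^bsub>V\<^esub> (x \<oplus>\<^bsub>V\<^esub> y) = c \<odot>\<^bsub>V\<^esub> x \<oplus>\<^bsub>V\<^esub> c \<odot>\<^bsub>V\<^esub> y" if "x \<in> carrier V" "y \<in> carrier V" for c x y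
    using V.smult_r_distr[OF _ that, of c] by simp
  have add_closed: "f \<oplus>\<^bsub>?H\<^esub> f' \<in> carrier ?H" if "f \<in> carrier ?H" "f' \<in> carrier ?H" for f f'
    using that N.smult_r_distr N.smult_closed
    by (intro hom_spaceI Q) (auto simp: hom_space_simps hom_spaceD V.M.a_ac integral_module_simps)
  have scale_closed: "c \<odot>\<^bsub>?H\<^esub> f \<in> carrier ?H" if "f \<in> carrier ?H" for c f
    using that by (intro hom_spaceI Q) (auto simp: hom_space_simps hom_spaceD smult_closed smult_r_distr commute)
  have zero_closed: "\<zero>\<^bsub>?H\<^esub> \<in> carrier ?H"
    using N.smult_r_null by (intro hom_spaceI Q) (auto simp: hom_space_simps integral_module_simps)
  have "abelian_group ?H"
  proof (rule abelian_groupI)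
    fix f assume f: "f \<in> carrier ?H"
    have "(- 1) \<odot>\<^bsub>V\<^esub> x \<oplus>\<^bsub>V\<^esub> x = \<zero>\<^bsub>V\<^esub>" if x: "x \<in> carrier V" for x
      using V.smult_l_distr[of "- 1" 1 x] V.smult_one[OF x] V.lmult_0[OF x] x
      by simp
    then have "(- 1) \<odot>\<^bsub>?H\<^esub> f \<oplus>\<^bsub>?H\<^esub> f = \<zero>\<^bsub>?H\<^esub>"
      using f by (auto simp: hom_space_simps hom_spaceD restrict_def fun_eq_iff)
    then show "\<exists>f'\<in>carrier ?H. f' \<oplus>\<^bsub>?H\<^esub> f = \<zero>\<^bsub>?H\<^esub>" using scale_closed[OF f] by blast
    show "\<zero>\<^bsub>?H\<^esub> \<oplus>\<^bsub>?H\<^esub> f = f"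
      by (rule hom_space_ext[OF add_closed[OF zero_closed f] f]) (simp add: hom_space_simps hom_spaceD(1)[OF f])
  next
    fix f f' assume "f \<in> carrier ?H" "f' \<in> carrier ?H"
    then show "f \<oplus>\<^bsub>?H\<^esub> f' = f' \<oplus>\<^bsub>?H\<^esub> f"
      by (auto simp: hom_space_simps restrict_def fun_eq_iff hom_spaceD V.M.a_comm)
    fix f'' assume "f'' \<in> carrier ?H"
    then show "f \<oplus>\<^bsub>?H\<^esub> f' \<oplus>\<^bsub>?H\<^esub> f'' = f \<oplus>\<^bsub>?H\<^esub> (f' \<oplus>\<^bsub>?H\<^esub> f'')"
      using \<open>f \<in> carrier ?H\<close> \<open>f' \<in> carrier ?H\<close>
      by (auto simp: hom_space_simps restrict_def fun_eq_iff hom_spaceD V.M.a_assoc)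
  qed (rule add_closed zero_closed; assumption)+
  then show ?thesis
  proof (rule moduleI[OF cring_from_type_algebra])
    fix a b :: complex and f assume f: "f \<in> carrier ?H"
    show "(a \<oplus>\<^bsub>complex_field\<^esub> b) \<odot>\<^bsub>?H\<^esub> f = a \<odot>\<^bsub>?H\<^esub> f \<oplus>\<^bsub>?H\<^esub> b \<odot>\<^bsub>?H\<^esub> f"
      using f V.smult_l_distr[of a b]
      by (auto simp: hom_space_simps restrict_def fun_eq_iff hom_spaceD)
    show "(a \<otimes>\<^bsub>complex_field\<^esub> b) \<odot>\<^bsub>?H\<^esub> f = a \<odot>\<^bsub>?H\<^esub> (b \<odot>\<^bsub>?H\<^esub> f)"
      using f V.smult_assoc1[of a b]
      by (auto simp: hom_space_simps restrict_def fun_eq_iff hom_spaceD)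
  next
    fix c f f' assume f: "f \<in> carrier ?H" "f' \<in> carrier ?H"
    show "c \<odot>\<^bsub>?H\<^esub> (f \<oplus>\<^bsub>?H\<^esub> f') = c \<odot>\<^bsub>?H\<^esub> f \<oplus>\<^bsub>?H\<^esub> c \<odot>\<^bsub>?H\<^esub> f'"
      using f by (auto simp: hom_space_simps restrict_def fun_eq_iff hom_spaceD smult_r_distr)
  next
    fix f assume f: "f \<in> carrier ?H"
    show "\<one>\<^bsub>complex_field\<^esub> \<odot>\<^bsub>?H\<^esub> f = f"
      using V.smult_one[OF hom_spaceD(1)[OF f]] scale_closed[OF f, of 1]
      by (intro hom_space_ext[OF _ f]) (auto simp: hom_space_simps)
  qed (rule scale_closed)
qed

context
  fixes P :: "nat \<Rightarrow> ('g \<Rightarrow> int, 'p) module" and d \<epsilon>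
  assumes P: "\<And>k. left_module (group_ring G) (P k)"
    and d: "\<And>k. d k \<in> lin_hom (group_ring G) (P (Suc k)) (P k)"
    and dd: "\<forall>k. \<forall>y \<in> carrier (P (Suc (Suc k))). d k (d (Suc k) y) = \<zero>\<^bsub>P k\<^esub>"
begin

lemma hom_space_compose:
  assumes "f \<in> carrier (hom_space G \<rho> V (P k))"
  shows "(\<lambda>x \<in> carrier (P (Suc k)). f (d k x)) \<in> carrier (hom_space G \<rho> V (P (Suc k)))"
proof -
  interpret left_module "group_ring G" "P (Suc k)" by (rule P)
  show ?thesis
    using assms by (intro hom_spaceI P) (auto simp: lin_homD[OF d] hom_spaceD)
qed

lemma submodule_cocycles: "submodule complex_field (cocycles G P d \<rho> V k) (hom_space G \<rho> V (P k))"
proof -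
  interpret H: module complex_field "hom_space G \<rho> V (P k)" by (rule module_hom_space[OF P])
  interpret left_module "group_ring G" "P k" by (rule P)
  have smult_0: "c \<odot>\<^bsub>V\<^esub> \<zero>\<^bsub>V\<^esub> = \<zero>\<^bsub>V\<^esub>" for c
    using V.smult_r_null[of c] by simp
  show ?thesis
  proof
    show "v \<oplus>\<^bsub>hom_space G \<rho> V (P k)\<^esub> w \<in> cocycles G P d \<rho> V k"
      if "v \<in> cocycles G P d \<rho> V k" "w \<in> cocycles G P d \<rho> V k" for v w
      using that H.M.a_closed[of v w] unfolding cocycles_def by (auto simp: hom_space_simps lin_homD[OF d])
    show "\<zero>\<^bsub>hom_space G \<rho> V (P k)\<^esub> \<in> cocycles G P d \<rho> V k"
      using H.M.zero_closed unfolding cocycles_def by (auto simp: hom_space_simps lin_homD[OF d])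
    show "c \<odot>\<^bsub>hom_space G \<rho> V (P k)\<^esub> v \<in> cocycles G P d \<rho> V k"
      if "c \<in> carrier complex_field" "v \<in> cocycles G P d \<rho> V k" for c v
      using that H.smult_closed[of c v] unfolding cocycles_def
      by (auto simp: hom_space_simps lin_homD[OF d] smult_0)
  qed (auto simp: cocycles_def)
qed

lemma submodule_coboundaries:
  "submodule complex_field (coboundaries G P d \<rho> V (Suc k))
    ((hom_space G \<rho> V (P (Suc k)))\<lparr>carrier := cocycles G P d \<rho> V (Suc k)\<rparr>)"
proof -
  interpret H: module complex_field "hom_space G \<rho> V (P k)" by (rule module_hom_space[OF P])
  interpret H': module complex_field "hom_space G \<rho> V (P (Suc k))" by (rule module_hom_space[OF P])
  interpret left_module "group_ring G" "P k" by (rule P)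
  have zero: "f \<zero>\<^bsub>P k\<^esub> = \<zero>\<^bsub>V\<^esub>" if f: "f \<in> carrier (hom_space G \<rho> V (P k))" for f
    using hom_spaceD(3)[OF f zero_closed N.R.zero_closed] hom_spaceD(1)[OF f zero_closed] smult_l_null[OF zero_closed]
      N.smult_l_null[of "f \<zero>\<^bsub>P k\<^esub>"] by (simp add: integral_module_simps)
  let ?D = "\<lambda>f. \<lambda>x \<in> carrier (P (Suc k)). f (d k x)"
  have D: "?D f \<in> coboundaries G P d \<rho> V (Suc k)" if "f \<in> carrier (hom_space G \<rho> V (P k))" for f
    using that by (auto simp: coboundaries_def)
  show ?thesis
  proof (rule submodule.intro)
    show "module complex_field ((hom_space G \<rho> V (P (Suc k)))\<lparr>carrier := cocycles G P d \<rho> V (Suc k)\<rparr>)"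
      by (rule H'.submodule_is_module[OF submodule_cocycles])
    show "coboundaries G P d \<rho> V (Suc k)
        \<subseteq> carrier ((hom_space G \<rho> V (P (Suc k)))\<lparr>carrier := cocycles G P d \<rho> V (Suc k)\<rparr>)"
      using hom_space_compose by (auto simp: coboundaries_def cocycles_def lin_homD[OF d] dd zero)
  next
    fix v w assume "v \<in> coboundaries G P d \<rho> V (Suc k)" "w \<in> coboundaries G P d \<rho> V (Suc k)"
    then obtain f f' where f: "f \<in> carrier (hom_space G \<rho> V (P k))" "v = ?D f"
      and f': "f' \<in> carrier (hom_space G \<rho> V (P k))" "w = ?D f'" by (auto simp: coboundaries_def)
    have "v \<oplus>\<^bsub>hom_space G \<rho> V (P (Suc k))\<^esub> w = ?D (f \<oplus>\<^bsub>hom_space G \<rho> V (P k)\<^esub> f')"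
      by (auto simp: f f' hom_space_simps lin_homD[OF d] fun_eq_iff restrict_def)
    then show "v \<oplus>\<^bsub>(hom_space G \<rho> V (P (Suc k)))\<lparr>carrier := cocycles G P d \<rho> V (Suc k)\<rparr>\<^esub> w
        \<in> coboundaries G P d \<rho> V (Suc k)"
      using D[OF H.M.a_closed[OF f(1) f'(1)]] by simp
  next
    have "\<zero>\<^bsub>hom_space G \<rho> V (P (Suc k))\<^esub> = ?D \<zero>\<^bsub>hom_space G \<rho> V (P k)\<^esub>"
      by (auto simp: hom_space_simps lin_homD[OF d] fun_eq_iff restrict_def)
    then show "\<zero>\<^bsub>(hom_space G \<rho> V (P (Suc k)))\<lparr>carrier := cocycles G P d \<rho> V (Suc k)\<rparr>\<^esub>
        \<in> coboundaries G P d \<rho> V (Suc k)"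
      using D[OF H.M.zero_closed] by simp
  next
    fix c v assume c: "c \<in> carrier complex_field" and "v \<in> coboundaries G P d \<rho> V (Suc k)"
    then obtain f where f: "f \<in> carrier (hom_space G \<rho> V (P k))" "v = ?D f" by (auto simp: coboundaries_def)
    have "c \<odot>\<^bsub>hom_space G \<rho> V (P (Suc k))\<^esub> v = ?D (c \<odot>\<^bsub>hom_space G \<rho> V (P k)\<^esub> f)"
      by (auto simp: f hom_space_simps lin_homD[OF d] fun_eq_iff restrict_def)
    then show "c \<odot>\<^bsub>(hom_space G \<rho> V (P (Suc k)))\<lparr>carrier := cocycles G P d \<rho> V (Suc k)\<rparr>\<^esub> v
        \<in> coboundaries G P d \<rho> V (Suc k)"
      using D[OF H.smult_closed[OF c f(1)]] by simp
  qed
qed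

end

end

section \<open>The top cohomology\<close>

theorem theorem9:
  fixes n :: nat
    and P :: "nat \<Rightarrow> ((nat \<Rightarrow> int) \<Rightarrow> int, 'p) module"
    and d :: "nat \<Rightarrow> 'p \<Rightarrow> 'p"
    and \<epsilon> :: "'p \<Rightarrow> int"
  assumes "n \<ge> 1"
    and "projective_resolution (free_abelian_group_of_rank n) P d \<epsilon>"
  shows "infinite_dimensional complex_field
    (group_cohomology (free_abelian_group_of_rank n) P d
      (cstar_action (free_abelian_group_of_rank n)) (cstar_red (free_abelian_group_of_rank n)) n)"
proof -
  define G where "G = free_abelian_group_of_rank n"
  define \<rho> where "\<rho> = cstar_action G"
  define V where "V = cstar_red G"
  let ?R = "group_ring G :: ((nat \<Rightarrow> int) \<Rightarrow> int) ring"
  let ?x = "difference_element n"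
  let ?H = "hom_space G \<rho> V (P n)"
  obtain k where k: "n = Suc k" using assms(1) by (cases n) auto
  have n: "0 < n" using assms(1) by simp
  have comm: "comm_group G" by (simp add: G_def comm_group_free_abelian)
  note grp = group_free_abelian[of n, folded G_def]
  have res: "projective_resolution G P d \<epsilon>" using assms(2) by (simp add: G_def)
  have x: "?x i \<in> carrier ?R" "pairing (?x i) (\<lambda>g. 1) = 0" for i
    by (simp_all add: G_def difference_element_closed pairing_difference_element)
  obtain u where u: "\<And>j. u j \<in> carrier (P j)" "\<epsilon> (u 0) = 1"
    and du: "\<And>j. \<exists>w \<in> span_multiples ?x (P j) j. d j (u (Suc j)) = ?x j \<odot>\<^bsub>P j\<^esub> u j \<oplus>\<^bsub>P j\<^esub> w"
    using koszul_chain[where \<xi> = ?x, OF comm res x] by blast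
  obtain c where c: "c \<in> lin_hom ?R (P n) (regular_module G)"
    and cd: "\<And>y. y \<in> carrier (P (Suc n)) \<Longrightarrow> c (d n y) = (\<lambda>g. 0)"
    and aug: "pairing (c (u n)) (\<lambda>g. 1) = 1"
    using koszul_cocycle[OF res[unfolded G_def] u du] unfolding G_def by blast

  have V: "module complex_field V" unfolding V_def by (rule module_cstar_red[OF grp])
  have N: "left_module ?R (integral_module \<rho> V)"
    unfolding V_def \<rho>_def by (rule left_module_cstar[OF grp])
  have commute: "\<forall>r \<in> carrier ?R. \<forall>T \<in> carrier V. \<forall>a.
    r \<odot>\<^bsub>integral_module \<rho> V\<^esub> (a \<odot>\<^bsub>V\<^esub> T) = a \<odot>\<^bsub>V\<^esub> (r \<odot>\<^bsub>integral_module \<rho> V\<^esub> T)"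
  proof (intro ballI allI)
    fix r T a assume r: "r \<in> carrier ?R" and T: "T \<in> carrier V"
    show "r \<odot>\<^bsub>integral_module \<rho> V\<^esub> (a \<odot>\<^bsub>V\<^esub> T) = a \<odot>\<^bsub>V\<^esub> (r \<odot>\<^bsub>integral_module \<rho> V\<^esub> T)"
      using cstar_module_smult[OF grp r T[unfolded V_def]]
        cstar_module_smult[OF grp r cstar_red_scale[OF grp T[unfolded V_def], of a]]
      by (simp add: V_def \<rho>_def convolution_linear(2)[OF grp])
  qed
  have P: "left_module ?R (P j)" for j by (rule left_module_if_module[OF resolution_module[OF comm res]])
  note d = resolution_hom[OF comm res]
  have dd: "\<forall>k. \<forall>y \<in> carrier (P (Suc (Suc k))). d k (d (Suc k) y) = \<zero>\<^bsub>P k\<^esub>"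
    using resolution_complex(2)[OF comm res] by blast
  let ?Z = "?H\<lparr>carrier := cocycles G P d \<rho> V n\<rparr>"
  let ?B = "coboundaries G P d \<rho> V n"
  have W: "submodule complex_field ?B ?Z" unfolding k by (rule submodule_coboundaries[OF V N commute P d dd])
  have H_eq: "group_cohomology G P d \<rho> V n = quotient_space ?Z ?B" by (simp add: group_cohomology_def)

  \<comment> \<open>The cocycle \<open>y \<mapsto> c(y) T\<^sub>b\<close>.\<close>
  define F where "F b = (\<lambda>y \<in> carrier (P n). \<lambda>\<beta>. convolution G (\<lambda>g. of_int (c y g)) (lacunary_operator n b \<beta>))"
    for b
  have cR: "c y \<in> carrier ?R" if "y \<in> carrier (P n)" for y
    using lin_homD(1)[OF c that] by simp
  have L: "lacunary_operator n b \<in> carrier (cstar_red G)" if "Bseq b" for b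
    using that unfolding Bseq_def G_def by (auto intro: lacunary_operator_cstar)
  interpret Pn: left_module ?R "P n" by (rule P)
  have F_smult: "F b y = c y \<odot>\<^bsub>integral_module \<rho> V\<^esub> lacunary_operator n b"
    if "Bseq b" "y \<in> carrier (P n)" for b y
    using that cstar_module_smult[OF grp cR L] by (simp add: F_def V_def \<rho>_def)
  interpret N: left_module ?R "integral_module \<rho> V" by (rule N)
  have F_hom: "F b \<in> carrier ?H" if b: "Bseq b" for b
  proof (rule hom_spaceI[OF V N commute P])
    have L': "lacunary_operator n b \<in> carrier (integral_module \<rho> V)"
      using L[OF b] by (simp add: integral_module_def V_def)
    show "F b \<in> extensional (carrier (P n))" by (simp add: F_def)
    fix y assume y: "y \<in> carrier (P n)"
    show "F b y \<in> carrier V"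
      using N.smult_closed[OF cR[OF y] L'] F_smult[OF b y] by (simp add: integral_module_def)
    show "F b (y \<oplus>\<^bsub>P n\<^esub> z) = F b y \<oplus>\<^bsub>V\<^esub> F b z" if z: "z \<in> carrier (P n)" for z
      using N.smult_l_distr[OF cR[OF y] cR[OF z] L'] y z lin_homD(2)[OF c y z]
      by (simp add: F_smult b group_ring_simps integral_module_def)
    show "F b (r \<odot>\<^bsub>P n\<^esub> y) = r \<odot>\<^bsub>integral_module \<rho> V\<^esub> F b y" if r: "r \<in> carrier ?R" for r
      using N.smult_assoc1[OF r cR[OF y] L'] y r lin_homD(3)[OF c y r]
      by (simp add: F_smult b group_ring_simps pushforward_identity[OF r])
  qed
  have F_cocycle: "F b \<in> carrier ?Z" if b: "Bseq b" for b
    using F_hom[OF b] cd lin_homD(1)[OF d]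
    by (simp add: cocycles_def F_def V_def convolution_zero_left)

  show ?thesis
    unfolding G_def[symmetric] \<rho>_def[symmetric] V_def[symmetric] H_eq
  proof (rule infinite_dimensional_if_bounded_sequences[where \<Psi> = "\<lambda>b. ?B +>\<^bsub>?Z\<^esub> F b"])
    show "module complex_field (quotient_space ?Z ?B)"
      by (rule module_quotient_space[OF W])
    show "?B +>\<^bsub>?Z\<^esub> F b \<in> carrier (quotient_space ?Z ?B)" if "Bseq b" for b
      using F_cocycle[OF that] by (auto simp: quotient_space_carrier[OF W])
    show "?B +>\<^bsub>?Z\<^esub> F (\<lambda>m. a m + b m) =
        (?B +>\<^bsub>?Z\<^esub> F a) \<oplus>\<^bsub>quotient_space ?Z ?B\<^esub> (?B +>\<^bsub>?Z\<^esub> F b)" if a: "Bseq a" and b: "Bseq b" for a b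
    proof -
      obtain A B where AB: "\<And>m. cmod (a m) \<le> A" "\<And>m. cmod (b m) \<le> B"
        using a b unfolding Bseq_def by auto
      have "F (\<lambda>m. a m + b m) = F a \<oplus>\<^bsub>?H\<^esub> F b"
        unfolding hom_space_simps[OF V N commute] F_def lacunary_operator_add[OF AB]
        by (rule restrict_ext) (simp add: V_def convolution_linear(1)[OF grp])
      then have "F (\<lambda>m. a m + b m) = F a \<oplus>\<^bsub>?Z\<^esub> F b" by simp
      then show ?thesis
        by (simp only: quotient_space_add[OF W F_cocycle[OF a] F_cocycle[OF b]])
    qed
    show "?B +>\<^bsub>?Z\<^esub> F (\<lambda>m. s * b m) = s \<odot>\<^bsub>quotient_space ?Z ?B\<^esub> (?B +>\<^bsub>?Z\<^esub> F b)" if b: "Bseq b" for s b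
    proof -
      obtain B where B: "\<And>m. cmod (b m) \<le> B" using b unfolding Bseq_def by auto
      have "F (\<lambda>m. s * b m) = s \<odot>\<^bsub>?H\<^esub> F b"
        unfolding hom_space_simps[OF V N commute] F_def lacunary_operator_scale[OF B]
        by (rule restrict_ext) (simp add: V_def convolution_linear(2)[OF grp])
      then have "F (\<lambda>m. s * b m) = s \<odot>\<^bsub>?Z\<^esub> F b" by simp
      then show ?thesis
        using quotient_space_smult[OF W _ F_cocycle[OF b], of s] by simp
    qed
    show "b \<longlonglongrightarrow> 0" if b: "Bseq b" and zero: "?B +>\<^bsub>?Z\<^esub> F b = \<zero>\<^bsub>quotient_space ?Z ?B\<^esub>" for b
    proof -
      have "F b \<in> ?B"
        using zero quotient_space_coset_eq_zero[OF W F_cocycle[OF b]] by (simp add: quotient_space_zero[OF W])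
      then obtain f where f: "f \<in> carrier (hom_space G \<rho> V (P k))"
        and Ff: "F b = (\<lambda>y \<in> carrier (P n). f (d k y))"
        by (auto simp: k coboundaries_def)
      have f_hom: "f \<in> lin_hom ?R (P k) (integral_module \<rho> V)"
        using f by (simp add: hom_space_carrier[OF V N commute])
      have "d k (u n) \<in> span_multiples ?x (P k) n"
        using du[of k] u(1)[of k] by (auto simp: k)
      then have "f (d k (u n)) \<in> span_multiples ?x (integral_module \<rho> V) n"
        by (rule span_multiples_hom[OF resolution_module[OF comm res]
              module_if_left_module[OF cring_group_ring[OF comm] N] x(1) f_hom])
      moreover have "f (d k (u n)) = F b (u n)" using Ff u(1)[of n] by simp
      ultimately have "(\<lambda>\<beta>. convolution G (\<lambda>g. of_int (c (u n) g)) (lacunary_operator n b \<beta>))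
          \<in> span_multiples ?x (integral_module \<rho> V) n"
        using u(1)[of n] by (simp add: F_def)
      moreover obtain B where "\<And>m. cmod (b m) \<le> B" using b unfolding Bseq_def by auto
      ultimately show ?thesis
        using lacunary_coefficients_tendsto_zero[OF n, of b B "c (u n)"] cR[OF u(1)] aug
        by (simp add: G_def \<rho>_def V_def)
    qed
  qed
qed

end
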